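(* Let $m\ge 2$. With all algebras realized as subspaces of $L_{\widehat{\mathfrak{so}}_{(2m+1)n}}(1,0)$ as in the context and $G=\langle\sigma_1,\dots,\sigma_n\rangle$, one has, for $n=3$, $$C_{L_{\widehat{\mathfrak{so}}_{2m+1}}(1,0)^{\otimes 3}}\bigl(L_{\widehat{\mathfrak{so}}_{2m+1}}(3,0)\bigr)=L_{\widehat{\mathfrak{sl}}_2}(4m+2,0)^{G},$$ and, for every $n\ge 4$, $$C_{L_{\widehat{\mathfrak{so}}_{2m+1}}(1,0)^{\otimes n}}\bigl(L_{\widehat{\mathfrak{so}}_{2m+1}}(n,0)\bigr)=L_{\widehat{\mathfrak{so}}_{n}}(2m+1,0)^{G}.$$
   Context: Commutant: for a vertex operator algebra $V$ and a vertex subalgebra $U$, $C_V(U)=\{v\in V: u_k v=0 \text{ for all } u\in U,\ k\ge 0\}$. Affine notation: $L_{\widehat{\mathfrak{so}}_r}(k,0)$ is the simple affine vertex operator algebra of level $k$ attached to $\mathfrak{so}_r(\mathbb C)$ (for $r=4$, $\mathfrak{so}_4\cong\mathfrak{sl}_2\oplus\mathfrak{sl}_2$ and $L_{\widehat{\mathfrak{so}}_4}(k,0)=L_{\widehat{\mathfrak{sl}}_2}(k,0)\otimes L_{\widehat{\mathfrak{sl}}_2}(k,0)$). $L_{\widehat{\mathfrak{sl}}_2}(k,0)$ is the simple affine vertex operator algebra of level $k$ attached to $\mathfrak{sl}_2(\mathbb C)$. Fermionic realization: let $\mathcal F_{(2m+1)n}$ be the irreducible module, generated by a vector $\mathbf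 1$ with $\psi_{ki}(r)\mathbf 1=0$ for $r>0$, over the Clifford algebra with generators $\psi_{ki}(r)$ ($1\le k\le 2m+1$, $1\le i\le n$, $r\in\mathbb Z+\frac12$) and relations $\psi_{ki}(r)\psi_{lj}(s)+\psi_{lj}(s)\psi_{ki}(r)=\delta_{kl}\delta_{ij}\delta_{r+s,0}$. It is a simple vertex superalgebra generated by the fields $\psi_{ki}(z)=\sum_{r\in\mathbb Z}\psi_{ki}(r+\frac12)z^{-r-1}$, and its even part is identified with $L_{\widehat{\mathfrak{so}}_{(2m+1)n}}(1,0)$. Inside it: - For $1\le j\le n$, the vertex subalgebra $L^{(j)}_{\widehat{\mathfrak{so}}_{2m+1}}(1,0)\cong L_{\widehat{\mathfrak{so}}_{2m+1}}(1,0)$ is generated by $\psi_{kj}(-\frac12)\psi_{lj}(-\frac12)\mathbf 1$, $1\le k,l\le 2m+1$, and $L_{\widehat{\mathfrak{so}}_{2m+1}}(1,0)^{\otimes n}$ is identified with $L^{(1)}_{\widehat{\mathfrak{so}}_{2m+1}}(1,0)\otimes\cdots\otimes L^{(n)}_{\widehat{\mathfrak{so}}_{2m+1}}(1,0)$. - $L_{\widehat{\mathfrak{so}}_{2m+1}}(n,0)$ denotes the (diagonal) vertex subalgebra generated by $\sum_{j=1}^n\psi_{kj}(-\frac12)\psi_{lj}(-\frac12)\mathbf 1$, $1\le k,l\le 2m+1$. - $L_{\widehat{\mathfrak{so}}_{n}}(2m+1,0)$ denotes the vertex subalgebra generated by $\sum_{k=1}^{2m+1}\psi_{ki}(-\frac12)\psi_{kj}(-\frac12)\mathbf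 1$, $1\le i,j\le n$. For $n=3$ it is isomorphic to, and denoted, $L_{\widehat{\mathfrak{sl}}_2}(4m+2,0)$. For $1\le i\le n$, $\sigma_i$ is the automorphism of $L_{\widehat{\mathfrak{so}}_{(2m+1)n}}(1,0)$ of order at most two determined by $\sigma_i(\psi_{kj}(-\frac12)\psi_{rs}(-\frac12)\mathbf 1)=(-1)^{\delta_{ij}+\delta_{is}}\psi_{kj}(-\frac12)\psi_{rs}(-\frac12)\mathbf 1$. The group $G$ acts on the subspaces above, and $(\cdot)^G$ denotes $G$-fixed points. *)

theory Defs
  imports
    Complex_Main
    "HOL-Library.Groups_Big_Fun"
    "HOL-Algebra.Bij"
    "HOL-Algebra.Generated_Groups"
begin

section \<open>Vertex superalgebras\<close>

text \<open>
  \<open>Y u k v\<close> is the mode \<open>u\<^sub>k v\<close>, with \<open>Y(u,z) = \<Sum>\<^sub>k u\<^sub>k z\<^sup>-\<^sup>k\<^sup>-\<^sup>1\<close>.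
  \<open>V False\<close> is the even part and \<open>V True\<close> the odd part.  The last axiom is the Jacobi identity in
  component form (Borcherds identity).  By truncation both sums over \<open>j\<close> have only finitely many
  nonzero terms, so that \<^const>\<open>Sum_any\<close> is the intended sum.
\<close>

locale vertex_superalgebra = vector_space scale
  for scale :: "complex \<Rightarrow> 'v::ab_group_add \<Rightarrow> 'v" (infixr "*s" 75) +
  fixes V :: "bool \<Rightarrow> 'v set"
    and Y :: "'v \<Rightarrow> int \<Rightarrow> 'v \<Rightarrow> 'v"
    and vac :: 'v
  assumes parity_subspace: "subspace (V p)"
    and parity_disjoint: "V False \<inter> V True = {0}"
    and parity_sum: "\<exists>u\<in>V False. \<exists>v\<in>V True. w = u + v"
    and mode_linear_left: "Vector_Spaces.linear scale scale (\<lambda>u. Y u k v)"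
    and mode_linear_right: "Vector_Spaces.linear scale scale (Y u k)"
    and mode_parity: "u \<in> V p \<Longrightarrow> v \<in> V q \<Longrightarrow> Y u k v \<in> V (p \<noteq> q)"
    and truncation: "\<exists>N. \<forall>k\<ge>N. Y u k v = 0"
    and vac_even: "vac \<in> V False"
    and vac_mode: "Y vac k v = (if k = -1 then v else 0)"
    and creation: "Y u (-1) vac = u" "k \<ge> 0 \<Longrightarrow> Y u k vac = 0"
    and borcherds: "u \<in> V p \<Longrightarrow> v \<in> V q \<Longrightarrow>
      Sum_any (\<lambda>j::nat. (of_int a gchoose j) *s Y (Y u (c + int j) v) (a + b - int j) w) =
      Sum_any (\<lambda>j::nat. ((-1) ^ j * (of_int c gchoose j)) *s
        (Y u (a + c - int j) (Y v (b + int j) w)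
         - ((-1) powi c * (-1) ^ of_bool (p \<and> q)) *s
             Y v (b + c - int j) (Y u (a + int j) w)))"

definition vertex_subalgebra ::
  "(complex \<Rightarrow> 'v::ab_group_add \<Rightarrow> 'v) \<Rightarrow> ('v \<Rightarrow> int \<Rightarrow> 'v \<Rightarrow> 'v) \<Rightarrow> 'v \<Rightarrow> 'v set \<Rightarrow> bool"
  where "vertex_subalgebra scale Y vac U \<longleftrightarrow>
    module.subspace scale U \<and> vac \<in> U \<and> (\<forall>u\<in>U. \<forall>v\<in>U. \<forall>k. Y u k v \<in> U)"

definition generated_subalgebra ::
  "(complex \<Rightarrow> 'v::ab_group_add \<Rightarrow> 'v) \<Rightarrow> ('v \<Rightarrow> int \<Rightarrow> 'v \<Rightarrow> 'v) \<Rightarrow> 'v \<Rightarrow> 'v set \<Rightarrow> 'v set"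
  where "generated_subalgebra scale Y vac S = vertex_subalgebra scale Y vac hull S"

definition commutant :: "('v::zero \<Rightarrow> int \<Rightarrow> 'v \<Rightarrow> 'v) \<Rightarrow> 'v set \<Rightarrow> 'v set \<Rightarrow> 'v set"
  where "commutant Y W U = {v\<in>W. \<forall>u\<in>U. \<forall>k\<ge>0. Y u k v = 0}"

text \<open>
  Automorphisms of a vertex subalgebra \<open>W\<close>, as elements of \<^term>\<open>BijGroup W\<close> (whose elements are
  required to be extensional outside \<open>W\<close>).
\<close>

definition vertex_automorphisms ::
  "(complex \<Rightarrow> 'v::ab_group_add \<Rightarrow> 'v) \<Rightarrow> ('v \<Rightarrow> int \<Rightarrow> 'v \<Rightarrow> 'v) \<Rightarrow> 'v \<Rightarrow> 'v set \<Rightarrow> ('v \<Rightarrow> 'v) set"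
  where "vertex_automorphisms scale Y vac W = {f \<in> Bij W.
    (\<forall>u\<in>W. \<forall>v\<in>W. f (u + v) = f u + f v) \<and>
    (\<forall>c. \<forall>u\<in>W. f (scale c u) = scale c (f u)) \<and>
    f vac = vac \<and>
    (\<forall>u\<in>W. \<forall>v\<in>W. \<forall>k. f (Y u k v) = Y (f u) k (f v))}"

definition fixed_points :: "('v \<Rightarrow> 'v) set \<Rightarrow> 'v set \<Rightarrow> 'v set"
  where "fixed_points G X = {v\<in>X. \<forall>g\<in>G. g v = v}"


section \<open>The fermionic vertex superalgebra\<close>

text \<open>
  The half-integral modes are indexed by integers: \<open>psi k i r\<close> stands for \<open>\<psi>\<^sub>k\<^sub>i(r + 1/2)\<close>.  Hence
  \<open>\<psi>\<^sub>k\<^sub>i(-1/2)\<close> is \<open>psi k i (-1)\<close>, the annihilation operators are those with \<open>r \<ge> 0\<close>, and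
  \<open>(r + 1/2) + (s + 1/2) = 0\<close> reads \<open>r + s = -1\<close>.  The first index \<open>k\<close> runs over \<open>{1..N}\<close> and the
  second index \<open>i\<close> over \<open>{1..n}\<close>.
\<close>

locale clifford_fock_module = vector_space scale
  for scale :: "complex \<Rightarrow> 'v::ab_group_add \<Rightarrow> 'v" (infixr "*s" 75) +
  fixes N n :: nat
    and psi :: "nat \<Rightarrow> nat \<Rightarrow> int \<Rightarrow> 'v \<Rightarrow> 'v"
    and vac :: 'v
  assumes psi_linear: "k \<in> {1..N} \<Longrightarrow> i \<in> {1..n} \<Longrightarrow>
      Vector_Spaces.linear scale scale (psi k i r)"
    and anticommutation:
      "k \<in> {1..N} \<Longrightarrow> l \<in> {1..N} \<Longrightarrow> i \<in> {1..n} \<Longrightarrow> j \<in> {1..n} \<Longrightarrow>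
       psi k i r (psi l j s v) + psi l j s (psi k i r v) =
       (if k = l \<and> i = j \<and> r + s = -1 then v else 0)"
    and vac_nonzero: "vac \<noteq> 0"
    and annihilation: "k \<in> {1..N} \<Longrightarrow> i \<in> {1..n} \<Longrightarrow> r \<ge> 0 \<Longrightarrow> psi k i r vac = 0"
    and irreducible_module: "subspace U \<Longrightarrow>
      (\<And>k i r v. k \<in> {1..N} \<Longrightarrow> i \<in> {1..n} \<Longrightarrow> v \<in> U \<Longrightarrow> psi k i r v \<in> U) \<Longrightarrow>
      U = {0} \<or> U = UNIV"

text \<open>
  The field of the odd vector \<open>\<psi>\<^sub>k\<^sub>i(-1/2)1\<close> is \<open>\<Sum>\<^sub>r \<psi>\<^sub>k\<^sub>i(r + 1/2) z\<^sup>-\<^sup>r\<^sup>-\<^sup>1\<close>.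
\<close>

locale fermionic_vertex_superalgebra =
  vertex_superalgebra scale V Y vac + clifford_fock_module scale N n psi vac
  for scale :: "complex \<Rightarrow> 'v::ab_group_add \<Rightarrow> 'v" (infixr "*s" 75)
    and V :: "bool \<Rightarrow> 'v set"
    and Y :: "'v \<Rightarrow> int \<Rightarrow> 'v \<Rightarrow> 'v"
    and vac :: 'v
    and N n :: nat
    and psi :: "nat \<Rightarrow> nat \<Rightarrow> int \<Rightarrow> 'v \<Rightarrow> 'v" +
  assumes psi_odd: "k \<in> {1..N} \<Longrightarrow> i \<in> {1..n} \<Longrightarrow> psi k i (-1) vac \<in> V True"
    and psi_field: "k \<in> {1..N} \<Longrightarrow> i \<in> {1..n} \<Longrightarrow> Y (psi k i (-1) vac) r = psi k i r"


section \<open>The subalgebras and the automorphisms\<close>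

text \<open>\<open>\<psi>\<^sub>k\<^sub>i(-1/2) \<psi>\<^sub>l\<^sub>j(-1/2) 1\<close>\<close>

definition quad :: "(nat \<Rightarrow> nat \<Rightarrow> int \<Rightarrow> 'v \<Rightarrow> 'v) \<Rightarrow> 'v \<Rightarrow> nat \<Rightarrow> nat \<Rightarrow> nat \<Rightarrow> nat \<Rightarrow> 'v"
  where "quad psi vac k i l j = psi k i (-1) (psi l j (-1) vac)"

context
  fixes scale :: "complex \<Rightarrow> 'v::ab_group_add \<Rightarrow> 'v"
    and Y :: "'v \<Rightarrow> int \<Rightarrow> 'v \<Rightarrow> 'v"
    and vac :: 'v
    and psi :: "nat \<Rightarrow> nat \<Rightarrow> int \<Rightarrow> 'v \<Rightarrow> 'v"
begin

definition so_factor :: "nat \<Rightarrow> nat \<Rightarrow> 'v set"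
  where "so_factor N j = generated_subalgebra scale Y vac
    {quad psi vac k j l j | k l. k \<in> {1..N} \<and> l \<in> {1..N}}"

text \<open>
  The tensor product \<open>L\<^sup>(\<^sup>1\<^sup>) \<otimes> \<dots> \<otimes> L\<^sup>(\<^sup>n\<^sup>)\<close> as a subspace: the image of the canonical map
  \<open>u\<^sub>1 \<otimes> \<dots> \<otimes> u\<^sub>n \<mapsto> (u\<^sub>1)\<^sub>-\<^sub>1 \<dots> (u\<^sub>n)\<^sub>-\<^sub>1 1\<close>.
\<close>

definition so_tensor_power :: "nat \<Rightarrow> nat \<Rightarrow> 'v set"
  where "so_tensor_power N n = module.span scale
    {foldr (\<lambda>j. Y (u j) (-1)) [1..<Suc n] vac | u. \<forall>j\<in>{1..n}. u j \<in> so_factor N j}"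

text \<open>The diagonal \<open>L\<^bsub>so_N\<^esub>(n,0)\<close>\<close>

definition so_diagonal :: "nat \<Rightarrow> nat \<Rightarrow> 'v set"
  where "so_diagonal N n = generated_subalgebra scale Y vac
    {(\<Sum>j=1..n. quad psi vac k j l j) | k l. k \<in> {1..N} \<and> l \<in> {1..N}}"

text \<open>The level-rank dual \<open>L\<^bsub>so_n\<^esub>(N,0)\<close>; for \<open>n = 3\<close> it is also denoted \<open>L\<^bsub>sl_2\<^esub>(2N,0)\<close>.\<close>

definition so_dual :: "nat \<Rightarrow> nat \<Rightarrow> 'v set"
  where "so_dual N n = generated_subalgebra scale Y vac
    {(\<Sum>k=1..N. quad psi vac k i k j) | i j. i \<in> {1..n} \<and> j \<in> {1..n}}"

definition sl2_dual :: "nat \<Rightarrow> 'v set"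
  where "sl2_dual N = so_dual N 3"

end

definition is_sigma ::
  "(complex \<Rightarrow> 'v::ab_group_add \<Rightarrow> 'v) \<Rightarrow> ('v \<Rightarrow> int \<Rightarrow> 'v \<Rightarrow> 'v) \<Rightarrow> 'v \<Rightarrow>
   (nat \<Rightarrow> nat \<Rightarrow> int \<Rightarrow> 'v \<Rightarrow> 'v) \<Rightarrow> 'v set \<Rightarrow> nat \<Rightarrow> nat \<Rightarrow> nat \<Rightarrow> ('v \<Rightarrow> 'v) \<Rightarrow> bool"
  where "is_sigma scale Y vac psi W N n i f \<longleftrightarrow>
    f \<in> vertex_automorphisms scale Y vac W \<and>
    (\<forall>k\<in>{1..N}. \<forall>r\<in>{1..N}. \<forall>j\<in>{1..n}. \<forall>s\<in>{1..n}.
       f (quad psi vac k j r s) =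
       scale ((-1) ^ (of_bool (i = j) + of_bool (i = s))) (quad psi vac k j r s))"

end

theory Submission
  imports Defs "HOL-Library.Multiset"
begin

text \<open>
  The action of \<open>G\<close> and the commutant are treated separately.

  \<^bold>\<open>The tensor power.\<close>  All spaces are described by words in the creation operators of the fermions
  \<open>\<psi>\<^sub>k\<^sub>i\<close>.  An even word in at least three fermions lies in the vertex algebra generated by their
  quadratic vectors (\<open>even_word_mem\<close>): bilinear vectors with derivatives are produced by letting
  quadratic vectors act on each other, and products of two modes are combinations of modes of
  products.  Hence the \<open>j\<close>-th tensor factor contains all even words in the \<open>j\<close>-th column, and \<open>\<sigma>\<^sub>i\<close>
  multiplies a word by \<open>-1\<close> to the number of its letters in the \<open>i\<close>-th column.  A word with an even
  number of letters in every column is up to sign a product of even words, one for each column, so the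
  tensor power is exactly the space of vectors of the even part fixed by all \<open>\<sigma>\<^sub>i\<close>
  (\<open>tensor_power_eq_sigma_fixed\<close>).

  \<^bold>\<open>The commutant in the even part.\<close>  It remains to prove that, with \<open>N = 2m + 1\<close>, the commutant of the
  diagonal algebra of \<open>so\<^sub>N\<close> in the even part is the dual algebra of \<open>so\<^sub>n\<close>
  (\<open>commutant_even_eq_dual\<close>).  One inclusion holds because the currents of the two algebras commute.
  For the other one let \<open>v\<close> be an invariant, that is, an even vector killed by all modes \<open>r \<ge> 0\<close> of the
  diagonal currents.  The Sugawara vectors of the two algebras add up to a multiple of the conformal
  vector of the fermions (\<open>sugawara_vector\<close>).  On \<open>v\<close> the diagonal currents drop out of this identity,
  and it says that \<open>defect v\<close>, a combination of the conformal weight operator and the Casimir operator of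
  \<open>so\<^sub>n\<close> applied to \<open>v\<close>, is a sum of terms \<open>J(-r) J(r) v\<close> with \<open>r > 0\<close> and dual currents \<open>J\<close>.  The
  vectors \<open>J(r) v\<close> are invariants of smaller weight, so by induction \<open>defect\<close> maps invariants into the dual
  algebra.

  If \<open>defect\<close> has no eigenvalue \<open>0\<close> in positive weight, then \<open>v\<close> itself lies in the dual algebra.  The
  eigenvalues are read off from a triangular form: in a basis in which the quadratic form of \<open>\<complex>\<^sup>n\<close> is
  antidiagonal, the raising operators of \<open>so\<^sub>n\<close> increase the height of a word, and \<open>defect\<close> is triangular
  with respect to it (\<open>defect_word\<close>).  The diagonal entries are positive by an elementary inequality
  between the energy of a word without repeated letters and the Casimir value of its weight
  (\<open>casimir_estimate\<close>).  Equality in it forces twice the conformal weight to be \<open>0\<close> or \<open>N\<close>, and the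
  words of the second kind are odd because \<open>N = 2m + 1\<close> is.
\<close>

section \<open>Modes of products\<close>

lemma Sum_any_lessThan:
  fixes f :: "nat \<Rightarrow> 'a::comm_monoid_add"
  assumes "\<And>j. j \<ge> m \<Longrightarrow> f j = 0"
  shows "Sum_any f = sum f {..<m}"
  by (rule Sum_any.expand_superset) (use assms in \<open>auto simp: not_less[symmetric]\<close>)

context vertex_superalgebra
begin

lemma mode_simps [simp]:
  "Y (u + v) k w = Y u k w + Y v k w"
  "Y (u - v) k w = Y u k w - Y v k w"
  "Y (- u) k w = - Y u k w"
  "Y 0 k w = 0"
  "Y (c *s u) k w = c *s Y u k w"
  "Y u k (v + w) = Y u k v + Y u k w"
  "Y u k (v - w) = Y u k v - Y u k w"
  "Y u k (- w) = - Y u k w"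
  "Y u k 0 = 0"
  "Y u k (c *s w) = c *s Y u k w"
proof -
  interpret L: Vector_Spaces.linear scale scale "\<lambda>u. Y u k w" for k w
    by (rule mode_linear_left)
  interpret R: Vector_Spaces.linear scale scale "Y u k" for u k
    by (rule mode_linear_right)
  show "Y (u + v) k w = Y u k w + Y v k w"
    "Y (u - v) k w = Y u k w - Y v k w"
    "Y (- u) k w = - Y u k w"
    "Y 0 k w = 0"
    "Y (c *s u) k w = c *s Y u k w"
    "Y u k (v + w) = Y u k v + Y u k w"
    "Y u k (v - w) = Y u k v - Y u k w"
    "Y u k (- w) = - Y u k w"
    "Y u k 0 = 0"
    "Y u k (c *s w) = c *s Y u k w"
    by (simp_all add: L.add L.diff L.neg L.zero L.scale R.add R.diff R.neg R.zero R.scale)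
qed

lemma mode_sum_left: "Y (\<Sum>i\<in>A. f i) k w = (\<Sum>i\<in>A. Y (f i) k w)"
  by (induction A rule: infinite_finite_induct) simp_all

lemma mode_sum_right: "Y u k (\<Sum>i\<in>A. f i) = (\<Sum>i\<in>A. Y u k (f i))"
  by (induction A rule: infinite_finite_induct) simp_all

lemma subspace_Sum_any:
  assumes "subspace S" "\<And>j. f j \<in> S"
  shows "Sum_any f \<in> S"
  unfolding Sum_any.expand_set using assms by (intro subspace_sum) auto

lemma even_odd_eq_0: "u \<in> V False \<Longrightarrow> u \<in> V True \<Longrightarrow> u = 0"
  using parity_disjoint by blast

text \<open>
  With \<open>a = 0\<close> the Borcherds identity expands the modes of a product; with \<open>c = 0\<close> it is the
  commutator formula.
\<close>

lemma normal_order: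
  assumes "u \<in> V p" "v \<in> V q"
  shows "Y (Y u c v) b w =
    Sum_any (\<lambda>j::nat. ((-1) ^ j * (of_int c gchoose j)) *s
        (Y u (c - int j) (Y v (b + int j) w)
         - ((-1) powi c * (-1) ^ of_bool (p \<and> q)) *s Y v (b + c - int j) (Y u (int j) w)))"
proof -
  have "Sum_any (\<lambda>j::nat. (of_int 0 gchoose j) *s Y (Y u (c + int j) v) (0 + b - int j) w) =
     Sum_any (\<lambda>j::nat. if j = 0 then Y (Y u (c + int j) v) (0 + b - int j) w else 0)"
    by (rule Sum_any.cong) (simp add: gbinomial_0_left)
  with borcherds[OF assms, where a=0 and b=b and c=c and w=w] show ?thesis
    by simp
qed

lemma mode_commutator:
  assumes "u \<in> V False" "v \<in> V q" and vanish: "\<And>j. j \<ge> m \<Longrightarrow> Y u (int j) v = 0"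
  shows "Y u r (Y v s w) = Y v s (Y u r w) +
    (\<Sum>j<m. (of_int r gchoose j) *s Y (Y u (int j) v) (r + s - int j) w)"
proof -
  have "Sum_any (\<lambda>j::nat. ((-1) ^ j * (of_int 0 gchoose j)) *s
        (Y u (r + 0 - int j) (Y v (s + int j) w)
         - ((-1) powi 0 * (-1) ^ of_bool (False \<and> q)) *s
             Y v (s + 0 - int j) (Y u (r + int j) w))) =
     Sum_any (\<lambda>j::nat. if j = 0 then Y u r (Y v s w) - Y v s (Y u r w) else 0)"
    by (rule Sum_any.cong) (simp add: gbinomial_0_left)
  also have "\<dots> = Y u r (Y v s w) - Y v s (Y u r w)"
    by (rule Sum_any.delta)
  finally have "Y u r (Y v s w) - Y v s (Y u r w) =
      Sum_any (\<lambda>j::nat. (of_int r gchoose j) *s Y (Y u (0 + int j) v) (r + s - int j) w)"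
    using borcherds[OF assms(1,2), where a=r and b=s and c=0 and w=w] by simp
  also have "\<dots> = (\<Sum>j<m. (of_int r gchoose j) *s Y (Y u (0 + int j) v) (r + s - int j) w)"
    by (rule Sum_any_lessThan) (simp add: vanish)
  finally show ?thesis by (simp add: algebra_simps)
qed

lemma zero_mode_derivation:
  assumes "u \<in> V False" "v \<in> V q"
  shows "Y u 0 (Y v s w) = Y v s (Y u 0 w) + Y (Y u 0 v) s w"
proof -
  obtain B where B: "\<And>k. k \<ge> B \<Longrightarrow> Y u k v = 0" using truncation by blast
  have "Y u 0 (Y v s w) = Y v s (Y u 0 w) +
      (\<Sum>j<Suc (nat B). (of_int 0 gchoose j) *s Y (Y u (int j) v) (0 + s - int j) w)"
    by (rule mode_commutator[OF assms]) (use B in auto)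
  also have "(\<Sum>j<Suc (nat B). (of_int 0 gchoose j) *s Y (Y u (int j) v) (0 + s - int j) w) = Y (Y u 0 v) s w"
    by (subst sum.lessThan_Suc_shift) (simp add: gbinomial_0_left)
  finally show ?thesis .
qed

lemma Sum_any_minus_head_mem:
  assumes S: "subspace S" and fin: "\<And>j. j \<ge> m \<Longrightarrow> f j = 0" and mem: "\<And>j::nat. j \<ge> 1 \<Longrightarrow> f j \<in> S"
  shows "Sum_any f - f 0 \<in> S"
proof -
  have "Sum_any f = sum f {..<Suc m}"
    by (rule Sum_any_lessThan) (simp add: fin)
  also have "\<dots> = f 0 + (\<Sum>j<m. f (Suc j))"
    by (rule sum.lessThan_Suc_shift)
  finally show ?thesis
    using S mem by (simp add: subspace_sum)
qed

text \<open>
  Products of two modes are linear combinations of modes of products.  One takes \<open>a\<close> in the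
  Borcherds identity so large that the second half of the right-hand side dies; what remains
  expresses \<open>u\<^sub>r v\<^sub>s w\<close> through modes of products and through \<open>u\<^bsub>r-j\<^esub> v\<^bsub>s+j\<^esub> w\<close> with \<open>j > 0\<close>, and the
  latter vanish for large \<open>j\<close>.
\<close>

lemma mode_mode_mem:
  assumes u: "u \<in> V p" and v: "v \<in> V q" and S: "subspace S"
    and mem: "\<And>i j. Y (Y u i v) j w \<in> S"
  shows "Y u r (Y v s w) \<in> S"
proof -
  obtain A where A: "\<And>k. k \<ge> A \<Longrightarrow> Y u k w = 0" using truncation by blast
  obtain B where B: "\<And>k. k \<ge> B \<Longrightarrow> Y v k w = 0" using truncation by blast
  show ?thesis
  proof (induction "nat (B - s)" arbitrary: r s rule: less_induct)
    case less
    define f where "f = (\<lambda>j::nat. ((-1) ^ j * (of_int (r - A) gchoose j)) *s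
        (Y u (A + (r - A) - int j) (Y v (s + int j) w)
         - ((-1) powi (r - A) * (-1) ^ of_bool (p \<and> q)) *s
             Y v (s + (r - A) - int j) (Y u (A + int j) w)))"
    have f: "f j = ((-1) ^ j * (of_int (r - A) gchoose j)) *s Y u (r - int j) (Y v (s + int j) w)" for j
      unfolding f_def by (simp add: A)
    have "Sum_any (\<lambda>j::nat. (of_int A gchoose j) *s Y (Y u (r - A + int j) v) (A + s - int j) w) \<in> S"
      using S mem by (intro subspace_Sum_any subspace_scale) auto
    then have sum: "Sum_any f \<in> S"
      using borcherds[OF u v, where a=A and b=s and c="r - A" and w=w] unfolding f_def by simp
    have "f j \<in> S" if "j \<ge> 1" for j
    proof (cases "s + int j \<ge> B")
      case True
      then show ?thesis using S by (simp add: f B subspace_0)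
    next
      case False
      then have "nat (B - (s + int j)) < nat (B - s)" using that by auto
      from less[OF this] show ?thesis using S by (simp add: f subspace_scale)
    qed
    moreover have "f j = 0" if "j \<ge> nat (B - s)" for j
      using that by (simp add: f B)
    ultimately have "Sum_any f - f 0 \<in> S"
      by (intro Sum_any_minus_head_mem[OF S])
    with sum have "f 0 \<in> S"
      using subspace_diff[OF S, of "Sum_any f" "Sum_any f - f 0"] by simp
    then show ?case by (simp add: f)
  qed
qed

section \<open>Generated subalgebras and commutants\<close>

lemma vertex_subalgebra_generated: "vertex_subalgebra scale Y vac (generated_subalgebra scale Y vac S)"
  unfolding generated_subalgebra_def
  by (rule hull_in) (auto simp: vertex_subalgebra_def intro!: subspace_Inter)

lemma generated_subset:
  "S \<subseteq> T \<Longrightarrow> vertex_subalgebra scale Y vac T \<Longrightarrow> generated_subalgebra scale Y vac S \<subseteq> T"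
  unfolding generated_subalgebra_def by (rule hull_minimal)

lemma generators_mem: "x \<in> S \<Longrightarrow> x \<in> generated_subalgebra scale Y vac S"
  unfolding generated_subalgebra_def by (rule hull_inc)

lemma vertex_subalgebra_even: "vertex_subalgebra scale Y vac (V False)"
  unfolding vertex_subalgebra_def
  using parity_subspace vac_even mode_parity[of _ False _ False] by auto

text \<open>
  The commutator of \<open>Y u k\<close>, \<open>k \<ge> 0\<close>, with a mode of \<open>x\<close> is a combination of modes of vectors
  \<open>Y u j x\<close> with \<open>j \<ge> 0\<close>.
\<close>

lemma vertex_subalgebra_annihilated_vectors:
  assumes "u \<in> V False"
  shows "vertex_subalgebra scale Y vac {v \<in> V False. \<forall>k\<ge>0. Y u k v = 0}"
  unfolding vertex_subalgebra_def
proof (intro conjI ballI allI)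
  show "subspace {v \<in> V False. \<forall>k\<ge>0. Y u k v = 0}"
    using parity_subspace[of False] by (auto simp: subspace_def)
  show "vac \<in> {v \<in> V False. \<forall>k\<ge>0. Y u k v = 0}"
    by (simp add: vac_even creation)
  fix x y m
  assume x: "x \<in> {v \<in> V False. \<forall>k\<ge>0. Y u k v = 0}" and y: "y \<in> {v \<in> V False. \<forall>k\<ge>0. Y u k v = 0}"
  have "Y u k (Y x m y) = 0" if "k \<ge> 0" for k
    using mode_commutator[of u x False 0 k m y] assms x y that by simp
  then show "Y x m y \<in> {v \<in> V False. \<forall>k\<ge>0. Y u k v = 0}"
    using x y mode_parity[of x False y False m] by simp
qed

text \<open>
  For \<open>k \<ge> 0\<close> every summand in the expansion of \<open>Y (Y x m y) k v\<close> begins by applying a mode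
  \<open>j \<ge> 0\<close> of \<open>x\<close> or of \<open>y\<close> to \<open>v\<close>.
\<close>

lemma vertex_subalgebra_annihilators:
  "vertex_subalgebra scale Y vac {u \<in> V False. \<forall>k\<ge>0. Y u k v = 0}"
  unfolding vertex_subalgebra_def
proof (intro conjI ballI allI)
  show "subspace {u \<in> V False. \<forall>k\<ge>0. Y u k v = 0}"
    using parity_subspace[of False] by (auto simp: subspace_def)
  show "vac \<in> {u \<in> V False. \<forall>k\<ge>0. Y u k v = 0}"
    by (simp add: vac_even vac_mode)
  fix x y m
  assume x: "x \<in> {u \<in> V False. \<forall>k\<ge>0. Y u k v = 0}" and y: "y \<in> {u \<in> V False. \<forall>k\<ge>0. Y u k v = 0}"
  have "Y (Y x m y) k v = 0" if "k \<ge> 0" for k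
    using normal_order[of x False y False m k v] x y that by simp
  then show "Y x m y \<in> {u \<in> V False. \<forall>k\<ge>0. Y u k v = 0}"
    using x y mode_parity[of x False y False m] by simp
qed

text \<open>
  Whether a vector commutes with a generated subalgebra can be tested on the generators, in both
  arguments.
\<close>

lemma annihilated_by_generated:
  assumes "S \<subseteq> V False" "\<And>u k. u \<in> S \<Longrightarrow> k \<ge> 0 \<Longrightarrow> Y u k v = 0"
    "u \<in> generated_subalgebra scale Y vac S" "k \<ge> 0"
  shows "Y u k v = 0"
proof -
  have "generated_subalgebra scale Y vac S \<subseteq> {u \<in> V False. \<forall>k\<ge>0. Y u k v = 0}"
    using assms by (intro generated_subset vertex_subalgebra_annihilators) auto
  with assms show ?thesis by blast
qed

lemma annihilates_generated:
  assumes "S \<subseteq> V False" "u \<in> V False" "\<And>v k. v \<in> S \<Longrightarrow> k \<ge> 0 \<Longrightarrow> Y u k v = 0"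
    "v \<in> generated_subalgebra scale Y vac S" "k \<ge> 0"
  shows "Y u k v = 0"
proof -
  have "generated_subalgebra scale Y vac S \<subseteq> {v \<in> V False. \<forall>k\<ge>0. Y u k v = 0}"
    using assms by (intro generated_subset vertex_subalgebra_annihilated_vectors) auto
  with assms show ?thesis by blast
qed

end

section \<open>Free fermions\<close>

lemma gbinomial_minus_one: "(-1) ^ j * ((- 1 :: complex) gchoose j) = 1"
proof -
  have "((- 1 :: complex) gchoose j) = (-1) ^ j * (of_nat j gchoose j)"
    by (subst gbinomial_negated_upper) simp
  also have "(of_nat j gchoose j :: complex) = 1"
    by (simp flip: binomial_gbinomial)
  finally show ?thesis by (simp flip: power_mult_distrib)
qed

lemma gbinomial_minus_two: "(-1) ^ j * ((- 2 :: complex) gchoose j) = of_nat j + 1"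
proof -
  have "((- 2 :: complex) gchoose j) = (-1) ^ j * (of_nat (Suc j) gchoose j)"
    by (subst gbinomial_negated_upper) (simp add: algebra_simps)
  also have "(of_nat (Suc j) gchoose j :: complex) = of_nat (Suc j)"
    by (simp flip: binomial_gbinomial del: of_nat_Suc)
  finally show ?thesis by (simp flip: power_mult_distrib add: mult.assoc[symmetric] add.commute)
qed

text \<open>A letter \<open>(a, t)\<close> stands for the creation operator \<open>\<phi> a (-1 - t)\<close>.\<close>

definition creation_word :: "('a \<Rightarrow> int \<Rightarrow> 'v \<Rightarrow> 'v) \<Rightarrow> ('a \<times> nat) list \<Rightarrow> 'v \<Rightarrow> 'v"
  where "creation_word \<phi> xs v = foldr (\<lambda>x. \<phi> (fst x) (- 1 - int (snd x))) xs v"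

lemma creation_word_simps [simp]:
  "creation_word \<phi> [] v = v"
  "creation_word \<phi> (x # xs) v = \<phi> (fst x) (- 1 - int (snd x)) (creation_word \<phi> xs v)"
  "creation_word \<phi> (xs @ ys) v = creation_word \<phi> xs (creation_word \<phi> ys v)"
  by (simp_all add: creation_word_def)

text \<open>Twice the conformal weight of a creation word.\<close>

definition energy :: "('a \<times> nat) list \<Rightarrow> int"
  where "energy xs = (\<Sum>x\<leftarrow>xs. 2 * int (snd x) + 1)"

lemma energy_simps [simp]:
  "energy [] = 0" "energy (x # xs) = 2 * int (snd x) + 1 + energy xs"
  by (simp_all add: energy_def)

lemma even_energy_iff: "even (energy xs) \<longleftrightarrow> even (length xs)"
  by (induction xs) auto

lemma energy_ge_length: "energy xs \<ge> int (length xs)"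
  by (induction xs) auto

context fermionic_vertex_superalgebra
begin

abbreviation Idx :: "(nat \<times> nat) set" where "Idx \<equiv> {1..N} \<times> {1..n}"

definition Psi :: "nat \<times> nat \<Rightarrow> int \<Rightarrow> 'v \<Rightarrow> 'v"
  where "Psi a = psi (fst a) (snd a)"

lemma Psi_pair: "psi k i = Psi (k, i)"
  by (simp add: Psi_def)

lemma Psi_linear:
  assumes "a \<in> Idx"
  shows "Psi a r (u + v) = Psi a r u + Psi a r v" "Psi a r (u - v) = Psi a r u - Psi a r v"
    "Psi a r (- v) = - Psi a r v" "Psi a r 0 = 0" "Psi a r (c *s v) = c *s Psi a r v"
proof -
  interpret L: Vector_Spaces.linear scale scale "Psi a r" for r
    using psi_linear assms by (auto simp: Psi_def)
  show "Psi a r (u + v) = Psi a r u + Psi a r v" "Psi a r (u - v) = Psi a r u - Psi a r v"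
    "Psi a r (- v) = - Psi a r v" "Psi a r 0 = 0" "Psi a r (c *s v) = c *s Psi a r v"
    by (simp_all add: L.add L.diff L.neg L.zero L.scale)
qed

lemma Psi_sum: "a \<in> Idx \<Longrightarrow> Psi a r (\<Sum>i\<in>A. f i) = (\<Sum>i\<in>A. Psi a r (f i))"
  by (induction A rule: infinite_finite_induct) (simp_all add: Psi_linear)

lemma Psi_anticommute:
  assumes "a \<in> Idx" "b \<in> Idx"
  shows "Psi a r (Psi b s v) = - Psi b s (Psi a r v) + (if a = b \<and> r + s = -1 then v else 0)"
proof -
  have "Psi a r (Psi b s v) + Psi b s (Psi a r v) = (if a = b \<and> r + s = -1 then v else 0)"
    unfolding Psi_def using assms by (subst anticommutation) (auto simp: prod_eq_iff)
  then show ?thesis by (simp add: algebra_simps)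
qed

lemma Psi_square_0:
  assumes "a \<in> Idx" "r + r \<noteq> -1"
  shows "Psi a r (Psi a r v) = 0"
proof -
  have "Psi a r (Psi a r v) = - Psi a r (Psi a r v)"
    using Psi_anticommute[of a a r r v] assms by auto
  then have "2 *s Psi a r (Psi a r v) = 0"
    using scale_left_distrib[of 1 1 "Psi a r (Psi a r v)"] by (simp add: eq_neg_iff_add_eq_0)
  then show ?thesis by simp
qed

lemma Psi_vac: "a \<in> Idx \<Longrightarrow> r \<ge> 0 \<Longrightarrow> Psi a r vac = 0"
  using annihilation by (auto simp: Psi_def)

lemma Psi_mode: "a \<in> Idx \<Longrightarrow> Y (Psi a (-1) vac) r = Psi a r"
  using psi_field by (auto simp: Psi_def)

lemma Psi_vac_odd: "a \<in> Idx \<Longrightarrow> Psi a (-1) vac \<in> V True"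
  using psi_odd by (auto simp: Psi_def)

lemma Psi_parity: "a \<in> Idx \<Longrightarrow> v \<in> V q \<Longrightarrow> Psi a r v \<in> V (\<not> q)"
  using mode_parity[OF Psi_vac_odd, of a v q r] by (simp add: Psi_mode)

lemma Psi_annihilation_creation:
  assumes "a \<in> Idx" "b \<in> Idx" "r \<ge> 0"
  shows "Psi a r (Psi b s vac) = (if a = b \<and> r + s = -1 then vac else 0)"
  using Psi_anticommute[OF assms(1,2), of r s vac] assms by (simp add: Psi_vac Psi_linear)

lemma normal_order_Psi:
  assumes "a \<in> Idx" "v \<in> V q"
  shows "Y (Psi a c v) b w =
    Sum_any (\<lambda>j::nat. ((-1) ^ j * (of_int c gchoose j)) *s
        (Psi a (c - int j) (Y v (b + int j) w)
         - ((-1) powi c * (-1) ^ of_bool q) *s Y v (b + c - int j) (Psi a (int j) w)))"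
  using normal_order[OF Psi_vac_odd[OF assms(1)] assms(2), of c b w] assms by (simp add: Psi_mode)

lemma normal_order_Psi_1:
  assumes "a \<in> Idx" "v \<in> V True"
  shows "Y (Psi a (-1) v) b w =
    Sum_any (\<lambda>j::nat. Psi a (- 1 - int j) (Y v (b + int j) w) - Y v (b - 1 - int j) (Psi a (int j) w))"
proof -
  have [simp]: "((-1::complex) powi -1) = -1" by (simp add: power_int_def)
  show ?thesis
    unfolding normal_order_Psi[OF assms, where c="-1"]
    using gbinomial_minus_one by (intro Sum_any.cong) (simp add: algebra_simps)
qed

lemma normal_order_Psi_2:
  assumes "a \<in> Idx" "v \<in> V q"
  shows "Y (Psi a (-2) v) b w =
    Sum_any (\<lambda>j::nat. (of_nat j + 1) *s (Psi a (- 2 - int j) (Y v (b + int j) w)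
      - (-1) ^ of_bool q *s Y v (b - 2 - int j) (Psi a (int j) w)))"
proof -
  have [simp]: "((-1::complex) powi -2) = 1" by (simp add: power_int_def)
  show ?thesis
    unfolding normal_order_Psi[OF assms, where c="-2"]
    using gbinomial_minus_two by (intro Sum_any.cong) (simp add: algebra_simps)
qed

text \<open>
  The field of \<open>\<psi>\<^sub>a(-3/2)1\<close> is the derivative of the field of \<open>\<psi>\<^sub>a(-1/2)1\<close>.
\<close>

lemma translate_fermion_mode:
  assumes a: "a \<in> Idx"
  shows "Y (Psi a (-2) vac) m w = - of_int m *s Psi a (m - 1) w"
proof -
  define f where "f = (\<lambda>j::nat. (of_nat j + 1) *s (Psi a (- 2 - int j) (Y vac (m + int j) w)
      - (-1) ^ of_bool False *s Y vac (m - 2 - int j) (Psi a (int j) w)))"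
  have f: "f j = (if int j = - 1 - m \<or> int j = m - 1 then - of_int m *s Psi a (m - 1) w else 0)" for j
  proof -
    consider "m = - 1 - int j" | "m = int j + 1" | "int j \<noteq> - 1 - m" "int j \<noteq> m - 1" by linarith
    then show ?thesis
    proof cases
      case 1
      then have "f j = (of_nat j + 1) *s Psi a (- 2 - int j) w"
        by (simp add: f_def vac_mode)
      moreover have "complex_of_int m = - (of_nat j + 1)" "m - 1 = - 2 - int j" using 1 by simp_all
      ultimately show ?thesis using 1 by simp
    next
      case 2
      then have "f j = - ((of_nat j + 1) *s Psi a (int j) w)"
        using a by (simp add: f_def vac_mode Psi_linear)
      moreover have "complex_of_int m = of_nat j + 1" using 2 by simp
      ultimately show ?thesis using 2 by (simp flip: scale_minus_left)
    next
      case 3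
      then show ?thesis using a by (auto simp: f_def vac_mode Psi_linear)
    qed
  qed
  have "Y (Psi a (-2) vac) m w = Sum_any f"
    unfolding f_def by (rule normal_order_Psi_2[OF a vac_even])
  also have "\<dots> = - of_int m *s Psi a (m - 1) w"
  proof (cases "m = 0")
    case True
    then have "f j = 0" for j by (simp add: f)
    then show ?thesis using True by simp
  next
    case False
    define j0 where "j0 = (if m < 0 then nat (- 1 - m) else nat (m - 1))"
    have "f = (\<lambda>j. if j = j0 then - of_int m *s Psi a (m - 1) w else 0)"
      using False by (auto simp: f j0_def fun_eq_iff)
    then show ?thesis by simp
  qed
  finally show ?thesis .
qed

definition quadratic :: "nat \<times> nat \<Rightarrow> nat \<times> nat \<Rightarrow> 'v"
  where "quadratic a b = Psi a (-1) (Psi b (-1) vac)"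

lemma quad_eq: "quad psi vac k i l j = quadratic (k, i) (l, j)"
  by (simp add: quad_def quadratic_def Psi_def)

lemma quadratic_even: "a \<in> Idx \<Longrightarrow> b \<in> Idx \<Longrightarrow> quadratic a b \<in> V False"
  unfolding quadratic_def using Psi_parity[of a "Psi b (-1) vac" True] Psi_vac_odd by auto

lemma quadratic_swap: "a \<in> Idx \<Longrightarrow> b \<in> Idx \<Longrightarrow> quadratic b a = - quadratic a b"
  unfolding quadratic_def using Psi_anticommute[of b a "-1" "-1"] by simp

lemma quadratic_mode:
  assumes "a \<in> Idx" "b \<in> Idx"
  shows "Y (quadratic a b) k w =
    Sum_any (\<lambda>j::nat. Psi a (- 1 - int j) (Psi b (k + int j) w) - Psi b (k - 1 - int j) (Psi a (int j) w))"
  unfolding quadratic_def using normal_order_Psi_1[OF assms(1) Psi_vac_odd[OF assms(2)]] assms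
  by (simp add: Psi_mode)

lemma quadratic_on_fermion:
  assumes "a \<in> Idx" "b \<in> Idx" "c \<in> Idx"
  shows "Y (quadratic a b) (int j) (Psi c (-1) vac) = (if j = 0 then
    (if b = c then Psi a (-1) vac else 0) - (if a = c then Psi b (-1) vac else 0) else 0)"
proof -
  define f where "f = (\<lambda>i::nat. Psi a (- 1 - int i) (Psi b (int j + int i) (Psi c (-1) vac))
    - Psi b (int j - 1 - int i) (Psi a (int i) (Psi c (-1) vac)))"
  have "Sum_any f = sum f {..<1}"
    using assms by (intro Sum_any_lessThan) (auto simp: f_def Psi_annihilation_creation Psi_linear)
  also have "\<dots> = (if j = 0 then
    (if b = c then Psi a (-1) vac else 0) - (if a = c then Psi b (-1) vac else 0) else 0)"
    using assms by (auto simp: f_def Psi_annihilation_creation Psi_linear Psi_vac)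
  finally show ?thesis
    unfolding f_def using assms by (simp add: quadratic_mode)
qed

text \<open>
  On the span of the fermions \<open>quadratic a b\<close> acts as the skew matrix that sends \<open>b\<close> to \<open>a\<close> and \<open>a\<close> to
  \<open>-b\<close>.
\<close>

lemma quadratic_commutator:
  assumes "a \<in> Idx" "b \<in> Idx" "c \<in> Idx"
  shows "Y (quadratic a b) r (Psi c s v) = Psi c s (Y (quadratic a b) r v)
    + (if b = c then Psi a (r + s) v else 0) - (if a = c then Psi b (r + s) v else 0)"
proof -
  have "Y (quadratic a b) r (Y (Psi c (-1) vac) s v) = Y (Psi c (-1) vac) s (Y (quadratic a b) r v) +
     (\<Sum>j<1. (of_int r gchoose j) *s Y (Y (quadratic a b) (int j) (Psi c (-1) vac)) (r + s - int j) v)"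
    by (rule mode_commutator[OF quadratic_even Psi_vac_odd]) (use assms in \<open>auto simp: quadratic_on_fermion\<close>)
  then show ?thesis
    using assms quadratic_on_fermion[of a b c 0] by (auto simp: Psi_mode)
qed

text \<open>\<open>fermion_conformal a\<close> is twice the conformal vector of the free fermion \<open>a\<close>.\<close>

definition fermion_conformal :: "nat \<times> nat \<Rightarrow> 'v"
  where "fermion_conformal a = Psi a (-2) (Psi a (-1) vac)"

lemma fermion_conformal_even: "a \<in> Idx \<Longrightarrow> fermion_conformal a \<in> V False"
  unfolding fermion_conformal_def using Psi_parity[of a "Psi a (-1) vac" True] Psi_vac_odd by auto

lemma fermion_conformal_on_fermion:
  assumes "a \<in> Idx" "c \<in> Idx"
  shows "Y (fermion_conformal a) (int j) (Psi c (-1) vac) = (if a = c \<and> j = 0 then 2 *s Psi a (-2) vac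
    else if a = c \<and> j = 1 then Psi a (-1) vac else 0)"
proof -
  define f where "f = (\<lambda>i::nat. (of_nat i + 1) *s (Psi a (- 2 - int i) (Psi a (int j + int i) (Psi c (-1) vac))
    + Psi a (int j - 2 - int i) (Psi a (int i) (Psi c (-1) vac))))"
  have "Sum_any f = sum f {..<1}"
    using assms by (intro Sum_any_lessThan) (auto simp: f_def Psi_annihilation_creation Psi_linear)
  also have "\<dots> = (if a = c \<and> j = 0 then 2 *s Psi a (-2) vac
    else if a = c \<and> j = 1 then Psi a (-1) vac else 0)"
    using assms scale_left_distrib[of 1 1 "Psi a (-2) vac"]
    by (auto simp: f_def Psi_annihilation_creation Psi_linear Psi_vac)
  finally show ?thesis
    unfolding f_def fermion_conformal_def using assms normal_order_Psi_2[OF assms(1) Psi_vac_odd[OF assms(1)]]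
    by (simp add: Psi_mode)
qed

text \<open>
  The mode \<open>r = 1\<close> measures the conformal weight of a fermion, and the mode \<open>r = 0\<close> differentiates
  its field.
\<close>

lemma fermion_conformal_commutator:
  assumes "a \<in> Idx" "c \<in> Idx"
  shows "Y (fermion_conformal a) r (Psi c s v) = Psi c s (Y (fermion_conformal a) r v)
    + (if a = c then - of_int (2 * s + r) *s Psi c (r + s - 1) v else 0)"
proof -
  have "Y (fermion_conformal a) r (Y (Psi c (-1) vac) s v) = Y (Psi c (-1) vac) s (Y (fermion_conformal a) r v) +
     (\<Sum>j<2. (of_int r gchoose j) *s Y (Y (fermion_conformal a) (int j) (Psi c (-1) vac)) (r + s - int j) v)"
    by (rule mode_commutator[OF fermion_conformal_even Psi_vac_odd]) (use assms in \<open>auto simp: fermion_conformal_on_fermion\<close>)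
  then show ?thesis
    using assms fermion_conformal_on_fermion[of a c 0] fermion_conformal_on_fermion[of a c 1]
    by (auto simp: Psi_mode numeral_2_eq_2 translate_fermion_mode algebra_simps simp flip: scale_left_distrib)
qed

section \<open>The grading\<close>

definition energy_space :: "int \<Rightarrow> 'v set"
  where "energy_space e = span {creation_word Psi xs vac | xs. fst ` set xs \<subseteq> Idx \<and> energy xs = e}"

lemma creation_word_energy_space: "fst ` set xs \<subseteq> Idx \<Longrightarrow> energy xs = e \<Longrightarrow> creation_word Psi xs vac \<in> energy_space e"
  unfolding energy_space_def by (intro span_base) auto

lemma subspace_energy_space: "subspace (energy_space e)"
  unfolding energy_space_def by (rule subspace_span)

lemma linear_energy_space_mapsto:
  assumes lin: "\<And>u v. f (u + v) = f u + f v" "\<And>c v. f (c *s v) = c *s f v" and S: "subspace S"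
    and words: "\<And>xs. fst ` set xs \<subseteq> Idx \<Longrightarrow> energy xs = e \<Longrightarrow> f (creation_word Psi xs vac) \<in> S"
    and v: "v \<in> energy_space e"
  shows "f v \<in> S"
  using v unfolding energy_space_def
proof (induction rule: span_induct_alt)
  case base
  show ?case using lin(2)[of 0 0] S by (simp add: subspace_0)
next
  case (step c x y)
  then show ?case using words S by (auto simp: lin subspace_add subspace_scale)
qed

text \<open>
  A creation operator lengthens a word by one letter; an annihilation operator is moved through the
  word, deleting at most one letter, until it meets the vacuum.
\<close>

lemma Psi_energy_space:
  assumes a: "a \<in> Idx" and v: "v \<in> energy_space e"
  shows "Psi a r v \<in> energy_space (e - 2 * r - 1)"
proof -
  have word: "Psi a r (creation_word Psi xs vac) \<in> energy_space (energy xs - 2 * r - 1)"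
    if "fst ` set xs \<subseteq> Idx" for xs
  proof (cases "r < 0")
    case True
    then have "Psi a r (creation_word Psi xs vac) = creation_word Psi ((a, nat (- 1 - r)) # xs) vac"
      by simp
    also have "\<dots> \<in> energy_space (energy xs - 2 * r - 1)"
      by (rule creation_word_energy_space) (use True that a in auto)
    finally show ?thesis .
  next
    case r: False
    show ?thesis using that
    proof (induction xs)
      case Nil
      then show ?case using r a by (simp add: Psi_vac subspace_0[OF subspace_energy_space])
    next
      case (Cons x xs)
      let ?w = "creation_word Psi xs vac" and ?s = "- 1 - int (snd x)"
      from Cons have x: "fst x \<in> Idx" by auto
      have up: "Psi (fst x) ?s v \<in> energy_space (e + 2 * int (snd x) + 1)" if "v \<in> energy_space e" for v e
      proof (rule linear_energy_space_mapsto[OF _ _ subspace_energy_space _ that])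
        fix ys assume "fst ` set ys \<subseteq> Idx" "energy ys = e"
        then show "Psi (fst x) ?s (creation_word Psi ys vac) \<in> energy_space (e + 2 * int (snd x) + 1)"
          using creation_word_energy_space[of "x # ys"] x by (auto simp: algebra_simps)
      qed (use x in \<open>auto simp: Psi_linear\<close>)
      have "Psi a r (creation_word Psi (x # xs) vac) =
          - Psi (fst x) ?s (Psi a r ?w) + (if a = fst x \<and> r + ?s = -1 then ?w else 0)"
        using Psi_anticommute[OF a x] by simp
      moreover have "Psi (fst x) ?s (Psi a r ?w) \<in> energy_space (energy (x # xs) - 2 * r - 1)"
        using up[of "Psi a r ?w" "energy xs - 2 * r - 1"] Cons by (auto simp: algebra_simps)
      moreover have "?w \<in> energy_space (energy (x # xs) - 2 * r - 1)" if "r + ?s = -1"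
        using that Cons.prems by (intro creation_word_energy_space) auto
      ultimately show ?case
        using subspace_energy_space by (auto intro!: subspace_add subspace_diff subspace_neg)
    qed
  qed
  show ?thesis
    by (rule linear_energy_space_mapsto[OF _ _ subspace_energy_space _ v]) (use a word in \<open>auto simp: Psi_linear\<close>)
qed

text \<open>
  The words span a nonzero submodule, so irreducibility applies.
\<close>

lemma span_creation_words: "v \<in> span {creation_word Psi xs vac | xs. fst ` set xs \<subseteq> Idx}" (is "v \<in> ?U")
proof -
  have sub: "energy_space e \<subseteq> ?U" for e
    unfolding energy_space_def by (intro span_mono) auto
  have "Psi a r v \<in> ?U" if "a \<in> Idx" "v \<in> ?U" for a r v
    using that(2)
  proof (induction rule: span_induct_alt)
    case base
    then show ?case using that(1) by (simp add: Psi_linear span_zero)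
  next
    case (step c x y)
    then obtain xs where xs: "x = creation_word Psi xs vac" "fst ` set xs \<subseteq> Idx" by auto
    then have "Psi a r x \<in> ?U"
      using Psi_energy_space[OF that(1) creation_word_energy_space[OF xs(2) refl], of r] sub xs by auto
    with step show ?case using that(1) by (simp add: Psi_linear span_add span_scale)
  qed
  then have "?U = {0} \<or> ?U = UNIV"
    by (intro irreducible_module subspace_span) (auto simp: Psi_pair)
  moreover have "vac \<in> ?U" by (intro span_base CollectI exI[of _ "[]"]) auto
  ultimately show ?thesis using vac_nonzero by auto
qed

lemma creation_word_parity:
  "fst ` set xs \<subseteq> Idx \<Longrightarrow> creation_word Psi xs vac \<in> V (odd (length xs))"
proof (induction xs)
  case Nil
  then show ?case by (simp add: vac_even)
next
  case (Cons x xs)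
  then have "creation_word Psi xs vac \<in> V (odd (length xs))" "fst x \<in> Idx" by auto
  from Psi_parity[OF this(2,1)] show ?case by simp
qed

lemma even_eq_span_words:
  "V False = span {creation_word Psi xs vac | xs. fst ` set xs \<subseteq> Idx \<and> even (length xs)}"
  (is "_ = span ?E")
proof
  have mem: "creation_word Psi xs vac \<in> V False" if "fst ` set xs \<subseteq> Idx" "even (length xs)" for xs
    using creation_word_parity[OF that(1)] that(2) by simp
  show sub: "span ?E \<subseteq> V False"
    using mem by (intro span_minimal parity_subspace) auto
  show "V False \<subseteq> span ?E"
  proof
    fix v assume v: "v \<in> V False"
    let ?O = "{creation_word Psi xs vac | xs. fst ` set xs \<subseteq> Idx \<and> odd (length xs)}"
    have "{creation_word Psi xs vac | xs. fst ` set xs \<subseteq> Idx} = ?E \<union> ?O" by auto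
    then have "v \<in> span (?E \<union> ?O)" using span_creation_words[of v] by simp
    then obtain x y where xy: "v = x + y" "x \<in> span ?E" "y \<in> span ?O"
      unfolding span_Un by auto
    have "creation_word Psi xs vac \<in> V True" if "fst ` set xs \<subseteq> Idx" "odd (length xs)" for xs
      using creation_word_parity[OF that(1)] that(2) by simp
    then have "span ?O \<subseteq> V True"
      by (intro span_minimal parity_subspace) auto
    with xy have "y \<in> V True" by auto
    moreover have "y \<in> V False"
      using subspace_diff[OF parity_subspace v, of x] xy sub by auto
    ultimately have "y = 0" using even_odd_eq_0 by auto
    with xy show "v \<in> span ?E" by simp
  qed
qed

section \<open>Even words and quadratic vectors\<close>

lemma Psi_creation_anticommute:
  "a \<in> Idx \<Longrightarrow> b \<in> Idx \<Longrightarrow> r < 0 \<Longrightarrow> s < 0 \<Longrightarrow> Psi a r (Psi b s v) = - Psi b s (Psi a r v)"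
  using Psi_anticommute[of a b r s v] by auto

text \<open>
  A family of two subspaces that is closed under modes compatibly with a sign \<open>\<epsilon>\<close> of the fermions
  and contains the quadratic vectors contains all even words.  This is used twice: with both members
  of the family equal to a vertex subalgebra, and with the two eigenspaces of \<open>\<sigma>\<^sub>i\<close>.  A third index,
  different from any two given ones, is what makes the bilinear vectors with derivatives reachable.
\<close>

context
  fixes X :: "bool \<Rightarrow> 'v set" and \<epsilon> :: "nat \<times> nat \<Rightarrow> bool" and A :: "(nat \<times> nat) set"
  assumes A: "A \<subseteq> Idx" and third_index: "\<And>a b. \<exists>c\<in>A. c \<noteq> a \<and> c \<noteq> b"
    and X_subspace: "\<And>s. subspace (X s)" and X_vac: "vac \<in> X False"
    and X_mode: "\<And>s t u v k. u \<in> X s \<Longrightarrow> v \<in> X t \<Longrightarrow> Y u k v \<in> X (s \<noteq> t)"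
    and X_quadratic: "\<And>a b. a \<in> A \<Longrightarrow> b \<in> A \<Longrightarrow> quadratic a b \<in> X (\<epsilon> a \<noteq> \<epsilon> b)"
begin

text \<open>
  In the product of \<open>quadratic a c\<close> and \<open>quadratic c b\<close> the letters \<open>c\<close> are contracted; the uncontracted quartic
  term contains \<open>Psi c (-1)\<close> twice and vanishes.
\<close>

lemma pair_2_1_mem:
  assumes "a \<in> A" "b \<in> A" "a \<noteq> b"
  shows "Psi a (-2) (Psi b (-1) vac) \<in> X (\<epsilon> a \<noteq> \<epsilon> b)"
proof -
  obtain c where c: "c \<in> A" "c \<noteq> a" "c \<noteq> b" using third_index by blast
  note I = A[THEN subsetD, OF assms(1)] A[THEN subsetD, OF assms(2)] A[THEN subsetD, OF c(1)]
  have "Psi c (-1) (Psi b (-1) (quadratic a c)) = 0"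
    unfolding quadratic_def using I by (simp add: Psi_creation_anticommute[of c b] Psi_creation_anticommute[of c a]
      Psi_square_0 Psi_linear)
  then have "Y (quadratic a c) (-1) (quadratic c b) = Psi a (-2) (Psi b (-1) vac)"
    unfolding quadratic_def[of c b] using I c assms
    by (simp add: quadratic_commutator creation Psi_linear)
  moreover have "((\<epsilon> a \<noteq> \<epsilon> c) \<noteq> (\<epsilon> c \<noteq> \<epsilon> b)) = (\<epsilon> a \<noteq> \<epsilon> b)" by auto
  ultimately show ?thesis
    using X_mode[OF X_quadratic[OF assms(1) c(1)] X_quadratic[OF c(1) assms(2)], of "-1"] by (simp only:)
qed

text \<open>
  Rotating \<open>a\<close> into \<open>b\<close> by the zero mode of \<open>quadratic b a\<close>.
\<close>

lemma fermion_conformal_diff_mem: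
  assumes "a \<in> A" "b \<in> A" "a \<noteq> b"
  shows "fermion_conformal b - fermion_conformal a \<in> X False"
proof -
  note I = A[THEN subsetD, OF assms(1)] A[THEN subsetD, OF assms(2)]
  have "Y (quadratic b a) 0 (Psi a (-2) (Psi b (-1) vac)) = fermion_conformal b - fermion_conformal a"
    using I assms by (simp add: quadratic_commutator creation Psi_linear fermion_conformal_def)
  with X_mode[OF X_quadratic[OF assms(2,1)] pair_2_1_mem[OF assms], of 0] show ?thesis
    by (metis (full_types))
qed

text \<open>The zero mode of \<open>fermion_conformal b - fermion_conformal a\<close> differentiates the fermion \<open>a\<close> and leaves \<open>c\<close> alone.\<close>

lemma distinct_pair_mem:
  assumes "a \<in> A" "c \<in> A" "a \<noteq> c"
  shows "Psi a (- 1 - int p) (Psi c (-1) vac) \<in> X (\<epsilon> a \<noteq> \<epsilon> c)"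
proof (induction p)
  case 0
  then show ?case using X_quadratic[OF assms(1,2)] by (simp add: quadratic_def)
next
  case (Suc p)
  obtain b where b: "b \<in> A" "b \<noteq> a" "b \<noteq> c" using third_index by blast
  note I = A[THEN subsetD, OF assms(1)] A[THEN subsetD, OF assms(2)] A[THEN subsetD, OF b(1)]
  have "Y (fermion_conformal b - fermion_conformal a) 0 (Psi a (- 1 - int p) (Psi c (-1) vac)) =
      (2 * of_int (- 1 - int p)) *s Psi a (- 1 - int (Suc p)) (Psi c (-1) vac)"
    using I b assms by (simp add: fermion_conformal_commutator creation Psi_linear algebra_simps)
  moreover have "Y (fermion_conformal b - fermion_conformal a) 0 (Psi a (- 1 - int p) (Psi c (-1) vac)) \<in> X (\<epsilon> a \<noteq> \<epsilon> c)"
    using X_mode[OF fermion_conformal_diff_mem[OF assms(1) b(1)] Suc, of 0] b by auto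
  ultimately have "(2 * of_int (- 1 - int p)) *s Psi a (- 1 - int (Suc p)) (Psi c (-1) vac) \<in> X (\<epsilon> a \<noteq> \<epsilon> c)"
    by simp
  from subspace_scale[OF X_subspace this, of "inverse (2 * of_int (- 1 - int p))"]
  have "(inverse (2 * of_int (- 1 - int p)) * (2 * of_int (- 1 - int p))) *s Psi a (- 1 - int (Suc p)) (Psi c (-1) vac)
      \<in> X (\<epsilon> a \<noteq> \<epsilon> c)"
    by (simp only: scale_scale)
  moreover have "(2 * of_int (- 1 - int p) :: complex) \<noteq> 0"
  proof
    assume "(2 * of_int (- 1 - int p) :: complex) = 0"
    then have "of_int (- 1 - int p) = (0 :: complex)" by simp
    then show False by (subst (asm) of_int_eq_0_iff) simp
  qed
  ultimately show ?case by (subst (asm) left_inverse) simp_all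
qed

text \<open>
  The first mode of \<open>quadratic a c\<close> turns \<open>\<psi>\<^sub>a\<close> into \<open>-\<psi>\<^sub>c\<close> and lowers it by one step, while it turns the
  letter \<open>Psi c (-1)\<close> into an operator that kills the vacuum.
\<close>

lemma same_pair_mem:
  assumes "c \<in> A"
  shows "Psi c (- 1 - int p) (Psi c (-1) vac) \<in> X False"
proof -
  obtain a where a: "a \<in> A" "a \<noteq> c" using third_index by blast
  note I = A[THEN subsetD, OF assms(1)] A[THEN subsetD, OF a(1)]
  have "Y (quadratic a c) 1 (Psi a (- 1 - int (Suc p)) (Psi c (-1) vac)) = - Psi c (- 1 - int p) (Psi c (-1) vac)"
    using I a by (simp add: quadratic_commutator creation Psi_linear Psi_vac)
  with X_mode[OF X_quadratic[OF a(1) assms] distinct_pair_mem[OF a(1) assms a(2), of "Suc p"], of 1]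
  have "- Psi c (- 1 - int p) (Psi c (-1) vac) \<in> X False"
    by (metis (full_types))
  then show ?thesis using subspace_neg[OF X_subspace] by fastforce
qed

lemma pair_mem:
  assumes "a \<in> A" "b \<in> A"
  shows "Psi a r (Psi b (-1) vac) \<in> X (\<epsilon> a \<noteq> \<epsilon> b)"
proof (cases "r \<ge> 0")
  case True
  moreover have "a \<in> Idx" "b \<in> Idx" using A assms by blast+
  ultimately show ?thesis
    using X_vac X_subspace by (auto simp: Psi_annihilation_creation subspace_0)
next
  case False
  then have r: "r = - 1 - int (nat (- 1 - r))" by simp
  show ?thesis
    using distinct_pair_mem[OF assms, of "nat (- 1 - r)"] same_pair_mem[OF assms(1), of "nat (- 1 - r)"]
    by (subst r, cases "a = b") auto
qed

text \<open>
  The passage from bilinear vectors to bilinear operators, by \<open>mode_mode_mem\<close>.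
\<close>

lemma fermion_pair_mem:
  assumes "a \<in> A" "b \<in> A" "v \<in> X t"
  shows "Psi a r (Psi b s v) \<in> X ((\<epsilon> a \<noteq> \<epsilon> b) \<noteq> t)"
proof -
  have I: "a \<in> Idx" "b \<in> Idx" using A assms by blast+
  have "Y (Psi a (-1) vac) r (Y (Psi b (-1) vac) s v) \<in> X ((\<epsilon> a \<noteq> \<epsilon> b) \<noteq> t)"
    by (rule mode_mode_mem[OF Psi_vac_odd[OF I(1)] Psi_vac_odd[OF I(2)] X_subspace])
      (simp only: Psi_mode[OF I(1)] X_mode[OF pair_mem[OF assms(1,2)] assms(3)])
  then show ?thesis by (simp only: Psi_mode[OF I(1)] Psi_mode[OF I(2)])
qed

lemma even_word_mem:
  assumes "even (length xs)" "fst ` set xs \<subseteq> A"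
  shows "creation_word Psi xs vac \<in> X (odd (length (filter (\<lambda>x. \<epsilon> (fst x)) xs)))"
  using assms
proof (induction xs rule: length_induct)
  case (1 xs)
  show ?case
  proof (cases xs)
    case Nil
    then show ?thesis by (simp add: X_vac)
  next
    case (Cons x zs)
    then obtain y ys where xs: "xs = x # y # ys" using 1(2) by (cases zs) auto
    with 1 have "creation_word Psi ys vac \<in> X (odd (length (filter (\<lambda>x. \<epsilon> (fst x)) ys)))" by simp
    from fermion_pair_mem[OF _ _ this, of "fst x" "fst y" "- 1 - int (snd x)" "- 1 - int (snd y)"]
    show ?thesis using 1(3) unfolding xs
      by (cases "\<epsilon> (fst x)"; cases "\<epsilon> (fst y)") auto
  qed
qed

end

section \<open>The tensor power as a space of fixed points\<close>

lemma third_index_column: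
  assumes "N \<ge> 3"
  shows "\<exists>c\<in>{1..N} \<times> {j}. c \<noteq> a \<and> c \<noteq> (b::nat\<times>nat)"
proof -
  have "finite {a, b}" "card {a, b} \<le> 2" by (auto simp: card_insert_if)
  moreover have "card ({1..N} \<times> {j}) = N" by (simp add: card_cartesian_product)
  ultimately have "\<not> {1..N} \<times> {j} \<subseteq> {a, b}"
    using card_mono[of "{a, b}" "{1..N} \<times> {j}"] assms by linarith
  then show ?thesis by blast
qed

text \<open>
  The third index of \<open>even_word_mem\<close> is chosen in the same column, which is possible for
  \<open>N \<ge> 3\<close>.
\<close>

lemma so_factor_word_mem:
  assumes "N \<ge> 3" "j \<in> {1..n}" "even (length xs)" "fst ` set xs \<subseteq> {1..N} \<times> {j}"
  shows "creation_word Psi xs vac \<in> so_factor scale Y vac psi N j"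
proof -
  have "vertex_subalgebra scale Y vac (so_factor scale Y vac psi N j)"
    unfolding so_factor_def by (rule vertex_subalgebra_generated)
  moreover have "quadratic a b \<in> so_factor scale Y vac psi N j" if "a \<in> {1..N} \<times> {j}" "b \<in> {1..N} \<times> {j}" for a b
    unfolding so_factor_def using that
    by (intro generators_mem CollectI exI[of _ "fst a"] exI[of _ "fst b"]) (auto simp: quad_eq)
  moreover have "{1..N} \<times> {j} \<subseteq> Idx" using assms(2) by auto
  ultimately show ?thesis
    by (intro even_word_mem[of "{1..N} \<times> {j}" "\<lambda>_. so_factor scale Y vac psi N j" "\<lambda>_. False" xs]
      assms third_index_column) (auto simp: vertex_subalgebra_def)
qed

text \<open>
  The letters of \<open>xs\<close> do not occur in \<open>x\<close>, in the sense that their annihilation operators kill it.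
  In the normally ordered product that represents a mode of the word only the terms that consist of
  creation operators survive, and for the mode \<open>-1\<close> exactly one such term remains.
\<close>

lemma creation_word_modes:
  assumes "fst ` set xs \<subseteq> Idx" "\<And>y r. y \<in> set xs \<Longrightarrow> r \<ge> 0 \<Longrightarrow> Psi (fst y) r x = 0"
  shows "(\<forall>k\<ge>0. Y (creation_word Psi xs vac) k x = 0) \<and> Y (creation_word Psi xs vac) (-1) x = creation_word Psi xs x"
  using assms
proof (induction xs)
  case Nil
  then show ?case by (simp add: vac_mode)
next
  case (Cons y ys)
  let ?v = "creation_word Psi ys vac" and ?c = "- 1 - int (snd y)"
  have y: "fst y \<in> Idx" and v: "?v \<in> V (odd (length ys))"
    using Cons.prems creation_word_parity[of ys] by auto
  from Cons have IH: "\<And>k. k \<ge> 0 \<Longrightarrow> Y ?v k x = 0" "Y ?v (-1) x = creation_word Psi ys x" by auto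
  have eq: "Y (Psi (fst y) ?c ?v) b x =
    Sum_any (\<lambda>j::nat. ((-1) ^ j * (of_int ?c gchoose j)) *s (Psi (fst y) (?c - int j) (Y ?v (b + int j) x)))" for b
    unfolding normal_order_Psi[OF y v, where c = ?c and b=b and w=x]
    by (rule Sum_any.cong) (use Cons.prems in simp)
  have "Y (Psi (fst y) ?c ?v) k x = 0" if "k \<ge> 0" for k
    unfolding eq using that y by (simp add: IH Psi_linear)
  moreover have "Y (Psi (fst y) ?c ?v) (-1) x = Psi (fst y) ?c (creation_word Psi ys x)"
    unfolding eq by (subst Sum_any_lessThan[where m=1]) (use y IH in \<open>auto simp: Psi_linear\<close>)
  ultimately show ?case by simp
qed

end

lemma creation_word_move:
  fixes \<phi> :: "'a \<Rightarrow> int \<Rightarrow> 'v::ab_group_add \<Rightarrow> 'v"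
  assumes anti: "\<And>a b r s v. a \<in> A \<Longrightarrow> b \<in> A \<Longrightarrow> r < 0 \<Longrightarrow> s < 0 \<Longrightarrow> \<phi> a r (\<phi> b s v) = - \<phi> b s (\<phi> a r v)"
    and neg: "\<And>a r v. a \<in> A \<Longrightarrow> \<phi> a r (- v) = - \<phi> a r v"
    and "fst ` set us \<subseteq> A" "fst x \<in> A"
  shows "creation_word \<phi> (us @ x # vs) v = creation_word \<phi> (x # us @ vs) v
    \<or> creation_word \<phi> (us @ x # vs) v = - creation_word \<phi> (x # us @ vs) v"
  using assms(3,4)
proof (induction us)
  case (Cons u us)
  have "\<phi> (fst u) (- 1 - int (snd u)) (creation_word \<phi> (x # us @ vs) v) =
     - creation_word \<phi> (x # (u # us) @ vs) v"
    using Cons.prems anti[of "fst u" "fst x" "- 1 - int (snd u)" "- 1 - int (snd x)"] by simp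
  moreover have "creation_word \<phi> ((u # us) @ x # vs) v = \<phi> (fst u) (- 1 - int (snd u)) (creation_word \<phi> (us @ x # vs) v)"
    by simp
  moreover have "fst u \<in> A" "fst ` set us \<subseteq> A" using Cons.prems by auto
  moreover note Cons.IH[OF this(2) Cons.prems(2)]
  ultimately show ?case
    using neg[of "fst u"] by (elim disjE) (simp_all only: minus_minus simp_thms)
qed simp

text \<open>Creation operators anticommute, so a word depends on the order of its letters only by a sign.\<close>

lemma creation_word_permute:
  fixes \<phi> :: "'a \<Rightarrow> int \<Rightarrow> 'v::ab_group_add \<Rightarrow> 'v"
  assumes anti: "\<And>a b r s v. a \<in> A \<Longrightarrow> b \<in> A \<Longrightarrow> r < 0 \<Longrightarrow> s < 0 \<Longrightarrow> \<phi> a r (\<phi> b s v) = - \<phi> b s (\<phi> a r v)"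
    and neg: "\<And>a r v. a \<in> A \<Longrightarrow> \<phi> a r (- v) = - \<phi> a r v"
    and "mset xs = mset ys" "fst ` set xs \<subseteq> A"
  shows "creation_word \<phi> xs v = creation_word \<phi> ys v \<or> creation_word \<phi> xs v = - creation_word \<phi> ys v"
  using assms(3,4)
proof (induction xs arbitrary: ys)
  case (Cons x xs)
  have "x \<in> set ys" using Cons.prems(1) by (metis list.set_intros(1) set_mset_mset)
  then obtain us vs where ys: "ys = us @ x # vs" by (meson split_list)
  have set_eq: "set (x # xs) = set ys" using Cons.prems(1) by (metis set_mset_mset)
  have x: "fst x \<in> A" and us: "fst ` set us \<subseteq> A" using Cons.prems(2) unfolding set_eq by (auto simp: ys)
  have "mset xs = mset (us @ vs)" using Cons.prems(1) by (simp add: ys)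
  from Cons.IH[OF this] Cons.prems(2)
  have "creation_word \<phi> xs v = creation_word \<phi> (us @ vs) v \<or> creation_word \<phi> xs v = - creation_word \<phi> (us @ vs) v"
    by simp
  then have "creation_word \<phi> (x # xs) v = creation_word \<phi> (x # us @ vs) v \<or> creation_word \<phi> (x # xs) v = - creation_word \<phi> (x # us @ vs) v"
    using neg[OF x] by auto
  moreover have "creation_word \<phi> ys v = creation_word \<phi> (x # us @ vs) v \<or> creation_word \<phi> ys v = - creation_word \<phi> (x # us @ vs) v"
    unfolding ys by (rule creation_word_move[OF anti neg us x])
  ultimately show ?case by (elim disjE) (simp_all only: minus_minus simp_thms)
qed simp

lemma mset_concat_filter:
  "distinct js \<Longrightarrow> mset (concat (map (\<lambda>j. filter (\<lambda>x. f x = j) xs) js)) = filter_mset (\<lambda>x. f x \<in> set js) (mset xs)"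
proof (induction js)
  case (Cons j js)
  have "filter_mset (\<lambda>x. f x \<in> set (j # js)) M = filter_mset (\<lambda>x. f x = j) M + filter_mset (\<lambda>x. f x \<in> set js) M" for M
    using Cons.prems by (induction M) auto
  with Cons show ?case by simp
qed simp

context fermionic_vertex_superalgebra
begin

lemma annihilate_creation_word:
  assumes "a \<in> Idx" "r \<ge> 0" "fst ` set xs \<subseteq> Idx" "a \<notin> fst ` set xs"
  shows "Psi a r (creation_word Psi xs vac) = 0"
  using assms(3,4)
proof (induction xs)
  case (Cons x xs)
  then show ?case
    using Psi_anticommute[of a "fst x" r "- 1 - int (snd x)"] assms by (auto simp: Psi_linear)
qed (use assms Psi_vac in auto)

text \<open>
  The letters of one column are not among those of the later columns, so \<open>creation_word_modes\<close>
  evaluates the product factor by factor.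
\<close>

lemma foldr_modes_blocks:
  assumes "fst ` set xs \<subseteq> Idx" "distinct js"
  shows "foldr (\<lambda>j. Y (creation_word Psi (filter (\<lambda>x. snd (fst x) = j) xs) vac) (-1)) js vac =
    creation_word Psi (concat (map (\<lambda>j. filter (\<lambda>x. snd (fst x) = j) xs) js)) vac"
  using assms(2)
proof (induction js)
  case (Cons j js)
  let ?B = "\<lambda>j. filter (\<lambda>x. snd (fst x) = j) xs"
  let ?w = "creation_word Psi (concat (map ?B js)) vac"
  have "Psi (fst y) r ?w = 0" if "y \<in> set (?B j)" "r \<ge> 0" for y r
    by (rule annihilate_creation_word) (use that Cons.prems assms(1) in auto)
  then have "Y (creation_word Psi (?B j) vac) (-1) ?w = creation_word Psi (?B j) ?w"
    using assms(1) by (intro creation_word_modes[THEN conjunct2]) auto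
  with Cons show ?case by simp
qed simp

text \<open>
  Sorting the letters by columns changes the word only by a sign, and the sorted word is a pure tensor
  of even words.
\<close>

lemma tensor_power_word_mem:
  assumes "N \<ge> 3" "fst ` set xs \<subseteq> Idx" "\<And>j. j \<in> {1..n} \<Longrightarrow> even (length (filter (\<lambda>x. snd (fst x) = j) xs))"
  shows "creation_word Psi xs vac \<in> so_tensor_power scale Y vac psi N n"
proof -
  let ?B = "\<lambda>j. filter (\<lambda>x. snd (fst x) = j) xs"
  let ?w = "creation_word Psi (concat (map ?B [1..<Suc n])) vac"
  have "foldr (\<lambda>j. Y (creation_word Psi (?B j) vac) (-1)) [1..<Suc n] vac \<in> so_tensor_power scale Y vac psi N n"
    unfolding so_tensor_power_def
  proof (intro span_base CollectI exI conjI ballI)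
    fix j assume j: "j \<in> {1..n}"
    show "creation_word Psi (?B j) vac \<in> so_factor scale Y vac psi N j"
      using assms j by (intro so_factor_word_mem) auto
  qed auto
  then have w: "?w \<in> so_tensor_power scale Y vac psi N n"
    using foldr_modes_blocks[OF assms(2), of "[1..<Suc n]"] by simp
  have "filter_mset (\<lambda>x. snd (fst x) \<in> set [1..<Suc n]) (mset xs) = mset xs"
    using assms(2) by (auto simp: filter_mset_eq_conv)
  then have "mset xs = mset (concat (map ?B [1..<Suc n]))"
    using mset_concat_filter[of "[1..<Suc n]" "\<lambda>x. snd (fst x)" xs] by simp
  from creation_word_permute[OF Psi_creation_anticommute Psi_linear(3) this assms(2)]
  have "creation_word Psi xs vac = ?w \<or> creation_word Psi xs vac = - ?w" .
  moreover have "subspace (so_tensor_power scale Y vac psi N n)"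
    unfolding so_tensor_power_def by (rule subspace_span)
  ultimately show ?thesis using w subspace_neg by auto
qed

lemma third_index_Idx:
  assumes "N \<ge> 3" "n \<ge> 1"
  shows "\<exists>c\<in>Idx. c \<noteq> a \<and> c \<noteq> b"
proof -
  obtain c where "c \<in> {1..N} \<times> {1}" "c \<noteq> a" "c \<noteq> b"
    using third_index_column[OF assms(1), of 1 a b] by blast
  then show ?thesis using assms(2) by (intro bexI[of _ c]) auto
qed

lemma automorphism_simps:
  assumes "f \<in> vertex_automorphisms scale Y vac (V False)" "u \<in> V False" "v \<in> V False"
  shows "f (u + v) = f u + f v" "f (c *s u) = c *s f u" "f vac = vac" "f (Y u k v) = Y (f u) k (f v)"
    "f 0 = 0" "f (- u) = - f u"
proof -
  show s: "f (u + v) = f u + f v" "f (c *s u) = c *s f u" "f vac = vac" "f (Y u k v) = Y (f u) k (f v)" for c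
    using assms by (auto simp: vertex_automorphisms_def)
  show "f 0 = 0" using s(2)[of 0] by simp
  show "f (- u) = - f u" using s(2)[of "-1"] by simp
qed

text \<open>
  The eigenspaces of \<open>\<sigma>\<^sub>i\<close> form a family to which \<open>even_word_mem\<close> applies; the values on quadratic
  vectors determine \<open>\<sigma>\<^sub>i\<close> on all even words.
\<close>

lemma sigma_word:
  assumes "N \<ge> 3" "n \<ge> 1" "is_sigma scale Y vac psi (V False) N n i f"
    and "fst ` set xs \<subseteq> Idx" "even (length xs)"
  shows "f (creation_word Psi xs vac) = (if odd (length (filter (\<lambda>x. snd (fst x) = i) xs))
    then - creation_word Psi xs vac else creation_word Psi xs vac)"
proof -
  have f: "f \<in> vertex_automorphisms scale Y vac (V False)"
    using assms(3) by (simp add: is_sigma_def)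
  have f_quadratic: "f (quadratic a b) = (if (snd a = i) \<noteq> (snd b = i) then - quadratic a b else quadratic a b)"
    if "a \<in> Idx" "b \<in> Idx" for a b
    using assms(3) that by (auto simp: is_sigma_def quad_eq)
  define X where "X = (\<lambda>s. {v \<in> V False. f v = (if s then - v else v)})"
  have "creation_word Psi xs vac \<in> X (odd (length (filter (\<lambda>x. snd (fst x) = i) xs)))"
  proof (rule even_word_mem[of Idx X "\<lambda>a. snd a = i" xs])
    show "\<exists>c\<in>Idx. c \<noteq> a \<and> c \<noteq> b" for a b by (rule third_index_Idx[OF assms(1,2)])
    show "subspace (X s)" for s
      using parity_subspace[of False]
      by (auto simp: X_def subspace_def automorphism_simps[OF f] vac_even)
    show "vac \<in> X False" by (simp add: X_def vac_even automorphism_simps[OF f vac_even vac_even])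
    show "Y u k v \<in> X (s \<noteq> t)" if "u \<in> X s" "v \<in> X t" for s t u v k
      using that mode_parity[of u False v False k] by (auto simp: X_def automorphism_simps[OF f])
    show "quadratic a b \<in> X ((snd a = i) \<noteq> (snd b = i))" if "a \<in> Idx" "b \<in> Idx" for a b
      using that by (auto simp: X_def quadratic_even f_quadratic)
  qed (use assms in auto)
  then show ?thesis by (auto simp: X_def)
qed

lemma automorphism_eigen_span:
  assumes f: "f \<in> vertex_automorphisms scale Y vac (V False)"
    and S: "S \<subseteq> V False" "\<And>w. w \<in> S \<Longrightarrow> f w = c *s w" and x: "x \<in> span S"
  shows "f x = c *s x"
proof -
  have "x \<in> V False \<and> f x = c *s x"
    using x
  proof (induction rule: span_induct_alt)
    case base
    then show ?case using automorphism_simps[OF f vac_even vac_even] parity_subspace by (simp add: subspace_0)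
  next
    case (step d y z)
    then have y: "y \<in> V False" "f y = c *s y" using S by auto
    then have "d *s y \<in> V False" using parity_subspace subspace_scale by blast
    with step y show ?case
      using subspace_add[OF parity_subspace] by (simp add: automorphism_simps[OF f] scale_right_distrib mult.commute)
  qed
  then show ?thesis ..
qed

text \<open>
  Each factor is fixed because its generators are.  Conversely a fixed vector is a combination of even
  words, and invariance under \<open>\<sigma>\<^sub>i\<close> removes the words with an odd number of letters in the \<open>i\<close>-th
  column; after all columns have been treated, only words in the tensor power are left.
\<close>

lemma tensor_power_eq_sigma_fixed:
  assumes N: "N \<ge> 3" and n: "n \<ge> 1" and sigma: "\<And>i. i \<in> {1..n} \<Longrightarrow> is_sigma scale Y vac psi (V False) N n i (\<sigma> i)"
  shows "so_tensor_power scale Y vac psi N n = {v \<in> V False. \<forall>i\<in>{1..n}. \<sigma> i v = v}"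
proof
  have f: "\<sigma> i \<in> vertex_automorphisms scale Y vac (V False)" if "i \<in> {1..n}" for i
    using sigma[OF that] by (simp add: is_sigma_def)
  let ?Z = "{v \<in> V False. \<forall>i\<in>{1..n}. \<sigma> i v = v}"
  have sub: "subspace ?Z"
    using parity_subspace[of False] by (auto simp: subspace_def automorphism_simps[OF f])
  have closed: "Y u k v \<in> ?Z" if "u \<in> ?Z" "v \<in> ?Z" for u v k
    using that mode_parity[of u False v False k] by (auto simp: automorphism_simps[OF f])
  have vac: "vac \<in> ?Z"
    using automorphism_simps(3)[OF f vac_even vac_even] by (auto simp: vac_even)
  have factor: "so_factor scale Y vac psi N j \<subseteq> ?Z" if "j \<in> {1..n}" for j
    unfolding so_factor_def
  proof (rule generated_subset)
    show "vertex_subalgebra scale Y vac ?Z"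
      using sub vac closed by (auto simp: vertex_subalgebra_def)
    show "{quad psi vac k j l j |k l. k \<in> {1..N} \<and> l \<in> {1..N}} \<subseteq> ?Z"
      using sigma that by (auto simp: quad_eq is_sigma_def intro!: quadratic_even)
  qed
  have prod: "foldr (\<lambda>j. Y (u j) (-1)) js vac \<in> ?Z" if "\<And>j. j \<in> set js \<Longrightarrow> u j \<in> ?Z" for u js
    using that
  proof (induction js)
    case Nil
    show ?case using vac by simp
  next
    case (Cons j js)
    then show ?case using closed[of "u j" "foldr (\<lambda>j. Y (u j) (-1)) js vac" "-1"] by simp
  qed
  show "so_tensor_power scale Y vac psi N n \<subseteq> ?Z"
    unfolding so_tensor_power_def
  proof (intro span_minimal sub subsetI)
    fix w assume "w \<in> {foldr (\<lambda>j. Y (u j) (-1)) [1..<Suc n] vac | u. \<forall>j\<in>{1..n}. u j \<in> so_factor scale Y vac psi N j}"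
    then obtain u where w: "w = foldr (\<lambda>j. Y (u j) (-1)) [1..<Suc n] vac"
      and u: "\<forall>j\<in>{1..n}. u j \<in> so_factor scale Y vac psi N j" by blast
    show "w \<in> ?Z"
      unfolding w
    proof (rule prod)
      fix j assume "j \<in> set [1..<Suc n]"
      then have j: "j \<in> {1..n}" by auto
      show "u j \<in> ?Z" using factor[OF j] u[rule_format, OF j] by (rule subsetD)
    qed
  qed
  show "?Z \<subseteq> so_tensor_power scale Y vac psi N n"
  proof
    fix v assume v: "v \<in> ?Z"
    define S where "S = (\<lambda>m. {creation_word Psi xs vac | xs. fst ` set xs \<subseteq> Idx \<and> even (length xs) \<and>
      (\<forall>j\<in>{1..m}. even (length (filter (\<lambda>x. snd (fst x) = j) xs)))})"
    have S_even: "S m \<subseteq> V False" for m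
      using creation_word_parity by (fastforce simp: S_def)
    have "v \<in> span (S m)" if "m \<le> n" for m
      using that
    proof (induction m)
      case 0
      then show ?case using v even_eq_span_words by (simp add: S_def)
    next
      case (Suc m)
      let ?f = "\<sigma> (Suc m)"
      have Sm: "Suc m \<in> {1..n}" using Suc.prems by simp
      define T where "T = {creation_word Psi xs vac | xs. fst ` set xs \<subseteq> Idx \<and> even (length xs) \<and>
        odd (length (filter (\<lambda>x. snd (fst x) = Suc m) xs))}"
      have T_even: "T \<subseteq> V False"
        using creation_word_parity by (fastforce simp: T_def)
      have "S m \<subseteq> S (Suc m) \<union> T"
      proof
        fix w assume "w \<in> S m"
        then obtain xs where xs: "w = creation_word Psi xs vac" "fst ` set xs \<subseteq> Idx" "even (length xs)"
          "\<forall>j\<in>{1..m}. even (length (filter (\<lambda>x. snd (fst x) = j) xs))"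
          unfolding S_def by blast
        show "w \<in> S (Suc m) \<union> T"
        proof (cases "even (length (filter (\<lambda>x. snd (fst x) = Suc m) xs))")
          case True
          then have "\<forall>j\<in>{1..Suc m}. even (length (filter (\<lambda>x. snd (fst x) = j) xs))"
            using xs(4) by (metis atLeastAtMost_iff le_Suc_eq)
          with xs(1-3) show ?thesis unfolding S_def by blast
        next
          case False
          with xs(1-3) show ?thesis unfolding T_def by blast
        qed
      qed
      then have "v \<in> span (S (Suc m) \<union> T)"
        using Suc span_mono by (metis Suc_leD subsetD)
      then obtain x y where xy: "v = x + y" "x \<in> span (S (Suc m))" "y \<in> span T"
        unfolding span_Un by auto
      have "?f x = 1 *s x"
        by (rule automorphism_eigen_span[OF f[OF Sm] S_even _ xy(2)])
          (auto simp: S_def sigma_word[OF N n sigma[OF Sm]])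
      moreover have "?f y = (-1) *s y"
        by (rule automorphism_eigen_span[OF f[OF Sm] T_even _ xy(3)])
          (auto simp: T_def sigma_word[OF N n sigma[OF Sm]])
      moreover have "x \<in> V False" "y \<in> V False"
        using xy S_even T_even span_minimal[OF _ parity_subspace] by blast+
      ultimately have "?f v = x - y"
        using xy(1) automorphism_simps(1)[OF f[OF Sm]] by simp
      then have "x + y = x - y" using v Sm xy(1) by auto
      then have "2 *s y = 0" using scale_left_distrib[of 1 1 y] by (simp add: eq_neg_iff_add_eq_0)
      then show ?case using xy by simp
    qed
    then have "v \<in> span (S n)" by simp
    moreover have "S n \<subseteq> so_tensor_power scale Y vac psi N n"
      using tensor_power_word_mem[OF N] by (auto simp: S_def)
    ultimately show "v \<in> so_tensor_power scale Y vac psi N n"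
      unfolding so_tensor_power_def using span_minimal[OF _ subspace_span] by blast
  qed
qed

end

text \<open>
  The vectors fixed by all generators are fixed by products and inverses as well.
\<close>

lemma fixed_points_generate:
  assumes "\<And>i. i \<in> I \<Longrightarrow> \<sigma> i \<in> Bij S" "X \<subseteq> S"
  shows "fixed_points (generate (BijGroup S) (\<sigma> ` I)) X = {v \<in> X. \<forall>i\<in>I. \<sigma> i v = v}"
proof -
  have sub: "\<sigma> ` I \<subseteq> carrier (BijGroup S)" using assms by (auto simp: BijGroup_def)
  have "g v = v" if "g \<in> generate (BijGroup S) (\<sigma> ` I)" and v: "v \<in> X" "\<forall>i\<in>I. \<sigma> i v = v" for g v
    using that(1)
  proof induction
    case one
    then show ?case using v assms by (auto simp: BijGroup_def)
  next
    case (incl h)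
    then show ?case using v by auto
  next
    case (inv h)
    then have h: "h \<in> Bij S" "h v = v" using v(2) assms(1) by blast+
    have vS: "v \<in> S" using v(1) assms(2) by blast
    have "inj_on h S" using h(1) by (simp add: Bij_def bij_betw_def)
    from inv_into_f_f[OF this vS] show ?case using vS by (simp add: inv_BijGroup[OF h(1)] h(2))
  next
    case (eng h1 h2)
    have "h1 \<in> Bij S" "h2 \<in> Bij S"
      using group.generate_in_carrier[OF group_BijGroup sub eng(1)]
        group.generate_in_carrier[OF group_BijGroup sub eng(2)] by (simp_all add: BijGroup_def)
    moreover have "v \<in> S" using v(1) assms(2) by blast
    ultimately show ?case using eng(3,4) by (simp add: BijGroup_def compose_def)
  qed
  moreover have "\<sigma> i \<in> generate (BijGroup S) (\<sigma> ` I)" if "i \<in> I" for i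
    using that by (intro generate.incl) blast
  ultimately show ?thesis
    unfolding fixed_points_def by blast
qed

section \<open>The two families of currents\<close>

lemma sum_swap_pairs:
  "(\<Sum>k\<in>A. \<Sum>l\<in>B. \<Sum>i\<in>C. \<Sum>j\<in>D. f k l i j) = (\<Sum>i\<in>C. \<Sum>j\<in>D. \<Sum>k\<in>A. \<Sum>l\<in>B. f k l i j)"
proof -
  have "(\<Sum>k\<in>A. \<Sum>l\<in>B. \<Sum>i\<in>C. \<Sum>j\<in>D. f k l i j) = (\<Sum>k\<in>A. \<Sum>i\<in>C. \<Sum>l\<in>B. \<Sum>j\<in>D. f k l i j)"
    by (intro sum.cong refl sum.swap)
  also have "\<dots> = (\<Sum>i\<in>C. \<Sum>k\<in>A. \<Sum>l\<in>B. \<Sum>j\<in>D. f k l i j)"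
    by (rule sum.swap)
  also have "\<dots> = (\<Sum>i\<in>C. \<Sum>k\<in>A. \<Sum>j\<in>D. \<Sum>l\<in>B. f k l i j)"
    by (intro sum.cong refl sum.swap)
  also have "\<dots> = (\<Sum>i\<in>C. \<Sum>j\<in>D. \<Sum>k\<in>A. \<Sum>l\<in>B. f k l i j)"
    by (intro sum.cong refl sum.swap)
  finally show ?thesis .
qed

context fermionic_vertex_superalgebra
begin

definition dual_current :: "nat \<Rightarrow> nat \<Rightarrow> 'v"
  where "dual_current i j = (\<Sum>k=1..N. quadratic (k, i) (k, j))"

definition diagonal_current :: "nat \<Rightarrow> nat \<Rightarrow> 'v"
  where "diagonal_current k l = (\<Sum>i=1..n. quadratic (k, i) (l, i))"

lemma dual_current_even: "i \<in> {1..n} \<Longrightarrow> j \<in> {1..n} \<Longrightarrow> dual_current i j \<in> V False"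
  unfolding dual_current_def by (intro subspace_sum parity_subspace quadratic_even) auto

lemma diagonal_current_even: "k \<in> {1..N} \<Longrightarrow> l \<in> {1..N} \<Longrightarrow> diagonal_current k l \<in> V False"
  unfolding diagonal_current_def by (intro subspace_sum parity_subspace quadratic_even) auto

lemma dual_current_swap:
  assumes "i \<in> {1..n}" "j \<in> {1..n}"
  shows "dual_current j i = - dual_current i j"
proof -
  have "dual_current j i = (\<Sum>k=1..N. - quadratic (k, i) (k, j))"
    unfolding dual_current_def by (intro sum.cong refl quadratic_swap) (use assms in auto)
  then show ?thesis by (simp add: dual_current_def sum_negf)
qed

lemma dual_current_commutator:
  assumes "i \<in> {1..n}" "j \<in> {1..n}" "k \<in> {1..N}" "c \<in> {1..n}"
  shows "Y (dual_current i j) r (Psi (k, c) s v) = Psi (k, c) s (Y (dual_current i j) r v)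
    + (if j = c then Psi (k, i) (r + s) v else 0) - (if i = c then Psi (k, j) (r + s) v else 0)"
proof -
  have "Y (dual_current i j) r (Psi (k, c) s v) = (\<Sum>k'=1..N. Y (quadratic (k', i) (k', j)) r (Psi (k, c) s v))"
    by (simp add: dual_current_def mode_sum_left)
  also have "\<dots> = (\<Sum>k'=1..N. Psi (k, c) s (Y (quadratic (k', i) (k', j)) r v)
      + (if k' = k then if j = c then Psi (k, i) (r + s) v else 0 else 0)
      - (if k' = k then if i = c then Psi (k, j) (r + s) v else 0 else 0))"
    by (rule sum.cong) (use assms in \<open>auto simp: quadratic_commutator\<close>)
  also have "\<dots> = Psi (k, c) s (Y (dual_current i j) r v)
    + (if j = c then Psi (k, i) (r + s) v else 0) - (if i = c then Psi (k, j) (r + s) v else 0)"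
    using assms by (simp add: sum.distrib sum_subtractf dual_current_def mode_sum_left Psi_sum)
  finally show ?thesis .
qed

text \<open>The currents of the two algebras have no singular terms in their operator product.\<close>

lemma dual_on_diagonal:
  assumes "i \<in> {1..n}" "j \<in> {1..n}" "k \<in> {1..N}" "l \<in> {1..N}"
  shows "Y (dual_current i j) (int t) (diagonal_current k l) = 0"
proof -
  define r where "r = int t - 1"
  have "Y (dual_current i j) (int t) (quadratic (k, p) (l, p)) =
      (if p = j then Psi (k, j) (-1) (Psi (l, i) r vac) + Psi (k, i) r (Psi (l, j) (-1) vac) else 0)
    - (if p = i then Psi (k, i) (-1) (Psi (l, j) r vac) + Psi (k, j) r (Psi (l, i) (-1) vac) else 0)"
    if "p \<in> {1..n}" for p
    using that assms
    by (simp add: quadratic_def dual_current_commutator creation Psi_linear r_def)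
  then have "Y (dual_current i j) (int t) (diagonal_current k l) =
     (\<Sum>p=1..n. (if p = j then Psi (k, j) (-1) (Psi (l, i) r vac) + Psi (k, i) r (Psi (l, j) (-1) vac) else 0)
    - (if p = i then Psi (k, i) (-1) (Psi (l, j) r vac) + Psi (k, j) r (Psi (l, i) (-1) vac) else 0))"
    by (simp add: diagonal_current_def mode_sum_right)
  also have "\<dots> = (Psi (k, j) (-1) (Psi (l, i) r vac) + Psi (k, i) r (Psi (l, j) (-1) vac))
    - (Psi (k, i) (-1) (Psi (l, j) r vac) + Psi (k, j) r (Psi (l, i) (-1) vac))"
    using assms by (simp add: sum_subtractf)
  also have "\<dots> = 0"
  proof (cases "t = 0")
    case True
    then show ?thesis by (simp add: r_def)
  next
    case False
    then have "r \<ge> 0" by (simp add: r_def)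
    then show ?thesis using assms by (auto simp: Psi_annihilation_creation Psi_vac Psi_linear)
  qed
  finally show ?thesis .
qed

lemma dual_diagonal_commute:
  assumes "i \<in> {1..n}" "j \<in> {1..n}" "k \<in> {1..N}" "l \<in> {1..N}"
  shows "Y (dual_current i j) r (Y (diagonal_current k l) s v) = Y (diagonal_current k l) s (Y (dual_current i j) r v)"
  using mode_commutator[of "dual_current i j" "diagonal_current k l" False 0 r s v] assms
  by (simp add: dual_current_even diagonal_current_even dual_on_diagonal)

lemma so_dual_eq:
  "so_dual scale Y vac psi N n = generated_subalgebra scale Y vac {dual_current i j | i j. i \<in> {1..n} \<and> j \<in> {1..n}}"
  by (simp add: so_dual_def dual_current_def quad_eq)

lemma so_diagonal_eq:
  "so_diagonal scale Y vac psi N n = generated_subalgebra scale Y vac {diagonal_current k l | k l. k \<in> {1..N} \<and> l \<in> {1..N}}"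
  by (simp add: so_diagonal_def diagonal_current_def quad_eq)

definition diagonal_invariants :: "'v set"
  where "diagonal_invariants = {v \<in> V False. \<forall>k\<in>{1..N}. \<forall>l\<in>{1..N}. \<forall>r\<ge>0. Y (diagonal_current k l) r v = 0}"

lemma commutant_even_eq: "commutant Y (V False) (so_diagonal scale Y vac psi N n) = diagonal_invariants"
proof (intro equalityI subsetI)
  fix v assume v: "v \<in> commutant Y (V False) (so_diagonal scale Y vac psi N n)"
  have "diagonal_current k l \<in> so_diagonal scale Y vac psi N n" if "k \<in> {1..N}" "l \<in> {1..N}" for k l
    unfolding so_diagonal_eq by (rule generators_mem) (use that in blast)
  with v show "v \<in> diagonal_invariants"
    by (simp add: commutant_def diagonal_invariants_def)
next
  fix v assume v: "v \<in> diagonal_invariants"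
  let ?S = "{diagonal_current k l | k l. k \<in> {1..N} \<and> l \<in> {1..N}}"
  have S: "?S \<subseteq> V False" using diagonal_current_even by blast
  have "Y u k v = 0" if "u \<in> ?S" "k \<ge> 0" for u k
    using that v by (auto simp: diagonal_invariants_def)
  from annihilated_by_generated[OF S this]
  show "v \<in> commutant Y (V False) (so_diagonal scale Y vac psi N n)"
    using v unfolding so_diagonal_eq by (simp add: commutant_def diagonal_invariants_def)
qed

lemma vertex_subalgebra_dual: "vertex_subalgebra scale Y vac (so_dual scale Y vac psi N n)"
  unfolding so_dual_eq by (rule vertex_subalgebra_generated)

lemma dual_current_mem: "i \<in> {1..n} \<Longrightarrow> j \<in> {1..n} \<Longrightarrow> dual_current i j \<in> so_dual scale Y vac psi N n"
  unfolding so_dual_eq by (rule generators_mem) auto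

lemma subspace_diagonal_invariants: "subspace diagonal_invariants"
  unfolding diagonal_invariants_def using parity_subspace[of False] by (auto simp: subspace_def)

lemma dual_current_diagonal_invariants:
  assumes "i \<in> {1..n}" "j \<in> {1..n}" "v \<in> diagonal_invariants"
  shows "Y (dual_current i j) r v \<in> diagonal_invariants"
proof -
  have "Y (diagonal_current k l) s (Y (dual_current i j) r v) = 0"
    if "k \<in> {1..N}" "l \<in> {1..N}" "s \<ge> 0" for k l s
    using dual_diagonal_commute[OF assms(1,2) that(1,2), of r s v] assms(3) that
    by (simp add: diagonal_invariants_def)
  moreover have "Y (dual_current i j) r v \<in> V False"
    using assms mode_parity[OF dual_current_even, of i j v False r] by (simp add: diagonal_invariants_def)
  ultimately show ?thesis by (simp add: diagonal_invariants_def)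
qed

text \<open>
  The commutation of the currents propagates from the generators to the generated subalgebra.
\<close>

lemma so_dual_subset_invariants: "so_dual scale Y vac psi N n \<subseteq> diagonal_invariants"
proof
  fix v assume v: "v \<in> so_dual scale Y vac psi N n"
  let ?S = "{dual_current i j | i j. i \<in> {1..n} \<and> j \<in> {1..n}}"
  have S: "?S \<subseteq> V False" using dual_current_even by auto
  have "so_dual scale Y vac psi N n \<subseteq> V False"
    unfolding so_dual_eq by (rule generated_subset[OF S vertex_subalgebra_even])
  moreover have "Y (diagonal_current k l) r v = 0" if kl: "k \<in> {1..N}" "l \<in> {1..N}" "r \<ge> 0" for k l r
  proof (rule annihilates_generated[OF S])
    show "v \<in> generated_subalgebra scale Y vac ?S" using v by (simp add: so_dual_eq)
    show "Y (diagonal_current k l) r w = 0" if w: "w \<in> ?S" and r: "r \<ge> 0" for w r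
    proof -
      obtain i j where ij: "w = dual_current i j" "i \<in> {1..n}" "j \<in> {1..n}" using w by blast
      then show ?thesis
        using dual_diagonal_commute[OF ij(2,3) kl(1,2), of "-1" r vac] r by (simp add: creation)
    qed
  qed (use kl diagonal_current_even in auto)
  ultimately show "v \<in> diagonal_invariants" using v by (auto simp: diagonal_invariants_def)
qed

section \<open>The Sugawara identity\<close>

lemma quadratic_product:
  assumes "a \<in> Idx" "b \<in> Idx" "c \<in> Idx" "d \<in> Idx"
  shows "Y (quadratic a b) (-1) (quadratic c d) = Psi a (-1) (Psi b (-1) (quadratic c d))
    + (if b = c then Psi a (-2) (Psi d (-1) vac) else 0) - (if b = d then Psi a (-2) (Psi c (-1) vac) else 0)
    - (if a = c then Psi b (-2) (Psi d (-1) vac) else 0) + (if a = d then Psi b (-2) (Psi c (-1) vac) else 0)"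
proof -
  have ann: "Psi x (int r) (quadratic c d) = (if r = 0 then (if x = c then Psi d (-1) vac else 0) - (if x = d then Psi c (-1) vac else 0) else 0)"
    if "x \<in> Idx" for x r
    unfolding quadratic_def using that assms Psi_anticommute[of x c "int r" "-1" "Psi d (-1) vac"]
    by (auto simp: Psi_annihilation_creation Psi_linear)
  define f where "f = (\<lambda>j::nat. Psi a (- 1 - int j) (Psi b (- 1 + int j) (quadratic c d)) - Psi b (- 1 - 1 - int j) (Psi a (int j) (quadratic c d)))"
  have "f j = 0" if "j \<ge> 2" for j
    using ann[of b "j - 1"] ann[of a j] that assms by (simp add: f_def of_nat_diff Psi_linear)
  then have "Sum_any f = sum f {..<2}"
    by (rule Sum_any_lessThan)
  also have "\<dots> = f 0 + f 1"
    by (simp add: numeral_2_eq_2)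
  finally have "Y (quadratic a b) (-1) (quadratic c d) = f 0 + f 1"
    unfolding f_def using assms by (simp add: quadratic_mode)
  then show ?thesis
    using ann[of b 0] ann[of a 0] ann[of a 1] assms by (auto simp: f_def Psi_linear)
qed

lemma sum_off_diagonal:
  assumes "finite A"
  shows "(\<Sum>i\<in>A. \<Sum>j\<in>A. if i = j then 0 else - f i - f j) = (2 - 2 * of_nat (card A)) *s (\<Sum>i\<in>A. f i)"
proof -
  have "(\<Sum>i\<in>A. \<Sum>j\<in>A. if i = j then 0 else - f i - f j) = (\<Sum>i\<in>A. \<Sum>j\<in>A. (if i = j then 2 *s f i else 0) - f i - f j)"
    using scale_left_distrib[of 1 1] by (intro sum.cong refl) (auto simp: algebra_simps)
  also have "\<dots> = (\<Sum>i\<in>A. 2 *s f i) - (\<Sum>i\<in>A. of_nat (card A) *s f i) - of_nat (card A) *s (\<Sum>i\<in>A. f i)"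
    using assms by (simp add: sum_subtractf sum_constant_scale)
  also have "\<dots> = (2 - 2 * of_nat (card A)) *s (\<Sum>i\<in>A. f i)"
    unfolding scale_sum_right[symmetric] by (simp only: mult_2 scale_left_diff_distrib scale_left_distrib) simp
  finally show ?thesis .
qed

text \<open>
  The quartic terms of the two sums are the same up to the order of the two middle fermions, hence
  cancel.  What remains are the single contractions: in the first sum the vector of a fermion
  \<open>(k, i)\<close> arises twice for every \<open>j \<noteq> i\<close>, in the second sum twice for every \<open>l \<noteq> k\<close>.
\<close>

lemma sugawara_vector:
  "(\<Sum>i=1..n. \<Sum>j=1..n. Y (dual_current i j) (-1) (dual_current i j))
    + (\<Sum>k=1..N. \<Sum>l=1..N. Y (diagonal_current k l) (-1) (diagonal_current k l))
   = - (2 * (of_nat N + of_nat n - 2)) *s (\<Sum>a\<in>Idx. fermion_conformal a)"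
proof -
  define Q where "Q = (\<lambda>k l i j. Psi (k, i) (-1) (Psi (k, j) (-1) (quadratic (l, i) (l, j))))"
  have dual: "Y (quadratic (k, i) (k, j)) (-1) (quadratic (l, i) (l, j)) = Q k l i j
     + (if k = l then if i = j then 0 else - fermion_conformal (k, i) - fermion_conformal (k, j) else 0)"
    if "k \<in> {1..N}" "l \<in> {1..N}" "i \<in> {1..n}" "j \<in> {1..n}" for k l i j
    using that by (auto simp: quadratic_product Q_def fermion_conformal_def)
  have diag: "Y (quadratic (k, i) (l, i)) (-1) (quadratic (k, j) (l, j)) = - Q k l i j
     + (if i = j then if k = l then 0 else - fermion_conformal (k, i) - fermion_conformal (l, i) else 0)"
    if "k \<in> {1..N}" "l \<in> {1..N}" "i \<in> {1..n}" "j \<in> {1..n}" for k l i j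
  proof -
    have "Psi (k, i) (-1) (Psi (l, i) (-1) (quadratic (k, j) (l, j))) = - Q k l i j"
      unfolding Q_def quadratic_def using that
      by (simp add: Psi_creation_anticommute[of "(l, i)" "(k, j)"] Psi_linear)
    then show ?thesis using that by (auto simp: quadratic_product fermion_conformal_def)
  qed
  have "(\<Sum>i=1..n. \<Sum>j=1..n. Y (dual_current i j) (-1) (dual_current i j)) =
     (\<Sum>i=1..n. \<Sum>j=1..n. \<Sum>k=1..N. \<Sum>l=1..N. Q k l i j + (if k = l then if i = j then 0 else - fermion_conformal (k, i) - fermion_conformal (k, j) else 0))"
    unfolding dual_current_def mode_sum_left unfolding mode_sum_right
    by (intro sum.cong refl dual) auto
  also have "\<dots> = (\<Sum>i=1..n. \<Sum>j=1..n. \<Sum>k=1..N. \<Sum>l=1..N. Q k l i j)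
      + (\<Sum>i=1..n. \<Sum>j=1..n. \<Sum>k=1..N. if i = j then 0 else - fermion_conformal (k, i) - fermion_conformal (k, j))"
    by (simp add: sum.distrib)
  also have "(\<Sum>i=1..n. \<Sum>j=1..n. \<Sum>k=1..N. if i = j then 0 else - fermion_conformal (k, i) - fermion_conformal (k, j))
     = (\<Sum>k=1..N. \<Sum>i=1..n. \<Sum>j=1..n. if i = j then 0 else - fermion_conformal (k, i) - fermion_conformal (k, j))"
    by (subst sum.swap, subst (2) sum.swap) (rule refl)
  also have "\<dots> = (\<Sum>k=1..N. (2 - 2 * of_nat n) *s (\<Sum>i=1..n. fermion_conformal (k, i)))"
    by (simp add: sum_off_diagonal)
  also have "\<dots> = (2 - 2 * of_nat n) *s (\<Sum>a\<in>Idx. fermion_conformal a)"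
    by (simp add: scale_sum_right sum.cartesian_product)
  finally have 1: "(\<Sum>i=1..n. \<Sum>j=1..n. Y (dual_current i j) (-1) (dual_current i j)) =
     (\<Sum>i=1..n. \<Sum>j=1..n. \<Sum>k=1..N. \<Sum>l=1..N. Q k l i j) + (2 - 2 * of_nat n) *s (\<Sum>a\<in>Idx. fermion_conformal a)" .
  have "(\<Sum>k=1..N. \<Sum>l=1..N. Y (diagonal_current k l) (-1) (diagonal_current k l)) =
     (\<Sum>k=1..N. \<Sum>l=1..N. \<Sum>i=1..n. \<Sum>j=1..n. - Q k l i j + (if i = j then if k = l then 0 else - fermion_conformal (k, i) - fermion_conformal (l, i) else 0))"
    unfolding diagonal_current_def mode_sum_left unfolding mode_sum_right
    by (intro sum.cong refl diag) auto
  also have "\<dots> = - (\<Sum>k=1..N. \<Sum>l=1..N. \<Sum>i=1..n. \<Sum>j=1..n. Q k l i j)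
      + (\<Sum>k=1..N. \<Sum>l=1..N. \<Sum>i=1..n. if k = l then 0 else - fermion_conformal (k, i) - fermion_conformal (l, i))"
    by (simp add: sum_subtractf)
  also have "(\<Sum>k=1..N. \<Sum>l=1..N. \<Sum>i=1..n. if k = l then 0 else - fermion_conformal (k, i) - fermion_conformal (l, i))
     = (\<Sum>i=1..n. \<Sum>k=1..N. \<Sum>l=1..N. if k = l then 0 else - fermion_conformal (k, i) - fermion_conformal (l, i))"
    by (subst sum.swap, subst (2) sum.swap) (rule refl)
  also have "\<dots> = (2 - 2 * of_nat N) *s (\<Sum>i=1..n. \<Sum>k=1..N. fermion_conformal (k, i))"
    by (simp add: sum_off_diagonal scale_sum_right)
  also have "(\<Sum>i=1..n. \<Sum>k=1..N. fermion_conformal (k, i)) = (\<Sum>a\<in>Idx. fermion_conformal a)"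
    by (subst sum.swap) (simp add: sum.cartesian_product)
  finally have 2: "(\<Sum>k=1..N. \<Sum>l=1..N. Y (diagonal_current k l) (-1) (diagonal_current k l)) =
     - (\<Sum>k=1..N. \<Sum>l=1..N. \<Sum>i=1..n. \<Sum>j=1..n. Q k l i j) + (2 - 2 * of_nat N) *s (\<Sum>a\<in>Idx. fermion_conformal a)" .
  have 3: "(\<Sum>k=1..N. \<Sum>l=1..N. \<Sum>i=1..n. \<Sum>j=1..n. Q k l i j) =
     (\<Sum>i=1..n. \<Sum>j=1..n. \<Sum>k=1..N. \<Sum>l=1..N. Q k l i j)"
    by (rule sum_swap_pairs)
  have "(\<Sum>i=1..n. \<Sum>j=1..n. Y (dual_current i j) (-1) (dual_current i j))
    + (\<Sum>k=1..N. \<Sum>l=1..N. Y (diagonal_current k l) (-1) (diagonal_current k l)) =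
    ((2 - 2 * of_nat n) + (2 - 2 * of_nat N)) *s (\<Sum>a\<in>Idx. fermion_conformal a)"
    unfolding 1 2 3 by (simp only: scale_left_distrib[of "2 - 2 * of_nat n" "2 - 2 * of_nat N"]) simp
  also have "(2 - 2 * of_nat n) + (2 - 2 * of_nat N) = (- (2 * (of_nat N + of_nat n - 2)) :: complex)"
    by simp
  finally show ?thesis .
qed

text \<open>
  In the expansion of the mode \<open>1\<close> of \<open>Y u (-1) u\<close>, every summand except \<open>Y u 0 (Y u 0 w)\<close> begins by
  applying a mode \<open>j \<ge> 1\<close> of \<open>u\<close> to \<open>w\<close>.
\<close>

lemma sugawara_mode_mem:
  assumes u: "u \<in> V False" and S: "subspace S" and mem: "\<And>m j. j \<ge> 1 \<Longrightarrow> Y u m (Y u j w) \<in> S"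
  shows "Y (Y u (-1) u) 1 w - Y u 0 (Y u 0 w) \<in> S"
proof -
  define f where "f = (\<lambda>j::nat. ((-1) ^ j * (of_int (-1) gchoose j)) *s
        (Y u (- 1 - int j) (Y u (1 + int j) w)
         - ((-1) powi -1 * (-1) ^ of_bool (False \<and> False)) *s Y u (1 + -1 - int j) (Y u (int j) w)))"
  have [simp]: "((-1::complex) powi -1) = -1" by (simp add: power_int_def)
  have f: "f j = Y u (- 1 - int j) (Y u (1 + int j) w) + Y u (- int j) (Y u (int j) w)" for j
    unfolding f_def using gbinomial_minus_one[of j] by simp
  have eq: "Y (Y u (-1) u) 1 w = Sum_any f"
    unfolding f_def by (rule normal_order[OF u u])
  obtain B where B: "\<And>k. k \<ge> B \<Longrightarrow> Y u k w = 0" using truncation by blast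
  have "f j = 0" if "j \<ge> nat B" for j using that by (simp add: f B)
  moreover have "f j \<in> S" if "j \<ge> 1" for j
    using that mem S by (auto simp: f intro!: subspace_add)
  ultimately have "Sum_any f - f 0 \<in> S"
    by (rule Sum_any_minus_head_mem[OF S])
  from subspace_add[OF S this mem[of 1 "-1"]]
  have "(Sum_any f - f 0) + Y u (-1) (Y u 1 w) \<in> S" by simp
  moreover have "(Sum_any f - f 0) + Y u (-1) (Y u 1 w) = Sum_any f - Y u 0 (Y u 0 w)"
    by (simp add: f)
  ultimately show ?thesis unfolding eq by simp
qed

text \<open>
  \<open>twice_weight_op\<close> is twice the conformal weight operator, and \<open>current_square\<close> is minus twice the Casimir operator of
  \<open>so\<^sub>n\<close>.  Their combination \<open>defect\<close> is the part of the Sugawara identity that involves only zero modes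
  of the dual currents.
\<close>

definition twice_weight_op :: "'v \<Rightarrow> 'v"
  where "twice_weight_op v = (\<Sum>a\<in>Idx. Y (fermion_conformal a) 1 v)"

definition current_square :: "'v \<Rightarrow> 'v"
  where "current_square v = (\<Sum>i=1..n. \<Sum>j=1..n. Y (dual_current i j) 0 (Y (dual_current i j) 0 v))"

definition defect :: "'v \<Rightarrow> 'v"
  where "defect v = current_square v + (2 * (of_nat N + of_nat n - 2)) *s twice_weight_op v"

lemma defect_linear: "defect (u + v) = defect u + defect v" "defect (c *s v) = c *s defect v" "defect (u - v) = defect u - defect v" "defect 0 = 0"
  by (simp_all add: defect_def current_square_def twice_weight_op_def sum.distrib sum_subtractf scale_right_distrib scale_right_diff_distrib
    scale_sum_right mult.commute)

text \<open>
  Applied to an invariant vector, the first mode of the Sugawara identity loses the diagonal currents,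
  and the terms with a mode \<open>r \<ge> 1\<close> of a dual current lie in the subalgebra by assumption.
\<close>

lemma defect_mem_dual:
  assumes v: "v \<in> diagonal_invariants"
    and pos: "\<And>i j r. i \<in> {1..n} \<Longrightarrow> j \<in> {1..n} \<Longrightarrow> r \<ge> 1 \<Longrightarrow> Y (dual_current i j) r v \<in> so_dual scale Y vac psi N n"
  shows "defect v \<in> so_dual scale Y vac psi N n"
proof -
  let ?U = "so_dual scale Y vac psi N n"
  have U: "subspace ?U" "\<And>x y k. x \<in> ?U \<Longrightarrow> y \<in> ?U \<Longrightarrow> Y x k y \<in> ?U"
    using vertex_subalgebra_dual by (auto simp: vertex_subalgebra_def)
  have dual: "Y (Y (dual_current i j) (-1) (dual_current i j)) 1 v - Y (dual_current i j) 0 (Y (dual_current i j) 0 v) \<in> ?U"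
    if "i \<in> {1..n}" "j \<in> {1..n}" for i j
    using that by (intro sugawara_mode_mem U dual_current_even pos dual_current_mem)
  have diag: "Y (Y (diagonal_current k l) (-1) (diagonal_current k l)) 1 v = 0" if "k \<in> {1..N}" "l \<in> {1..N}" for k l
  proof -
    have "Y (diagonal_current k l) r v = 0" if "r \<ge> 0" for r
      using v that \<open>k \<in> {1..N}\<close> \<open>l \<in> {1..N}\<close> by (auto simp: diagonal_invariants_def)
    then show ?thesis
      using sugawara_mode_mem[OF diagonal_current_even[OF that] subspace_single_0, of v] by simp
  qed
  let ?A = "\<Sum>i=1..n. \<Sum>j=1..n. Y (dual_current i j) (-1) (dual_current i j)"
  let ?B = "\<Sum>k=1..N. \<Sum>l=1..N. Y (diagonal_current k l) (-1) (diagonal_current k l)"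
  have "Y ?B 1 v = 0" unfolding mode_sum_left using diag by (intro sum.neutral ballI) auto
  then have "Y ?A 1 v = Y (?A + ?B) 1 v" by simp
  also have "\<dots> = - (2 * (of_nat N + of_nat n - 2)) *s twice_weight_op v"
    unfolding sugawara_vector by (simp add: twice_weight_op_def mode_sum_left)
  finally have "Y ?A 1 v = - ((2 * (of_nat N + of_nat n - 2)) *s twice_weight_op v)"
    by (simp only: scale_minus_left)
  then have "defect v = - (Y ?A 1 v - current_square v)"
    by (simp only: defect_def) simp
  also have "Y ?A 1 v - current_square v = (\<Sum>i=1..n. \<Sum>j=1..n.
    Y (Y (dual_current i j) (-1) (dual_current i j)) 1 v - Y (dual_current i j) 0 (Y (dual_current i j) 0 v))"
    by (simp add: current_square_def mode_sum_left sum_subtractf)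
  finally show ?thesis
    using dual U(1) by (auto intro!: subspace_neg subspace_sum)
qed

lemma dual_current_energy_space:
  assumes ij: "i \<in> {1..n}" "j \<in> {1..n}" and r: "r \<ge> 0" and v: "v \<in> energy_space e"
  shows "Y (dual_current i j) r v \<in> energy_space (e - 2 * r)"
proof -
  have word: "Y (dual_current i j) r (creation_word Psi xs vac) \<in> energy_space (energy xs - 2 * r)"
    if "fst ` set xs \<subseteq> Idx" for xs
    using that
  proof (induction xs)
    case Nil
    then show ?case using r by (simp add: creation subspace_0[OF subspace_energy_space])
  next
    case (Cons x xs)
    let ?w = "creation_word Psi xs vac" and ?s = "- 1 - int (snd x)"
    obtain k c where kc: "fst x = (k, c)" by (cases "fst x")
    have I: "k \<in> {1..N}" "c \<in> {1..n}" and w: "?w \<in> energy_space (energy xs)"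
      using Cons.prems kc by (auto intro!: creation_word_energy_space)
    have A: "Psi (k, c) ?s (Y (dual_current i j) r ?w) \<in> energy_space (energy (x # xs) - 2 * r)"
      using Psi_energy_space[of "(k, c)" "Y (dual_current i j) r ?w" "energy xs - 2 * r" ?s] Cons I by (auto simp: algebra_simps)
    have B: "(if P then Psi (k, d) (r + ?s) ?w else 0) \<in> energy_space (energy (x # xs) - 2 * r)" if "d \<in> {1..n}" for P d
      using Psi_energy_space[of "(k, d)" ?w "energy xs" "r + ?s"] w I that subspace_0[OF subspace_energy_space]
      by (auto simp: algebra_simps)
    have "Y (dual_current i j) r (creation_word Psi (x # xs) vac) = Psi (k, c) ?s (Y (dual_current i j) r ?w)
      + (if j = c then Psi (k, i) (r + ?s) ?w else 0) - (if i = c then Psi (k, j) (r + ?s) ?w else 0)"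
      using dual_current_commutator[OF ij I, of r ?s ?w] kc by simp
    then show ?case
      using subspace_diff[OF subspace_energy_space subspace_add[OF subspace_energy_space A B[OF ij(1)]] B[OF ij(2)]] by simp
  qed
  show ?thesis
  proof (rule linear_energy_space_mapsto[where f="Y (dual_current i j) r", OF _ _ subspace_energy_space _ v])
    fix xs assume "fst ` set xs \<subseteq> Idx" "energy xs = e"
    then show "Y (dual_current i j) r (creation_word Psi xs vac) \<in> energy_space (e - 2 * r)"
      using word by blast
  qed (rule mode_simps)+
qed

lemma twice_weight_op_Psi:
  assumes "c \<in> Idx"
  shows "twice_weight_op (Psi c s v) = Psi c s (twice_weight_op v) - of_int (2 * s + 1) *s Psi c s v"
proof -
  have "twice_weight_op (Psi c s v) = (\<Sum>a\<in>Idx. Psi c s (Y (fermion_conformal a) 1 v) + (if a = c then - of_int (2 * s + 1) *s Psi c s v else 0))"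
    unfolding twice_weight_op_def using assms by (intro sum.cong refl) (auto simp: fermion_conformal_commutator)
  also have "\<dots> = Psi c s (twice_weight_op v) + - of_int (2 * s + 1) *s Psi c s v"
    unfolding sum.distrib using assms by (subst sum.delta) (auto simp: twice_weight_op_def Psi_sum)
  also have "\<dots> = Psi c s (twice_weight_op v) - of_int (2 * s + 1) *s Psi c s v"
    by (simp only: scale_minus_left) simp
  finally show ?thesis .
qed

end

section \<open>The split form of the orthogonal Lie algebra\<close>

text \<open>
  The rows of this matrix form a basis of \<open>\<complex>\<^sup>n\<close> in which the standard symmetric bilinear form
  becomes antidiagonal: row \<open>a\<close> pairs to \<open>1\<close> with row \<open>n + 1 - a\<close> and to \<open>0\<close> with all the others.
\<close>

definition split_coeff :: "nat \<Rightarrow> nat \<Rightarrow> nat \<Rightarrow> complex"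
  where "split_coeff n a i =
    (if a < Suc n - a then of_bool (i = a) + \<i> * of_bool (i = Suc n - a)
     else if a = Suc n - a then of_bool (i = a)
     else (of_bool (i = Suc n - a) - \<i> * of_bool (i = a)) / 2)"

lemma sum_split_coeff_row:
  assumes "a \<in> {1..n}"
  shows "(\<Sum>i=1..n. split_coeff n a i * f i) =
    (if a < Suc n - a then f a + \<i> * f (Suc n - a) else if a = Suc n - a then f a
     else (f (Suc n - a) - \<i> * f a) / 2)"
proof -
  have 1: "(\<Sum>i=1..n. of_bool (i = c) * f i) = f c" if "c \<in> {1..n}" for c
    using that by (simp add: of_bool_def if_distrib[of "\<lambda>x. x * _"] cong: if_cong)
  have a': "Suc n - a \<in> {1..n}" using assms by auto
  have "(\<Sum>i=1..n. (x * of_bool (i = a) + y * of_bool (i = Suc n - a)) * f i) = x * f a + y * f (Suc n - a)" for x y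
    using 1[OF assms] 1[OF a'] by (simp add: distrib_right sum.distrib mult.assoc flip: sum_distrib_left)
  from this[of 1 \<i>] this[of 1 0] this[of "- \<i> / 2" "1 / 2"] show ?thesis
    by (simp add: split_coeff_def algebra_simps diff_divide_distrib add_divide_distrib)
qed

lemma split_coeff_orthogonal:
  assumes "a \<in> {1..n}" "b \<in> {1..n}"
  shows "(\<Sum>i=1..n. split_coeff n a i * split_coeff n b i) = of_bool (b = Suc n - a)"
  unfolding sum_split_coeff_row[OF assms(1)] using assms
  by (auto simp: split_coeff_def algebra_simps)

lemma sum_split_coeff_column:
  assumes "i \<in> {1..n}"
  shows "(\<Sum>a=1..n. split_coeff n a i * f a) =
    (if i < Suc n - i then f i + f (Suc n - i) / 2 else if i = Suc n - i then f i
     else \<i> * f (Suc n - i) - \<i> / 2 * f i)"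
proof -
  have i': "Suc n - i \<in> {1..n}" using assms by auto
  have "(\<Sum>a=1..n. split_coeff n a i * f a) = (\<Sum>a=1..n. (if a = i then split_coeff n i i * f i else 0) +
      (if a = Suc n - i then if i = Suc n - i then 0 else split_coeff n (Suc n - i) i * f (Suc n - i) else 0))"
    by (rule sum.cong) (use assms in \<open>auto simp: split_coeff_def\<close>)
  also have "\<dots> = split_coeff n i i * f i + (if i = Suc n - i then 0 else split_coeff n (Suc n - i) i * f (Suc n - i))"
    using assms i' by (simp add: sum.distrib del: Suc_diff_le)
  finally show ?thesis using assms by (auto simp: split_coeff_def)
qed

lemma split_coeff_dual_orthogonal:
  assumes "i \<in> {1..n}" "l \<in> {1..n}"
  shows "(\<Sum>a=1..n. split_coeff n a i * split_coeff n (Suc n - a) l) = of_bool (i = l)"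
  unfolding sum_split_coeff_column[OF assms(1)] using assms
  by (auto simp: split_coeff_def algebra_simps)

context fermionic_vertex_superalgebra
begin

abbreviation J0 :: "nat \<Rightarrow> nat \<Rightarrow> 'v \<Rightarrow> 'v"
  where "J0 i j \<equiv> Y (dual_current i j) 0"

lemma J0_bracket:
  assumes "i \<in> {1..n}" "j \<in> {1..n}" "k \<in> {1..n}" "l \<in> {1..n}"
  shows "J0 k l (J0 i j v) = J0 i j (J0 k l v) + (if l = i then J0 k j v else 0) - (if k = i then J0 l j v else 0)
    + (if l = j then J0 i k v else 0) - (if k = j then J0 i l v else 0)"
proof -
  have "J0 k l (dual_current i j) = (\<Sum>p=1..N. (if l = i then quadratic (p, k) (p, j) else 0) - (if k = i then quadratic (p, l) (p, j) else 0)
    + (if l = j then quadratic (p, i) (p, k) else 0) - (if k = j then quadratic (p, i) (p, l) else 0))"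
    unfolding dual_current_def[of i j] mode_sum_right
  proof (rule sum.cong[OF refl])
    fix p assume "p \<in> {1..N}"
    then show "J0 k l (quadratic (p, i) (p, j)) = (if l = i then quadratic (p, k) (p, j) else 0) - (if k = i then quadratic (p, l) (p, j) else 0)
      + (if l = j then quadratic (p, i) (p, k) else 0) - (if k = j then quadratic (p, i) (p, l) else 0)"
      unfolding quadratic_def using assms by (simp add: dual_current_commutator creation Psi_linear)
  qed
  also have "\<dots> = (if l = i then dual_current k j else 0) - (if k = i then dual_current l j else 0)
    + (if l = j then dual_current i k else 0) - (if k = j then dual_current i l else 0)"
    by (simp add: dual_current_def sum.distrib sum_subtractf)
  finally show ?thesis
    using zero_mode_derivation[OF dual_current_even[of k l] dual_current_even[of i j], of 0 v] assms
    by simp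
qed

text \<open>
  The invariance of the Casimir operator: moving \<open>J0 k l\<close> through the squares produces products of two
  zero modes that cancel in pairs.
\<close>

lemma current_square_J0:
  assumes "k \<in> {1..n}" "l \<in> {1..n}"
  shows "current_square (J0 k l v) = J0 k l (current_square v)"
proof -
  define d where "d = (\<lambda>i j x. (if l = i then J0 k j x else 0) - (if k = i then J0 l j x else 0)
    + (if l = j then J0 i k x else 0) - (if k = j then J0 i l x else 0))"
  have br: "J0 k l (J0 i j x) = J0 i j (J0 k l x) + d i j x" if "i \<in> {1..n}" "j \<in> {1..n}" for i j x
    using J0_bracket[OF that assms] by (simp add: d_def)
  have "J0 k l (current_square v) = (\<Sum>i=1..n. \<Sum>j=1..n. J0 k l (J0 i j (J0 i j v)))"
    by (simp add: current_square_def mode_sum_right)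
  also have "\<dots> = (\<Sum>i=1..n. \<Sum>j=1..n. J0 i j (J0 i j (J0 k l v)) + (J0 i j (d i j v) + d i j (J0 i j v)))"
    by (intro sum.cong refl) (simp add: br)
  also have "\<dots> = current_square (J0 k l v) + (\<Sum>i=1..n. \<Sum>j=1..n. J0 i j (d i j v) + d i j (J0 i j v))"
    by (simp add: current_square_def sum.distrib)
  also have "(\<Sum>i=1..n. \<Sum>j=1..n. J0 i j (d i j v) + d i j (J0 i j v)) =
    (\<Sum>i=1..n. \<Sum>j=1..n. (if l = i then J0 l j (J0 k j v) + J0 k j (J0 l j v) else 0)
     - (if k = i then J0 k j (J0 l j v) + J0 l j (J0 k j v) else 0)
     + (if l = j then J0 i l (J0 i k v) + J0 i k (J0 i l v) else 0)
     - (if k = j then J0 i k (J0 i l v) + J0 i l (J0 i k v) else 0))"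
    by (intro sum.cong refl) (simp add: d_def)
  also have "\<dots> = 0"
  proof -
    have row: "(\<Sum>i=1..n. \<Sum>j=1..n. if x = i then f j else 0) = (\<Sum>j=1..n. f j)"
      if "x \<in> {1..n}" for x and f :: "nat \<Rightarrow> 'v"
      using that by (subst sum.swap) simp
    have column: "(\<Sum>i=1..n. \<Sum>j=1..n. if x = j then f i else 0) = (\<Sum>i=1..n. f i)"
      if "x \<in> {1..n}" for x and f :: "nat \<Rightarrow> 'v"
      using that by simp
    show ?thesis
      unfolding sum.distrib sum_subtractf row[OF assms(1)] row[OF assms(2)] column[OF assms(1)] column[OF assms(2)]
      by simp
  qed
  finally show ?thesis by simp
qed

abbreviation g :: "nat \<Rightarrow> nat \<Rightarrow> complex" where "g \<equiv> split_coeff n"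

text \<open>
  The fermions in the basis given by \<open>split_coeff\<close>, and the corresponding matrix units \<open>E a b\<close> of
  \<open>so\<^sub>n\<close>, subject to \<open>E a b = - E (n + 1 - b) (n + 1 - a)\<close>.  The operators \<open>E a a\<close> span a Cartan
  subalgebra, and \<open>E a b\<close> with \<open>a < b\<close> are the raising operators.
\<close>

definition chi :: "nat \<times> nat \<Rightarrow> int \<Rightarrow> 'v \<Rightarrow> 'v"
  where "chi x r v = (\<Sum>i=1..n. g (snd x) i *s Psi (fst x, i) r v)"

definition E :: "nat \<Rightarrow> nat \<Rightarrow> 'v \<Rightarrow> 'v"
  where "E a b v = (\<Sum>i=1..n. \<Sum>j=1..n. (g a i * g (Suc n - b) j) *s J0 i j v)"

lemma chi_linear:
  assumes "x \<in> Idx"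
  shows "chi x r (u + v) = chi x r u + chi x r v" "chi x r (u - v) = chi x r u - chi x r v"
    "chi x r (- v) = - chi x r v" "chi x r 0 = 0" "chi x r (c *s v) = c *s chi x r v"
proof -
  have I: "(fst x, i) \<in> Idx" if "i \<in> {1..n}" for i using assms that by auto
  have "chi x r (u + v) = (\<Sum>i=1..n. g (snd x) i *s Psi (fst x, i) r u + g (snd x) i *s Psi (fst x, i) r v)"
    unfolding chi_def using I by (intro sum.cong refl) (simp add: Psi_linear scale_right_distrib)
  then show add: "chi x r (u + v) = chi x r u + chi x r v" for u v
    unfolding chi_def using I by (simp add: Psi_linear scale_right_distrib sum.distrib)
  have "chi x r (c *s v) = (\<Sum>i=1..n. c *s (g (snd x) i *s Psi (fst x, i) r v))" for c v
    unfolding chi_def using I by (intro sum.cong refl) (simp add: Psi_linear mult.commute)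
  then show scale: "chi x r (c *s v) = c *s chi x r v" for c v
    by (simp add: chi_def scale_sum_right)
  show neg: "chi x r (- v) = - chi x r v" for v using scale[of "-1" v] by simp
  show "chi x r (u - v) = chi x r u - chi x r v" using add[of u "- v"] neg by simp
  show "chi x r 0 = 0" using scale[of 0 0] by simp
qed

lemma chi_creation_anticommute:
  assumes "x \<in> Idx" "y \<in> Idx" "r < 0" "s < 0"
  shows "chi x r (chi y s v) = - chi y s (chi x r v)"
proof -
  have I: "(fst x, i) \<in> Idx" "(fst y, i) \<in> Idx" if "i \<in> {1..n}" for i using assms that by auto
  have "chi x r (chi y s v) = (\<Sum>i=1..n. \<Sum>j=1..n. (g (snd x) i * g (snd y) j) *s Psi (fst x, i) r (Psi (fst y, j) s v))"
    unfolding chi_def using I by (intro sum.cong refl) (simp add: Psi_sum Psi_linear scale_sum_right)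
  also have "\<dots> = (\<Sum>i=1..n. \<Sum>j=1..n. - ((g (snd y) j * g (snd x) i) *s Psi (fst y, j) s (Psi (fst x, i) r v)))"
    using I assms by (intro sum.cong refl) (simp add: Psi_creation_anticommute[of "(fst x, _)" "(fst y, _)"] mult.commute)
  also have "\<dots> = - (\<Sum>j=1..n. \<Sum>i=1..n. (g (snd y) j * g (snd x) i) *s Psi (fst y, j) s (Psi (fst x, i) r v))"
    by (subst sum.swap) (simp add: sum_negf)
  also have "(\<Sum>j=1..n. \<Sum>i=1..n. (g (snd y) j * g (snd x) i) *s Psi (fst y, j) s (Psi (fst x, i) r v)) = chi y s (chi x r v)"
    unfolding chi_def using I by (intro sum.cong refl) (simp add: Psi_sum Psi_linear scale_sum_right)
  finally show ?thesis .
qed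

lemma Psi_eq_chi:
  assumes "k \<in> {1..N}" "i \<in> {1..n}"
  shows "Psi (k, i) r v = (\<Sum>a=1..n. g (Suc n - a) i *s chi (k, a) r v)"
proof -
  have "(\<Sum>a=1..n. g (Suc n - a) i *s chi (k, a) r v) = (\<Sum>a=1..n. \<Sum>l=1..n. (g a l * g (Suc n - a) i) *s Psi (k, l) r v)"
    by (simp add: chi_def scale_sum_right mult.commute)
  also have "\<dots> = (\<Sum>l=1..n. (\<Sum>a=1..n. g a l * g (Suc n - a) i) *s Psi (k, l) r v)"
    by (subst sum.swap) (simp add: scale_sum_left)
  also have "\<dots> = (\<Sum>l=1..n. if l = i then Psi (k, l) r v else 0)"
    by (intro sum.cong refl, subst split_coeff_dual_orthogonal) (use assms in auto)
  also have "\<dots> = Psi (k, i) r v" using assms by simp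
  finally show ?thesis ..
qed

lemma E_linear:
  "E a b (u + v) = E a b u + E a b v" "E a b (u - v) = E a b u - E a b v"
  "E a b (- v) = - E a b v" "E a b 0 = 0" "E a b (c *s v) = c *s E a b v"
  by (simp_all add: E_def scale_right_distrib scale_right_diff_distrib sum.distrib sum_subtractf sum_negf
    scale_sum_right mult.left_commute mult.commute)

lemma E_vac: "E a b vac = 0"
  by (simp add: E_def creation)

lemma E_chi:
  assumes "a \<in> {1..n}" "b \<in> {1..n}" "k \<in> {1..N}" "c \<in> {1..n}"
  shows "E a b (chi (k, c) s v) = chi (k, c) s (E a b v) + (if c = b then chi (k, a) s v else 0)
    - (if c = Suc n - a then chi (k, Suc n - b) s v else 0)"
proof -
  let ?b = "Suc n - b"
  have b: "?b \<in> {1..n}" "Suc n - ?b = b" using assms(2) by auto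
  have kc: "(k, c) \<in> Idx" using assms by auto
  have J: "J0 i j (chi (k, c) s v) = chi (k, c) s (J0 i j v) + g c j *s Psi (k, i) s v - g c i *s Psi (k, j) s v"
    if "i \<in> {1..n}" "j \<in> {1..n}" for i j
  proof -
    have "J0 i j (chi (k, c) s v) = (\<Sum>d=1..n. g c d *s Psi (k, d) s (J0 i j v)
        + (if d = j then g c d *s Psi (k, i) s v else 0) - (if d = i then g c d *s Psi (k, j) s v else 0))"
      unfolding chi_def mode_sum_right
      by (intro sum.cong refl)
        (use assms that in \<open>auto simp: dual_current_commutator scale_right_distrib scale_right_diff_distrib\<close>)
    also have "\<dots> = chi (k, c) s (J0 i j v) + g c j *s Psi (k, i) s v - g c i *s Psi (k, j) s v"
      using that by (simp add: chi_def sum.distrib sum_subtractf)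
    finally show ?thesis .
  qed
  have chi_sum: "chi (k, c) s (\<Sum>i\<in>A. f i) = (\<Sum>i\<in>A. chi (k, c) s (f i))" for A :: "nat set" and f
    by (induction A rule: infinite_finite_induct) (simp_all add: chi_linear[OF kc])
  have "E a b (chi (k, c) s v) = (\<Sum>i=1..n. \<Sum>j=1..n. (g a i * g ?b j) *s chi (k, c) s (J0 i j v)
     + (g a i * (g ?b j * g c j)) *s Psi (k, i) s v - (g ?b j * (g a i * g c i)) *s Psi (k, j) s v)"
    unfolding E_def
    by (intro sum.cong refl) (simp add: J scale_right_distrib scale_right_diff_distrib ac_simps)
  also have "\<dots> = (\<Sum>i=1..n. \<Sum>j=1..n. (g a i * g ?b j) *s chi (k, c) s (J0 i j v))
     + (\<Sum>i=1..n. \<Sum>j=1..n. (g a i * (g ?b j * g c j)) *s Psi (k, i) s v)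
     - (\<Sum>i=1..n. \<Sum>j=1..n. (g ?b j * (g a i * g c i)) *s Psi (k, j) s v)"
    by (simp add: sum.distrib sum_subtractf)
  also have "(\<Sum>i=1..n. \<Sum>j=1..n. (g a i * g ?b j) *s chi (k, c) s (J0 i j v)) = chi (k, c) s (E a b v)"
    by (simp add: E_def chi_sum chi_linear[OF kc])
  also have "(\<Sum>i=1..n. \<Sum>j=1..n. (g a i * (g ?b j * g c j)) *s Psi (k, i) s v) =
     (\<Sum>i=1..n. (g a i * (\<Sum>j=1..n. g ?b j * g c j)) *s Psi (k, i) s v)"
    by (simp add: scale_sum_left sum_distrib_left)
  also have "\<dots> = (if c = b then chi (k, a) s v else 0)"
    using split_coeff_orthogonal[OF b(1) assms(4)] b(2) by (simp add: chi_def)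
  also have "(\<Sum>i=1..n. \<Sum>j=1..n. (g ?b j * (g a i * g c i)) *s Psi (k, j) s v) =
     (\<Sum>j=1..n. (g ?b j * (\<Sum>i=1..n. g a i * g c i)) *s Psi (k, j) s v)"
    by (subst sum.swap) (simp add: scale_sum_left sum_distrib_left)
  also have "\<dots> = (if c = Suc n - a then chi (k, Suc n - b) s v else 0)"
    using split_coeff_orthogonal[OF assms(1,4)] by (simp add: chi_def)
  finally show ?thesis .
qed

text \<open>
  The coefficients of the antisymmetric currents are symmetric here.
\<close>

lemma E_opposite:
  assumes "a \<in> {1..n}"
  shows "E a (Suc n - a) v = 0"
proof -
  have a: "Suc n - (Suc n - a) = a" using assms by auto
  have "E a (Suc n - a) v = (\<Sum>i=1..n. \<Sum>j=1..n. (g a i * g a j) *s J0 i j v)"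
    by (simp only: E_def a)
  also have "\<dots> = (\<Sum>i=1..n. \<Sum>j=1..n. - ((g a j * g a i) *s J0 j i v))"
  proof (intro sum.cong refl)
    fix i j assume "i \<in> {1..n}" "j \<in> {1..n}"
    then show "(g a i * g a j) *s J0 i j v = - ((g a j * g a i) *s J0 j i v)"
      by (subst dual_current_swap[of i j]) simp_all
  qed
  also have "\<dots> = - (\<Sum>j=1..n. \<Sum>i=1..n. (g a j * g a i) *s J0 j i v)"
    by (subst sum.swap) (simp add: sum_negf)
  also have "(\<Sum>j=1..n. \<Sum>i=1..n. (g a j * g a i) *s J0 j i v) = E a (Suc n - a) v"
    by (simp only: E_def a)
  finally have "2 *s E a (Suc n - a) v = 0"
    using scale_left_distrib[of 1 1 "E a (Suc n - a) v"] by (simp add: eq_neg_iff_add_eq_0)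
  then show ?thesis by simp
qed

text \<open>
  The Casimir operator does not depend on the pair of dual bases in which it is written.
\<close>

lemma current_square_eq_E: "current_square v = - (\<Sum>a=1..n. \<Sum>b=1..n. E a b (E b a v))"
proof -
  have J0_sum: "J0 i j (\<Sum>k\<in>A. f k) = (\<Sum>k\<in>A. J0 i j (f k))" for A :: "nat set" and f i j
    by (rule mode_sum_right)
  have "(\<Sum>a=1..n. \<Sum>b=1..n. E a b (E b a v)) = (\<Sum>a=1..n. \<Sum>b=1..n. \<Sum>i=1..n. \<Sum>j=1..n. \<Sum>k=1..n. \<Sum>l=1..n.
      (g a i * g (Suc n - b) j * (g b k * g (Suc n - a) l)) *s J0 i j (J0 k l v))"
    by (simp add: E_def J0_sum scale_sum_right)
  also have "\<dots> = (\<Sum>i=1..n. \<Sum>j=1..n. \<Sum>a=1..n. \<Sum>b=1..n. \<Sum>k=1..n. \<Sum>l=1..n.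
      (g a i * g (Suc n - b) j * (g b k * g (Suc n - a) l)) *s J0 i j (J0 k l v))"
    by (rule sum_swap_pairs)
  also have "\<dots> = (\<Sum>i=1..n. \<Sum>j=1..n. \<Sum>k=1..n. \<Sum>l=1..n. \<Sum>a=1..n. \<Sum>b=1..n.
      (g a i * g (Suc n - b) j * (g b k * g (Suc n - a) l)) *s J0 i j (J0 k l v))"
    by (intro sum.cong refl sum_swap_pairs)
  also have "\<dots> = (\<Sum>i=1..n. \<Sum>j=1..n. \<Sum>k=1..n. \<Sum>l=1..n.
      ((\<Sum>a=1..n. g a i * g (Suc n - a) l) * (\<Sum>b=1..n. g b k * g (Suc n - b) j)) *s J0 i j (J0 k l v))"
    by (simp add: sum_product scale_sum_left ac_simps)
  also have "\<dots> = (\<Sum>i=1..n. \<Sum>j=1..n. \<Sum>k=1..n. \<Sum>l=1..n.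
      if l = i then if k = j then J0 i j (J0 k l v) else 0 else 0)"
    by (intro sum.cong refl, subst (1 2) split_coeff_dual_orthogonal) auto
  also have "\<dots> = (\<Sum>i=1..n. \<Sum>j=1..n. J0 i j (J0 j i v))"
    by (intro sum.cong refl) simp
  also have "\<dots> = - current_square v"
    unfolding current_square_def sum_negf[symmetric]
  proof (intro sum.cong refl)
    fix i j assume "i \<in> {1..n}" "j \<in> {1..n}"
    then show "J0 i j (J0 j i v) = - J0 i j (J0 i j v)"
      by (subst dual_current_swap[of i j]) simp_all
  qed
  finally show ?thesis by simp
qed

end

section \<open>An estimate for Casimir eigenvalues\<close>

text \<open>
  \<open>weight n a\<close> is the eigenvalue of \<open>E a a\<close> on a word in the split fermions, and \<open>height\<close> orders the
  words in such a way that \<open>E a b\<close> raises it by \<open>2 * (b - a)\<close>.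
\<close>

definition weight :: "nat \<Rightarrow> nat \<Rightarrow> ((nat \<times> nat) \<times> nat) list \<Rightarrow> int"
  where "weight n a xs = (\<Sum>x\<leftarrow>xs. of_bool (snd (fst x) = a) - of_bool (snd (fst x) = Suc n - a))"

definition height :: "nat \<Rightarrow> ((nat \<times> nat) \<times> nat) list \<Rightarrow> int"
  where "height n xs = (\<Sum>x\<leftarrow>xs. int n + 1 - 2 * int (snd (fst x)))"

lemma weight_simps [simp]:
  "weight n a [] = 0"
  "weight n a (x # xs) = of_bool (snd (fst x) = a) - of_bool (snd (fst x) = Suc n - a) + weight n a xs"
  by (simp_all add: weight_def)

lemma height_simps [simp]:
  "height n [] = 0" "height n (x # xs) = int n + 1 - 2 * int (snd (fst x)) + height n xs"
  by (simp_all add: height_def)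

lemma height_le:
  assumes "fst ` set xs \<subseteq> {1..N} \<times> {1..n}"
  shows "height n xs \<le> int n * energy xs"
proof -
  have "height n xs \<le> int n * int (length xs)"
    using assms by (induction xs) (auto simp: algebra_simps)
  also have "\<dots> \<le> int n * energy xs"
    by (intro mult_left_mono energy_ge_length) auto
  finally show ?thesis .
qed

text \<open>
  The sum of the first \<open>m\<close> odd numbers is \<open>m\<^sup>2\<close>.  Since a nonzero word repeats no letter, this bounds
  its energy from below by the sum of the squares of the multiplicities of its fermions.
\<close>

lemma card_square_le_sum_odd: "finite S \<Longrightarrow> (int (card S))\<^sup>2 \<le> (\<Sum>t\<in>S. 2 * int t + 1)"
proof (induction "card S" arbitrary: S)
  case 0
  then show ?case by simp
next
  case (Suc m)
  then have ne: "S \<noteq> {}" by auto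
  let ?M = "Max S"
  have M: "?M \<in> S" using Suc ne by auto
  have "S \<subseteq> {..?M}" using Suc by auto
  then have "card S \<le> card {..?M}" by (intro card_mono) auto
  then have mM: "m \<le> ?M" using Suc by simp
  have "card (S - {?M}) = m" using Suc M by simp
  then have "(int m)\<^sup>2 \<le> (\<Sum>t\<in>S - {?M}. 2 * int t + 1)"
    using Suc(1)[of "S - {?M}"] Suc(3) by simp
  moreover have "(\<Sum>t\<in>S. 2 * int t + 1) = (2 * int ?M + 1) + (\<Sum>t\<in>S - {?M}. 2 * int t + 1)"
    using Suc M by (simp add: sum.remove)
  moreover have "(int (card S))\<^sup>2 = (int m)\<^sup>2 + 2 * int m + 1"
    using Suc(2)[symmetric] by (simp add: power2_eq_square algebra_simps)
  ultimately show ?case using mM by linarith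
qed

text \<open>
  The Cauchy-Schwarz inequality against the constant function \<open>1\<close>.
\<close>

lemma sum_square_le_card_sum_squares:
  fixes q :: "'a \<Rightarrow> int"
  shows "(\<Sum>k\<in>A. q k)\<^sup>2 \<le> int (card A) * (\<Sum>k\<in>A. (q k)\<^sup>2)"
proof (cases "finite A")
  case True
  have "0 \<le> (\<Sum>k\<in>A. \<Sum>l\<in>A. (q k - q l)\<^sup>2)"
    by (intro sum_nonneg) simp
  also have "(\<Sum>k\<in>A. \<Sum>l\<in>A. (q k - q l)\<^sup>2) = (\<Sum>k\<in>A. \<Sum>l\<in>A. (q k)\<^sup>2 + (q l)\<^sup>2 - 2 * (q k * q l))"
    by (intro sum.cong refl) (simp add: power2_eq_square algebra_simps)
  also have "\<dots> = 2 * (int (card A) * (\<Sum>k\<in>A. (q k)\<^sup>2)) - 2 * (\<Sum>k\<in>A. q k)\<^sup>2"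
    by (simp add: sum.distrib sum_subtractf sum_product power2_eq_square flip: sum_distrib_left)
  finally show ?thesis by simp
qed simp

text \<open>
  For \<open>2 * a \<le> n\<close> this is \<open>n - 2 * a\<close>, the \<open>a\<close>-th coordinate of the sum of the positive roots of
  \<open>so\<^sub>n\<close>; it is continued antisymmetrically under \<open>a \<mapsto> n + 1 - a\<close>.
\<close>

definition rho_coeff :: "nat \<Rightarrow> nat \<Rightarrow> int"
  where "rho_coeff n a = int n + 1 - 2 * int a - (if a < Suc n - a then 1 else if Suc n - a < a then -1 else 0)"

lemma sum_positive_roots:
  fixes \<mu> :: "nat \<Rightarrow> int"
  shows "(\<Sum>a=1..n. \<Sum>b=1..n. if a < b \<and> b \<noteq> Suc n - a then \<mu> a - \<mu> b else 0) = (\<Sum>a=1..n. rho_coeff n a * \<mu> a)"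
proof -
  have up: "int (card {b \<in> {1..n}. a < b \<and> b \<noteq> Suc n - a}) = int n - int a - (if a < Suc n - a then 1 else 0)"
    if "a \<in> {1..n}" for a
  proof -
    have "{b \<in> {1..n}. a < b \<and> b \<noteq> Suc n - a} = {a<..n} - {Suc n - a}" by auto
    moreover have "Suc n - a \<in> {a<..n} \<longleftrightarrow> a < Suc n - a" using that by auto
    ultimately show ?thesis
      using that by (cases "a < Suc n - a") (simp_all add: card_Diff_singleton_if of_nat_diff)
  qed
  have down: "int (card {b \<in> {1..n}. b < a \<and> a \<noteq> Suc n - b}) = int a - 1 - (if Suc n - a < a then 1 else 0)"
    if "a \<in> {1..n}" for a
  proof -
    have "{b \<in> {1..n}. b < a \<and> a \<noteq> Suc n - b} = {1..<a} - {Suc n - a}" using that by auto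
    moreover have "Suc n - a \<in> {1..<a} \<longleftrightarrow> Suc n - a < a" using that by auto
    ultimately show ?thesis
      using that by (cases "Suc n - a < a") (simp_all add: card_Diff_singleton_if of_nat_diff)
  qed
  have "(\<Sum>a=1..n. \<Sum>b=1..n. if a < b \<and> b \<noteq> Suc n - a then \<mu> a - \<mu> b else 0) =
     (\<Sum>a=1..n. \<Sum>b=1..n. if a < b \<and> b \<noteq> Suc n - a then \<mu> a else 0)
     - (\<Sum>a=1..n. \<Sum>b=1..n. if a < b \<and> b \<noteq> Suc n - a then \<mu> b else 0)"
    unfolding sum_subtractf[symmetric] by (intro sum.cong refl) simp
  also have "(\<Sum>a=1..n. \<Sum>b=1..n. if a < b \<and> b \<noteq> Suc n - a then \<mu> b else 0) =
     (\<Sum>a=1..n. \<Sum>b=1..n. if b < a \<and> a \<noteq> Suc n - b then \<mu> a else 0)"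
    by (rule sum.swap)
  also have "(\<Sum>a=1..n. \<Sum>b=1..n. if a < b \<and> b \<noteq> Suc n - a then \<mu> a else 0) =
     (\<Sum>a=1..n. int (card {b \<in> {1..n}. a < b \<and> b \<noteq> Suc n - a}) * \<mu> a)"
    by (intro sum.cong refl) (simp only: sum.inter_filter[symmetric] finite_atLeastAtMost sum_constant of_nat_id)
  also have "(\<Sum>a=1..n. \<Sum>b=1..n. if b < a \<and> a \<noteq> Suc n - b then \<mu> a else 0) =
     (\<Sum>a=1..n. int (card {b \<in> {1..n}. b < a \<and> a \<noteq> Suc n - b}) * \<mu> a)"
    by (intro sum.cong refl) (simp only: sum.inter_filter[symmetric] finite_atLeastAtMost sum_constant of_nat_id)
  also have "(\<Sum>a=1..n. int (card {b \<in> {1..n}. a < b \<and> b \<noteq> Suc n - a}) * \<mu> a)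
     - (\<Sum>a=1..n. int (card {b \<in> {1..n}. b < a \<and> a \<noteq> Suc n - b}) * \<mu> a) = (\<Sum>a=1..n. rho_coeff n a * \<mu> a)"
    unfolding sum_subtractf[symmetric]
    by (intro sum.cong refl) (simp only: up down, simp add: rho_coeff_def algebra_simps)
  finally show ?thesis .
qed

lemma rho_coeff_bounds:
  assumes "n \<ge> 3" "a \<in> {1..n}"
  shows "\<bar>rho_coeff n a\<bar> \<le> int n - 2" "1 < a \<Longrightarrow> a < n \<Longrightarrow> \<bar>rho_coeff n a\<bar> \<le> int n - 3"
    "rho_coeff n 1 = int n - 2"
proof -
  have lt: "a < Suc n - a \<longleftrightarrow> 2 * int a < int n + 1" "Suc n - a < a \<longleftrightarrow> int n + 1 < 2 * int a"
    using assms by auto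
  show "\<bar>rho_coeff n a\<bar> \<le> int n - 2"
    unfolding rho_coeff_def lt using assms by (cases "2 * int a < int n + 1"; cases "int n + 1 < 2 * int a") auto
  show "\<bar>rho_coeff n a\<bar> \<le> int n - 3" if "1 < a" "a < n"
    unfolding rho_coeff_def lt using assms that by (cases "2 * int a < int n + 1"; cases "int n + 1 < 2 * int a") auto
  show "rho_coeff n 1 = int n - 2"
    using assms by (simp add: rho_coeff_def)
qed

lemma sum_reflect: "(\<Sum>a=1..n. f (Suc n - a)) = (\<Sum>a=1..n. f a)"
  by (rule sum.reindex_bij_witness[of _ "\<lambda>a. Suc n - a" "\<lambda>a. Suc n - a"]) auto

text \<open>
  In the application \<open>m k a\<close> counts the letters \<open>(k, a)\<close> of a word.  Let \<open>Q a\<close> be the sum over \<open>k\<close> of the squared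
  charges \<open>m k a - m k (n + 1 - a)\<close>.  By Cauchy-Schwarz \<open>\<mu> a\<close> has square at most \<open>N * Q a\<close>, and
  \<open>\<bar>\<mu> a\<bar> \<le> Q a\<close> because the charges are integers.  As \<open>\<bar>rho_coeff n a\<bar> \<le> n - 2\<close>, the subtracted
  terms are at most \<open>(N + n - 2)\<close> times the sum of all \<open>Q a\<close>, which in turn is at most \<open>2 * e\<close>.

  Equality throughout would force \<open>Q a = 0\<close> for \<open>1 < a < n\<close>, then \<open>\<mu> 1 = Q 1 = e\<close> and finally
  \<open>e * e = N * e\<close>.  The value \<open>e = N\<close> does occur, for the product of the \<open>N\<close> fermions \<open>(k, 1)\<close>, but
  it is odd.
\<close>

lemma casimir_estimate:
  fixes N n :: nat and m :: "nat \<Rightarrow> nat \<Rightarrow> int" and \<mu> :: "nat \<Rightarrow> int" and e :: int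
  defines "\<mu> \<equiv> \<lambda>a. \<Sum>k=1..N. m k a - m k (Suc n - a)"
  assumes n: "n \<ge> 3" and N: "odd N" and m: "\<And>k a. m k a \<ge> 0"
    and e: "(\<Sum>k=1..N. \<Sum>a=1..n. (m k a)\<^sup>2) \<le> e" and e_even: "even e" "e > 0"
  shows "2 * (int N + int n - 2) * e - (\<Sum>a=1..n. (\<mu> a)\<^sup>2) - (\<Sum>a=1..n. rho_coeff n a * \<mu> a) > 0"
proof (rule ccontr)
  define q where "q = (\<lambda>k a. m k a - m k (Suc n - a))"
  define Q where "Q = (\<lambda>a. \<Sum>k=1..N. (q k a)\<^sup>2)"
  define P where "P = (\<lambda>a. (int N + int n - 2) * Q a - (\<mu> a)\<^sup>2 - rho_coeff n a * \<mu> a)"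
  have \<mu>: "\<mu> a = (\<Sum>k=1..N. q k a)" for a by (simp add: \<mu>_def q_def)
  have Q0: "Q a \<ge> 0" for a unfolding Q_def by (intro sum_nonneg) simp
  have CS: "(\<mu> a)\<^sup>2 \<le> int N * Q a" for a
    unfolding \<mu> Q_def using sum_square_le_card_sum_squares[of "\<lambda>k. q k a" "{1..N}"] by simp
  have abs_le: "\<bar>\<mu> a\<bar> \<le> Q a" for a
  proof -
    have "\<bar>x\<bar> \<le> x\<^sup>2" for x :: int
      using self_le_power[of "\<bar>x\<bar>" 2] by (cases "x = 0") auto
    then have "(\<Sum>k=1..N. \<bar>q k a\<bar>) \<le> Q a" unfolding Q_def by (intro sum_mono) auto
    then show ?thesis unfolding \<mu> using sum_abs[of "\<lambda>k. q k a" "{1..N}"] by linarith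
  qed
  have rho_le: "rho_coeff n a * \<mu> a \<le> \<bar>rho_coeff n a\<bar> * Q a" for a
  proof -
    have "rho_coeff n a * \<mu> a \<le> \<bar>rho_coeff n a\<bar> * \<bar>\<mu> a\<bar>" by (simp flip: abs_mult)
    also have "\<dots> \<le> \<bar>rho_coeff n a\<bar> * Q a" using abs_le by (intro mult_left_mono) auto
    finally show ?thesis .
  qed
  have P_lower: "P a \<ge> (int n - 2 - \<bar>rho_coeff n a\<bar>) * Q a" for a
    using CS[of a] rho_le[of a] unfolding P_def by (simp add: algebra_simps)
  have P0: "P a \<ge> 0" if "a \<in> {1..n}" for a
    using P_lower[of a] mult_nonneg_nonneg[of "int n - 2 - \<bar>rho_coeff n a\<bar>" "Q a"]
      rho_coeff_bounds(1)[OF n that] Q0[of a] by linarith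
  have Qsum: "(\<Sum>a=1..n. Q a) \<le> 2 * e"
  proof -
    have "(\<Sum>a=1..n. Q a) = (\<Sum>k=1..N. \<Sum>a=1..n. (q k a)\<^sup>2)"
      unfolding Q_def by (rule sum.swap)
    also have "\<dots> \<le> (\<Sum>k=1..N. \<Sum>a=1..n. (m k a)\<^sup>2 + (m k (Suc n - a))\<^sup>2)"
    proof (intro sum_mono)
      fix k a
      have "0 \<le> m k a * m k (Suc n - a)" using m by simp
      then show "(q k a)\<^sup>2 \<le> (m k a)\<^sup>2 + (m k (Suc n - a))\<^sup>2"
        unfolding q_def power2_diff by linarith
    qed
    also have "\<dots> = (\<Sum>k=1..N. 2 * (\<Sum>a=1..n. (m k a)\<^sup>2))"
      using sum_reflect[of "\<lambda>a. (m k a)\<^sup>2" n for k] by (simp add: sum.distrib)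
    also have "\<dots> \<le> 2 * e" using e by (simp flip: sum_distrib_left)
    finally show ?thesis .
  qed
  assume "\<not> 2 * (int N + int n - 2) * e - (\<Sum>a=1..n. (\<mu> a)\<^sup>2) - (\<Sum>a=1..n. rho_coeff n a * \<mu> a) > 0"
  moreover have "2 * (int N + int n - 2) * e - (\<Sum>a=1..n. (\<mu> a)\<^sup>2) - (\<Sum>a=1..n. rho_coeff n a * \<mu> a)
      = (int N + int n - 2) * (2 * e - (\<Sum>a=1..n. Q a)) + (\<Sum>a=1..n. P a)"
    unfolding P_def sum_subtractf sum_distrib_left[symmetric] right_diff_distrib by simp
  ultimately have le: "(int N + int n - 2) * (2 * e - (\<Sum>a=1..n. Q a)) + (\<Sum>a=1..n. P a) \<le> 0" by linarith
  have Psum: "(\<Sum>a=1..n. P a) \<ge> 0" by (intro sum_nonneg P0)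
  have c: "int N + int n - 2 > 0" using n by simp
  have "(int N + int n - 2) * (2 * e - (\<Sum>a=1..n. Q a)) \<ge> 0"
    using c Qsum by (intro mult_nonneg_nonneg) auto
  with le Psum have "(int N + int n - 2) * (2 * e - (\<Sum>a=1..n. Q a)) = 0" "(\<Sum>a=1..n. P a) = 0" by linarith+
  with c have eq: "2 * e = (\<Sum>a=1..n. Q a)" and "(\<Sum>a=1..n. P a) = 0" by auto
  then have Pz: "P a = 0" if "a \<in> {1..n}" for a
    using sum_nonneg_eq_0_iff[of "{1..n}" P] P0 that by auto
  have mid: "Q a = 0" if "1 < a" "a < n" for a
  proof -
    have a: "a \<in> {1..n}" using that by auto
    have "(int n - 2 - \<bar>rho_coeff n a\<bar>) * Q a \<ge> 1 * Q a"
      using rho_coeff_bounds(2)[OF n a that] Q0 by (intro mult_right_mono) auto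
    with P_lower[of a] Pz[OF a] Q0[of a] show ?thesis by linarith
  qed
  have "(\<Sum>a=1..n. Q a) = (\<Sum>a\<in>{1, n}. Q a)"
    using n by (intro sum.mono_neutral_right) (auto intro!: mid)
  also have "\<dots> = Q 1 + Q n" using n by simp
  also have "Q n = Q 1"
    unfolding Q_def q_def by (intro sum.cong refl) (simp add: power2_commute)
  finally have eQ: "e = Q 1" using eq by simp
  have one: "1 \<in> {1..n}" using n by simp
  have "(int N * Q 1 - (\<mu> 1)\<^sup>2) + (int n - 2) * (Q 1 - \<mu> 1) = 0"
    using Pz[OF one] unfolding P_def rho_coeff_bounds(3)[OF n one] by (simp add: algebra_simps)
  moreover have "(int n - 2) * (Q 1 - \<mu> 1) \<ge> 0" using n abs_le[of 1] by (intro mult_nonneg_nonneg) auto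
  ultimately have "int N * Q 1 = (\<mu> 1)\<^sup>2" "(int n - 2) * (Q 1 - \<mu> 1) = 0" using CS[of 1] by linarith+
  then have "int N * Q 1 = Q 1 * Q 1" using n by (auto simp: power2_eq_square)
  then have "e = int N" using eQ e_even by simp
  then show False using N e_even by simp
qed

text \<open>
  The diagonal entry of \<open>defect\<close> at a word: \<open>2 * (N + n - 2)\<close> times the energy minus twice the Casimir
  eigenvalue of a highest weight vector of the same weight.
\<close>

definition casimir_gap :: "nat \<Rightarrow> nat \<Rightarrow> ((nat \<times> nat) \<times> nat) list \<Rightarrow> int"
  where "casimir_gap N n xs = 2 * (int N + int n - 2) * energy xs - (\<Sum>a=1..n. (weight n a xs)\<^sup>2)
    - (\<Sum>a=1..n. \<Sum>b=1..n. if a < b \<and> b \<noteq> Suc n - a then weight n a xs - weight n b xs else 0)"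

lemma casimir_gap_pos:
  assumes "n \<ge> 3" "odd N" "distinct xs" "fst ` set xs \<subseteq> {1..N} \<times> {1..n}" "even (energy xs)" "energy xs > 0"
  shows "casimir_gap N n xs > 0"
proof -
  define T where "T = (\<lambda>k c. {t. ((k, c), t) \<in> set xs})"
  define m where "m = (\<lambda>k c. int (card (T k c)))"
  have finT: "finite (T k c)" for k c
    unfolding T_def by (rule finite_subset[of _ "snd ` set xs"]) force+
  have sum_eq: "(\<Sum>x\<leftarrow>xs. f x) = (\<Sum>k=1..N. \<Sum>c=1..n. \<Sum>t\<in>T k c. f ((k, c), t))" for f :: "(nat \<times> nat) \<times> nat \<Rightarrow> int"
  proof -
    have "set xs = Sigma ({1..N} \<times> {1..n}) (\<lambda>(k, c). T k c)"
      using assms(4) by (force simp: T_def)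
    moreover have "(\<Sum>x\<leftarrow>xs. f x) = sum f (set xs)"
      using assms(3) by (rule sum_list_distinct_conv_sum_set)
    moreover have "(\<Sum>k=1..N. \<Sum>c=1..n. \<Sum>t\<in>T k c. f ((k, c), t)) =
        (\<Sum>a\<in>{1..N} \<times> {1..n}. \<Sum>t\<in>(case a of (k, c) \<Rightarrow> T k c). f (a, t))"
      unfolding sum.cartesian_product by (intro sum.cong refl) auto
    moreover have "\<dots> = (\<Sum>(a, t)\<in>Sigma ({1..N} \<times> {1..n}) (\<lambda>(k, c). T k c). f (a, t))"
      by (rule sum.Sigma) (use finT in auto)
    ultimately show ?thesis by simp
  qed
  have "(\<Sum>k=1..N. \<Sum>a=1..n. (m k a)\<^sup>2) \<le> energy xs"
    unfolding energy_def sum_eq m_def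
    using card_square_le_sum_odd[OF finT] by (intro sum_mono) auto
  moreover have "weight n a xs = (\<Sum>k=1..N. m k a - m k (Suc n - a))" if a: "a \<in> {1..n}" for a
  proof -
    have a': "Suc n - a \<in> {1..n}" using a by auto
    have "weight n a xs = (\<Sum>k=1..N. \<Sum>c=1..n. m k c * (of_bool (c = a) - of_bool (c = Suc n - a)))"
      unfolding weight_def sum_eq m_def by simp
    also have "\<dots> = (\<Sum>k=1..N. (\<Sum>c=1..n. if c = a then m k c else 0) - (\<Sum>c=1..n. if c = Suc n - a then m k c else 0))"
      unfolding sum_subtractf[symmetric] by (intro sum.cong refl) auto
    also have "\<dots> = (\<Sum>k=1..N. m k a - m k (Suc n - a))"
      using a a' by (intro sum.cong refl) (simp only: sum.delta finite_atLeastAtMost if_True)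
    finally show ?thesis .
  qed
  ultimately show ?thesis
    using casimir_estimate[of n N m "energy xs"] assms
    unfolding casimir_gap_def sum_positive_roots by (simp add: m_def)
qed

context fermionic_vertex_superalgebra
begin

section \<open>Triangularity of the defect\<close>

abbreviation chi_word :: "((nat \<times> nat) \<times> nat) list \<Rightarrow> 'v"
  where "chi_word xs \<equiv> creation_word chi xs vac"

lemma chi_energy_space:
  assumes "x \<in> Idx" "v \<in> energy_space e"
  shows "chi x r v \<in> energy_space (e - 2 * r - 1)"
  unfolding chi_def using assms
  by (intro subspace_sum subspace_energy_space subspace_scale[OF subspace_energy_space] Psi_energy_space) auto

lemma chi_word_energy_space: "fst ` set xs \<subseteq> Idx \<Longrightarrow> chi_word xs \<in> energy_space (energy xs)"
proof (induction xs)
  case Nil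
  then show ?case using creation_word_energy_space[of "[]" 0] by simp
next
  case (Cons x xs)
  then show ?case
    using chi_energy_space[of "fst x" "chi_word xs" "energy xs" "- 1 - int (snd x)"] by (auto simp: algebra_simps)
qed

text \<open>
  The change of basis replaces a fermion by a combination of fermions with the same mode.
\<close>

lemma energy_space_subset_span_chi_words:
  "energy_space e \<subseteq> span {chi_word xs | xs. fst ` set xs \<subseteq> Idx \<and> energy xs = e}"
proof -
  let ?C = "\<lambda>e. span {chi_word xs | xs. fst ` set xs \<subseteq> Idx \<and> energy xs = e}"
  have chi: "chi x (- 1 - int t) v \<in> ?C (2 * int t + 1 + e)" if x: "x \<in> Idx" and v: "v \<in> ?C e" for x t v e
    using v
  proof (induction rule: span_induct_alt)
    case base
    then show ?case using x by (simp add: chi_linear span_zero)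
  next
    case (step c y z)
    then obtain ys where ys: "y = chi_word ys" "fst ` set ys \<subseteq> Idx" "energy ys = e" by blast
    have "chi x (- 1 - int t) y = chi_word ((x, t) # ys)" by (simp add: ys)
    also have "\<dots> \<in> ?C (2 * int t + 1 + e)"
      by (rule span_base) (rule CollectI, rule exI[of _ "(x, t) # ys"], use ys x in simp)
    finally show ?case using step x by (simp add: chi_linear span_add span_scale)
  qed
  have "creation_word Psi xs vac \<in> ?C (energy xs)" if "fst ` set xs \<subseteq> Idx" for xs
    using that
  proof (induction xs)
    case Nil
    then show ?case by (intro span_base CollectI exI[of _ "[]"]) simp
  next
    case (Cons x xs)
    let ?w = "creation_word Psi xs vac"
    obtain k i where ki: "fst x = (k, i)" by (cases "fst x")
    have I: "k \<in> {1..N}" "i \<in> {1..n}" using Cons.prems ki by auto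
    have "creation_word Psi (x # xs) vac = (\<Sum>a=1..n. split_coeff n (Suc n - a) i *s chi (k, a) (- 1 - int (snd x)) ?w)"
      by (simp only: creation_word_simps ki Psi_eq_chi[OF I])
    also have "\<dots> \<in> ?C (energy (x # xs))"
    proof (intro span_sum span_scale)
      fix a assume a: "a \<in> {1..n}"
      have w: "?w \<in> ?C (energy xs)" using Cons by simp
      show "chi (k, a) (- 1 - int (snd x)) ?w \<in> ?C (energy (x # xs))"
        using chi[OF _ w, of "(k, a)" "snd x"] I(1) a by simp
    qed
    finally show ?case .
  qed
  then show ?thesis
    unfolding energy_space_def by (intro span_minimal subspace_span) auto
qed

lemma chi_word_not_distinct:
  assumes "fst ` set xs \<subseteq> Idx" "\<not> distinct xs"
  shows "chi_word xs = 0"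
proof -
  obtain us vs ws x where xs: "xs = us @ [x] @ vs @ [x] @ ws"
    using not_distinct_decomp[OF assms(2)] by blast
  have x: "fst x \<in> Idx" using assms(1) by (auto simp: xs)
  have "chi (fst x) r (chi (fst x) r v) = 0" if "r < 0" for r v
  proof -
    have "chi (fst x) r (chi (fst x) r v) = - chi (fst x) r (chi (fst x) r v)"
      using chi_creation_anticommute[OF x x that that] .
    then have "2 *s chi (fst x) r (chi (fst x) r v) = 0"
      using scale_left_distrib[of 1 1 "chi (fst x) r (chi (fst x) r v)"] by (simp add: eq_neg_iff_add_eq_0)
    then show ?thesis by simp
  qed
  then have "chi_word (x # x # us @ vs @ ws) = 0" by simp
  moreover have "mset xs = mset (x # x # us @ vs @ ws)" by (simp add: xs)
  from creation_word_permute[OF chi_creation_anticommute chi_linear(3) this assms(1)]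
  have "chi_word xs = chi_word (x # x # us @ vs @ ws) \<or> chi_word xs = - chi_word (x # x # us @ vs @ ws)" .
  ultimately show ?thesis by auto
qed

lemma E_diagonal_word:
  assumes "a \<in> {1..n}" "fst ` set xs \<subseteq> Idx"
  shows "E a a (chi_word xs) = of_int (weight n a xs) *s chi_word xs"
  using assms(2)
proof (induction xs)
  case Nil
  then show ?case by (simp add: E_vac)
next
  case (Cons x xs)
  obtain k c where kc: "fst x = (k, c)" by (cases "fst x")
  have I: "k \<in> {1..N}" "c \<in> {1..n}" "(k, c) \<in> Idx" using Cons.prems kc by auto
  have IH: "E a a (chi_word xs) = of_int (weight n a xs) *s chi_word xs" using Cons by simp
  show ?case
    using E_chi[OF assms(1,1) I(1,2), of "- 1 - int (snd x)" "chi_word xs"]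
    by (auto simp: kc IH chi_linear(5)[OF I(3)] algebra_simps)
qed

text \<open>
  The commutator of \<open>E a b\<close> and \<open>E b a\<close> and the operator \<open>E a a - E b b\<close> both kill the vacuum and have
  the same commutators with the split fermions, so they agree on all words.
\<close>

lemma E_bracket_word:
  assumes a: "a \<in> {1..n}" and b: "b \<in> {1..n}" and ab: "a \<noteq> b" "b \<noteq> Suc n - a" and xs: "fst ` set xs \<subseteq> Idx"
  shows "E a b (E b a (chi_word xs)) = E b a (E a b (chi_word xs)) + E a a (chi_word xs) - E b b (chi_word xs)"
  using xs
proof (induction xs)
  case Nil
  then show ?case by (simp add: E_vac E_linear)
next
  case (Cons x xs)
  let ?a = "Suc n - a" and ?b = "Suc n - b"
  obtain k c where kc: "fst x = (k, c)" by (cases "fst x")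
  have I: "k \<in> {1..N}" "c \<in> {1..n}" "(k, c) \<in> Idx" using Cons.prems kc by auto
  have a': "?a \<in> {1..n}" and b': "?b \<in> {1..n}" using a b by auto
  have refl: "Suc n - ?a = a" "Suc n - ?b = b" using a b by auto
  have ne: "?a \<noteq> ?b" "?a \<noteq> b" "?b \<noteq> a" "a \<noteq> ?b" "b \<noteq> ?a" "b \<noteq> a" "a \<noteq> b"
    using ab a b by auto
  define w s where "w = chi_word xs" and "s = - 1 - int (snd x)"
  have IH: "E a b (E b a w) = E b a (E a b w) + E a a w - E b b w"
    using Cons by (simp add: w_def)
  note E1 = E_chi[OF a b I(1)] E_chi[OF b a I(1)] E_chi[OF a a I(1)] E_chi[OF b b I(1)]
  have if_E: "E p q (if P then y else 0) = (if P then E p q y else 0)" for p q P y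
    by (simp add: E_linear)
  have "E a b (E b a (chi (k, c) s w)) = E b a (E a b (chi (k, c) s w)) + E a a (chi (k, c) s w) - E b b (chi (k, c) s w)"
    using I(2) a b a' b'
    by (simp add: E1 E_linear if_E IH chi_linear[OF I(3)] refl ne)
  then show ?case by (simp add: kc w_def s_def)
qed

lemma E_raise_word:
  assumes a: "a \<in> {1..n}" and b: "b \<in> {1..n}" and xs: "fst ` set xs \<subseteq> Idx"
  shows "E a b (chi_word xs) \<in> span {chi_word ys | ys. fst ` set ys \<subseteq> Idx \<and> energy ys = energy xs
    \<and> height n ys = height n xs + 2 * (int b - int a)}"
  using xs
proof (induction xs)
  case Nil
  then show ?case by (simp add: E_vac span_zero)
next
  case (Cons x xs)
  let ?S = "\<lambda>xs. {chi_word ys | ys. fst ` set ys \<subseteq> Idx \<and> energy ys = energy xs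
    \<and> height n ys = height n xs + 2 * (int b - int a)}"
  obtain k c t where x: "x = ((k, c), t)" by (metis surj_pair)
  have I: "k \<in> {1..N}" "c \<in> {1..n}" "(k, c) \<in> Idx" and xs: "fst ` set xs \<subseteq> Idx" using Cons.prems x by auto
  have b': "Suc n - b \<in> {1..n}" using b by auto
  have A: "chi (k, c) (- 1 - int t) v \<in> span (?S (x # xs))" if "v \<in> span (?S xs)" for v
    using that
  proof (induction rule: span_induct_alt)
    case base
    then show ?case by (simp add: chi_linear[OF I(3)] span_zero)
  next
    case (step d y z)
    then obtain ys where ys: "y = chi_word ys" "fst ` set ys \<subseteq> Idx" "energy ys = energy xs"
      "height n ys = height n xs + 2 * (int b - int a)" by blast
    have "chi (k, c) (- 1 - int t) y = chi_word (x # ys)" by (simp add: ys x)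
    also have "\<dots> \<in> span (?S (x # xs))"
      by (rule span_base) (rule CollectI, rule exI[of _ "x # ys"], use ys I x in simp)
    finally show ?case using step by (simp add: chi_linear[OF I(3)] span_add span_scale)
  qed
  have B: "(if c = b then chi (k, a) (- 1 - int t) (chi_word xs) else 0) \<in> span (?S (x # xs))"
  proof (cases "c = b")
    case True
    have "chi_word (((k, a), t) # xs) \<in> span (?S (x # xs))"
      by (rule span_base) (rule CollectI, rule exI[of _ "((k, a), t) # xs"], use xs I x a True in simp)
    then show ?thesis using True by simp
  qed (simp add: span_zero)
  have C: "(if c = Suc n - a then chi (k, Suc n - b) (- 1 - int t) (chi_word xs) else 0) \<in> span (?S (x # xs))"
  proof (cases "c = Suc n - a")
    case True
    then have "int c = int n + 1 - int a" "int (Suc n - b) = int n + 1 - int b" using a b by auto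
    then have "chi_word (((k, Suc n - b), t) # xs) \<in> span (?S (x # xs))"
      by (intro span_base CollectI exI[of _ "((k, Suc n - b), t) # xs"]) (use xs I x b' in simp)
    then show ?thesis using True by simp
  qed (simp add: span_zero)
  have "E a b (chi_word xs) \<in> span (?S xs)" using Cons.IH xs by simp
  from span_diff[OF span_add[OF A[OF this] B] C]
  have "chi (k, c) (- 1 - int t) (E a b (chi_word xs)) + (if c = b then chi (k, a) (- 1 - int t) (chi_word xs) else 0)
    - (if c = Suc n - a then chi (k, Suc n - b) (- 1 - int t) (chi_word xs) else 0) \<in> span (?S (x # xs))" .
  then show ?case
    using E_chi[OF a b I(1,2), of "- 1 - int t" "chi_word xs"] by (simp only: x creation_word_simps fst_conv snd_conv)
qed

lemma E_energy_space: "a \<in> {1..n} \<Longrightarrow> b \<in> {1..n} \<Longrightarrow> v \<in> energy_space e \<Longrightarrow> E a b v \<in> energy_space e"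
  unfolding E_def using dual_current_energy_space[of _ _ 0 v e]
  by (intro subspace_sum subspace_energy_space subspace_scale[OF subspace_energy_space]) auto

lemma current_square_energy_space: "v \<in> energy_space e \<Longrightarrow> current_square v \<in> energy_space e"
  unfolding current_square_def using dual_current_energy_space[of _ _ 0 _ e]
  by (intro subspace_sum subspace_energy_space) auto

lemma twice_weight_op_energy_space:
  assumes "v \<in> energy_space e"
  shows "twice_weight_op v = of_int e *s v"
proof -
  have twice_weight_op_linear: "twice_weight_op (u + v) = twice_weight_op u + twice_weight_op v" "twice_weight_op (c *s v) = c *s twice_weight_op v" for u v c
    by (simp_all add: twice_weight_op_def sum.distrib scale_sum_right)
  have word: "twice_weight_op (creation_word Psi xs vac) = of_int (energy xs) *s creation_word Psi xs vac"
    if "fst ` set xs \<subseteq> Idx" for xs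
    using that
  proof (induction xs)
    case Nil
    then show ?case by (simp add: twice_weight_op_def creation)
  next
    case (Cons x xs)
    then have x: "fst x \<in> Idx" by auto
    let ?w = "creation_word Psi xs vac" and ?s = "- 1 - int (snd x)"
    have "twice_weight_op (Psi (fst x) ?s ?w) = of_int (energy xs) *s Psi (fst x) ?s ?w - of_int (2 * ?s + 1) *s Psi (fst x) ?s ?w"
      using Cons by (simp add: twice_weight_op_Psi[OF x] Psi_linear[OF x])
    also have "\<dots> = (of_int (energy xs) - of_int (2 * ?s + 1)) *s Psi (fst x) ?s ?w"
      by (simp only: scale_left_diff_distrib)
    also have "of_int (energy xs) - of_int (2 * ?s + 1) = (of_int (energy (x # xs)) :: complex)"
      by simp
    finally show ?case by simp
  qed
  have "twice_weight_op v - of_int e *s v \<in> {0}"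
    by (rule linear_energy_space_mapsto[where f="\<lambda>v. twice_weight_op v - of_int e *s v", OF _ _ subspace_single_0 _ assms])
      (auto simp: twice_weight_op_linear word scale_right_distrib scale_right_diff_distrib mult.commute)
  then show ?thesis by simp
qed

lemma defect_energy_space_eq: "v \<in> energy_space e \<Longrightarrow> defect v = current_square v + (2 * (of_nat N + of_nat n - 2) * of_int e) *s v"
  by (simp add: defect_def twice_weight_op_energy_space)

lemma defect_energy_space: "v \<in> energy_space e \<Longrightarrow> defect v \<in> energy_space e"
  by (simp add: defect_energy_space_eq current_square_energy_space subspace_add[OF subspace_energy_space] subspace_scale[OF subspace_energy_space])

lemma defect_E:
  assumes "a \<in> {1..n}" "b \<in> {1..n}" "v \<in> energy_space e"
  shows "defect (E a b v) = E a b (defect v)"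
proof -
  have current_square_sum: "current_square (\<Sum>i\<in>A. f i) = (\<Sum>i\<in>A. current_square (f i))" for A :: "nat set" and f
    unfolding current_square_def mode_sum_right by (subst sum.swap, subst (2) sum.swap) (rule refl)
  have current_square_scale: "current_square (c *s v) = c *s current_square v" for c v
    by (simp add: current_square_def scale_sum_right)
  have "current_square (E a b v) = E a b (current_square v)"
    unfolding E_def current_square_sum current_square_scale by (intro sum.cong refl) (simp add: current_square_J0)
  then show ?thesis
    using defect_energy_space_eq[OF assms(3)] defect_energy_space_eq[OF E_energy_space[OF assms]] by (simp add: E_linear)
qed

lemma sum_pairs_split:
  fixes f :: "nat \<Rightarrow> nat \<Rightarrow> 'v"
  shows "(\<Sum>a=1..n. \<Sum>b=1..n. f a b) = (\<Sum>a=1..n. f a a) + (\<Sum>a=1..n. \<Sum>b=1..n. if a < b then f a b + f b a else 0)"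
proof -
  have "(\<Sum>a=1..n. \<Sum>b=1..n. f a b) = (\<Sum>a=1..n. \<Sum>b=1..n. (if a = b then f a b else 0) +
     ((if a < b then f a b else 0) + (if b < a then f a b else 0)))"
    by (intro sum.cong refl) auto
  also have "\<dots> = (\<Sum>a=1..n. f a a) + ((\<Sum>a=1..n. \<Sum>b=1..n. if a < b then f a b else 0) + (\<Sum>a=1..n. \<Sum>b=1..n. if b < a then f a b else 0))"
    by (simp add: sum.distrib)
  also have "(\<Sum>a=1..n. \<Sum>b=1..n. if b < a then f a b else 0) = (\<Sum>a=1..n. \<Sum>b=1..n. if a < b then f b a else 0)"
    by (rule sum.swap)
  also have "(\<Sum>a=1..n. \<Sum>b=1..n. if a < b then f a b else 0) + \<dots> = (\<Sum>a=1..n. \<Sum>b=1..n. if a < b then f a b + f b a else 0)"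
    unfolding sum.distrib[symmetric] by (intro sum.cong refl) auto
  finally show ?thesis .
qed

text \<open>
  The sum over all \<open>E a b E b a\<close> splits into the squares of the Cartan elements and, for \<open>a < b\<close>, the
  terms \<open>2 * E b a E a b\<close> and a bracket.  The former are the only ones that are not multiples of the
  word, and they pass through words of larger height.
\<close>

lemma defect_word:
  assumes xs: "fst ` set xs \<subseteq> Idx"
  shows "defect (chi_word xs) = of_int (casimir_gap N n xs) *s chi_word xs
    - (\<Sum>a=1..n. \<Sum>b=1..n. if a < b then 2 *s E b a (E a b (chi_word xs)) else 0)"
proof -
  let ?w = "chi_word xs"
  have diag: "E a a (E a a ?w) = of_int ((weight n a xs)\<^sup>2) *s ?w" if "a \<in> {1..n}" for a
    using E_diagonal_word[OF that xs] by (simp add: E_linear power2_eq_square)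
  have off: "E a b (E b a ?w) + E b a (E a b ?w) = 2 *s E b a (E a b ?w) +
     of_int (if b \<noteq> Suc n - a then weight n a xs - weight n b xs else 0) *s ?w"
    if "a \<in> {1..n}" "b \<in> {1..n}" "a < b" for a b
  proof (cases "b = Suc n - a")
    case True
    then have "a = Suc n - b" using that by auto
    then have "E b a v = 0" for v using E_opposite[OF that(2), of v] by simp
    moreover have "E a b v = 0" for v using E_opposite[OF that(1), of v] True by simp
    ultimately show ?thesis using True by simp
  next
    case False
    with E_bracket_word[OF that(1,2) _ False xs] that E_diagonal_word[OF that(1) xs] E_diagonal_word[OF that(2) xs]
    have "E a b (E b a ?w) = E b a (E a b ?w) + of_int (weight n a xs) *s ?w - of_int (weight n b xs) *s ?w"
      by simp
    moreover have "2 *s E b a (E a b ?w) = E b a (E a b ?w) + E b a (E a b ?w)"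
      using scale_left_distrib[of 1 1 "E b a (E a b ?w)"] by simp
    ultimately show ?thesis using False by (simp add: scale_left_diff_distrib)
  qed
  let ?R = "\<Sum>a=1..n. \<Sum>b=1..n. if a < b then 2 *s E b a (E a b ?w) else 0"
  have "(\<Sum>a=1..n. \<Sum>b=1..n. E a b (E b a ?w)) = (\<Sum>a=1..n. of_int ((weight n a xs)\<^sup>2) *s ?w) +
     (\<Sum>a=1..n. \<Sum>b=1..n. (if a < b then 2 *s E b a (E a b ?w) else 0) +
      of_int (if a < b \<and> b \<noteq> Suc n - a then weight n a xs - weight n b xs else 0) *s ?w)"
    unfolding sum_pairs_split[of "\<lambda>a b. E a b (E b a ?w)"]
    by (intro arg_cong2[of _ _ _ _ "(+)"] sum.cong refl) (use diag off in auto)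
  also have "\<dots> = of_int ((\<Sum>a=1..n. (weight n a xs)\<^sup>2) +
      (\<Sum>a=1..n. \<Sum>b=1..n. if a < b \<and> b \<noteq> Suc n - a then weight n a xs - weight n b xs else 0)) *s ?w + ?R"
    unfolding sum.distrib of_int_add of_int_sum scale_left_distrib scale_sum_left by simp
  finally have "current_square ?w = - (of_int ((\<Sum>a=1..n. (weight n a xs)\<^sup>2) +
      (\<Sum>a=1..n. \<Sum>b=1..n. if a < b \<and> b \<noteq> Suc n - a then weight n a xs - weight n b xs else 0)) *s ?w) - ?R"
    unfolding current_square_eq_E by simp
  moreover define c where "c = (\<Sum>a=1..n. (weight n a xs)\<^sup>2) +
      (\<Sum>a=1..n. \<Sum>b=1..n. if a < b \<and> b \<noteq> Suc n - a then weight n a xs - weight n b xs else 0)"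
  ultimately have "defect ?w = (2 * (of_nat N + of_nat n - 2) * of_int (energy xs)) *s ?w - of_int c *s ?w - ?R"
    using defect_energy_space_eq[OF chi_word_energy_space[OF xs]] by simp
  also have "\<dots> = (2 * (of_nat N + of_nat n - 2) * of_int (energy xs) - of_int c) *s ?w - ?R"
    by (simp only: scale_left_diff_distrib)
  also have "(2 * (of_nat N + of_nat n - 2) * of_int (energy xs) - of_int c) = (of_int (casimir_gap N n xs) :: complex)"
    by (simp add: casimir_gap_def c_def)
  finally show ?thesis .
qed

section \<open>The commutant of the diagonal subalgebra\<close>

definition defect_product :: "int list \<Rightarrow> 'v \<Rightarrow> 'v"
  where "defect_product cs = foldr (\<lambda>c x. defect x - of_int c *s x) cs"

lemma defect_product_simps [simp]:
  "defect_product [] v = v"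
  "defect_product (c # cs) v = defect (defect_product cs v) - of_int c *s defect_product cs v"
  "defect_product (cs @ ds) v = defect_product cs (defect_product ds v)"
  by (simp_all add: defect_product_def)

lemma defect_product_linear:
  "defect_product cs (u + v) = defect_product cs u + defect_product cs v"
  "defect_product cs (c *s v) = c *s defect_product cs v"
  "defect_product cs 0 = 0"
  by (induction cs) (simp_all add: defect_linear scale_right_distrib scale_right_diff_distrib mult.commute)

lemma defect_product_commute: "defect_product cs (defect_product ds v) = defect_product ds (defect_product cs v)"
proof -
  have defect: "defect_product ds (defect x) = defect (defect_product ds x)" for ds x
    by (induction ds) (simp_all add: defect_linear)
  have diff: "defect_product ds (x - c *s y) = defect_product ds x - c *s defect_product ds y" for ds x y c
    using defect_product_linear(1)[of ds x "(- c) *s y"] defect_product_linear(2)[of ds "- c" y] by simp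
  show ?thesis
    by (induction cs) (simp_all add: defect diff)
qed

lemma defect_product_energy_space: "v \<in> energy_space e \<Longrightarrow> defect_product cs v \<in> energy_space e"
  by (induction cs)
    (simp_all add: defect_energy_space subspace_diff[OF subspace_energy_space] subspace_scale[OF subspace_energy_space])

lemma defect_product_E:
  assumes "a \<in> {1..n}" "b \<in> {1..n}" "v \<in> energy_space e"
  shows "defect_product cs (E a b v) = E a b (defect_product cs v)"
  by (induction cs) (simp_all add: defect_E[OF assms(1,2) defect_product_energy_space[OF assms(3)]] E_linear)

text \<open>
  The sums of generalized eigenvectors of \<open>defect\<close> for positive integral eigenvalues.
\<close>

definition positive_part :: "'v set"
  where "positive_part = {v. \<exists>cs. (\<forall>c\<in>set cs. c > 0) \<and> defect_product cs v = 0}"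

lemma subspace_positive_part: "subspace positive_part"
proof (rule subspaceI)
  show "0 \<in> positive_part"
    unfolding positive_part_def by (intro CollectI exI[of _ "[]"]) simp
  show "c *s v \<in> positive_part" if "v \<in> positive_part" for c v
    using that by (auto simp: positive_part_def defect_product_linear)
  show "u + v \<in> positive_part" if uv: "u \<in> positive_part" "v \<in> positive_part" for u v
  proof -
    obtain cs ds where "\<forall>c\<in>set cs. c > 0" "defect_product cs u = 0" "\<forall>c\<in>set ds. c > 0" "defect_product ds v = 0"
      using uv unfolding positive_part_def by blast
    then have "\<forall>c\<in>set (cs @ ds). c > 0" "defect_product (cs @ ds) (u + v) = 0"
      using defect_product_commute[of cs ds u] by (auto simp: defect_product_linear)
    then show ?thesis unfolding positive_part_def by blast
  qed
qed

text \<open>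
  By triangularity \<open>defect - casimir_gap\<close> maps a word to images under lowering operators of combinations of
  words of larger height and the same energy.  A product of factors that kills these combinations also
  kills their images, since \<open>defect\<close> commutes with \<open>E b a\<close>.  The height of words of a given energy is
  bounded, so the induction ends.
\<close>

lemma chi_word_positive_part:
  assumes n: "n \<ge> 3" and N: "odd N" and xs: "fst ` set xs \<subseteq> Idx" and e: "even (energy xs)" "energy xs > 0"
  shows "chi_word xs \<in> positive_part"
  using xs e
proof (induction "nat (int n * energy xs - height n xs)" arbitrary: xs rule: less_induct)
  case less
  let ?w = "chi_word xs"
  show ?case
  proof (cases "distinct xs")
    case False
    then show ?thesis
      using chi_word_not_distinct less.prems subspace_0[OF subspace_positive_part] by simp
  next
    case True
    have E: "E b a (E a b ?w) \<in> positive_part" if ab: "a \<in> {1..n}" "b \<in> {1..n}" "a < b" for a b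
    proof -
      let ?S = "{chi_word ys | ys. fst ` set ys \<subseteq> Idx \<and> energy ys = energy xs
        \<and> height n ys = height n xs + 2 * (int b - int a)}"
      have "?S \<subseteq> positive_part"
      proof
        fix v assume "v \<in> ?S"
        then obtain ys where ys: "v = chi_word ys" "fst ` set ys \<subseteq> Idx" "energy ys = energy xs"
          "height n ys = height n xs + 2 * (int b - int a)" by blast
        have "height n ys \<le> int n * energy xs" using height_le[OF ys(2)] ys(3) by simp
        then have "nat (int n * energy ys - height n ys) < nat (int n * energy xs - height n xs)"
          using ys(3,4) ab(3) by simp
        then show "v \<in> positive_part" using less.hyps[of ys] ys less.prems by simp
      qed
      then have "E a b ?w \<in> positive_part"
        using E_raise_word[OF ab(1,2) less.prems(1)] span_minimal[OF _ subspace_positive_part] by blast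
      then obtain cs where cs: "\<forall>c\<in>set cs. c > 0" "defect_product cs (E a b ?w) = 0"
        unfolding positive_part_def by blast
      have "E a b ?w \<in> energy_space (energy xs)"
        by (rule E_energy_space[OF ab(1,2) chi_word_energy_space[OF less.prems(1)]])
      from defect_product_E[OF ab(2,1) this, of cs] have "defect_product cs (E b a (E a b ?w)) = 0"
        by (simp add: cs E_linear)
      with cs(1) show ?thesis unfolding positive_part_def by blast
    qed
    let ?R = "\<Sum>a=1..n. \<Sum>b=1..n. if a < b then 2 *s E b a (E a b ?w) else 0"
    have "?R \<in> positive_part"
    proof (intro subspace_sum subspace_positive_part)
      fix a b assume "a \<in> {1..n}" "b \<in> {1..n}"
      then show "(if a < b then 2 *s E b a (E a b ?w) else 0) \<in> positive_part"
        using E subspace_scale[OF subspace_positive_part] subspace_0[OF subspace_positive_part] by simp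
    qed
    then obtain cs where cs: "\<forall>c\<in>set cs. c > 0" "defect_product cs ?R = 0"
      unfolding positive_part_def by blast
    have "defect ?w - of_int (casimir_gap N n xs) *s ?w = (-1) *s ?R"
      using defect_word[OF less.prems(1)] by simp
    then have "defect_product (cs @ [casimir_gap N n xs]) ?w = (-1) *s defect_product cs ?R"
      by (simp only: defect_product_simps defect_product_linear)
    moreover have "casimir_gap N n xs > 0"
      by (rule casimir_gap_pos[OF n N True less.prems])
    ultimately show ?thesis
      unfolding positive_part_def using cs by (intro CollectI exI[of _ "cs @ [casimir_gap N n xs]"]) auto
  qed
qed

lemma energy_space_positive_part:
  assumes "n \<ge> 3" "odd N" "even e" "e > 0"
  shows "energy_space e \<subseteq> positive_part"
proof -
  have "{chi_word xs | xs. fst ` set xs \<subseteq> Idx \<and> energy xs = e} \<subseteq> positive_part"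
    using chi_word_positive_part[OF assms(1,2)] assms(3,4) by blast
  then have "span {chi_word xs | xs. fst ` set xs \<subseteq> Idx \<and> energy xs = e} \<subseteq> positive_part"
    by (rule span_minimal[OF _ subspace_positive_part])
  with energy_space_subset_span_chi_words show ?thesis by blast
qed

lemma energy_space_negative: "e < 0 \<Longrightarrow> energy_space e = {0}"
proof -
  assume "e < 0"
  then have "energy xs \<noteq> e" for xs :: "((nat \<times> nat) \<times> nat) list"
    using energy_ge_length[of xs] by linarith
  then show ?thesis unfolding energy_space_def by simp
qed

definition even_energy_space :: "int \<Rightarrow> 'v set"
  where "even_energy_space m = span (\<Union>e\<in>{e. even e \<and> e \<le> m}. energy_space e)"

lemma even_energy_space_mapsto:
  assumes lin: "\<And>u v. f (u + v) = f u + f v" "\<And>c v. f (c *s v) = c *s f v"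
    and deg: "\<And>v e. even e \<Longrightarrow> e \<le> m \<Longrightarrow> v \<in> energy_space e \<Longrightarrow> f v \<in> even_energy_space m'" and v: "v \<in> even_energy_space m"
  shows "f v \<in> even_energy_space m'"
  using v unfolding even_energy_space_def[of m]
proof (induction rule: span_induct_alt)
  case base
  show ?case using lin(2)[of 0 0] by (simp add: even_energy_space_def span_zero)
next
  case (step c x y)
  then obtain e where "even e" "e \<le> m" "x \<in> energy_space e" by blast
  then have "f x \<in> even_energy_space m'" by (rule deg)
  then have "c *s f x + f y \<in> even_energy_space m'"
    using step(2) unfolding even_energy_space_def by (intro span_add span_scale)
  then show ?case by (simp only: lin)
qed

lemma energy_space_even_energy_space: "even e \<Longrightarrow> e \<le> m \<Longrightarrow> energy_space e \<subseteq> even_energy_space m"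
  unfolding even_energy_space_def by (rule order_trans[OF _ span_superset], rule UN_upper) simp

lemma even_energy_space_mono: "m \<le> m' \<Longrightarrow> even_energy_space m \<subseteq> even_energy_space m'"
  unfolding even_energy_space_def by (intro span_mono UN_mono) auto

lemma even_mem_even_energy_space:
  assumes "v \<in> V False"
  shows "\<exists>m. v \<in> even_energy_space m"
  using assms unfolding even_eq_span_words
proof (induction rule: span_induct_alt)
  case base
  show ?case by (auto simp: even_energy_space_def span_zero)
next
  case (step c x y)
  then obtain xs where xs: "x = creation_word Psi xs vac" "fst ` set xs \<subseteq> Idx" "even (length xs)" by blast
  have "even (energy xs)" using xs(3) by (simp add: even_energy_iff)
  then have "x \<in> even_energy_space (energy xs)"
    using energy_space_even_energy_space[of "energy xs" "energy xs"] creation_word_energy_space[OF xs(2) refl] unfolding xs(1) by auto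
  moreover obtain m where "y \<in> even_energy_space m" using step by blast
  ultimately have "x \<in> even_energy_space (max m (energy xs))" "y \<in> even_energy_space (max m (energy xs))"
    using even_energy_space_mono[OF max.cobounded1[of m "energy xs"]] even_energy_space_mono[OF max.cobounded2[of "energy xs" m]] by blast+
  then have "c *s x + y \<in> even_energy_space (max m (energy xs))"
    unfolding even_energy_space_def by (intro span_add span_scale)
  then show ?case ..
qed

text \<open>
  The induction is on the energy.  Positive modes of the dual currents preserve the invariants and lower
  the energy, so \<open>defect\<close> maps the invariants of energy at most \<open>m\<close> into the subalgebra.  Modulo the
  vacuum every vector of even energy is killed by a product of operators \<open>defect - c\<close> with \<open>c > 0\<close>, and
  the factors of this product can be removed one at a time.
\<close>

lemma diagonal_invariants_even_energy_space_subset_dual: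
  assumes n: "n \<ge> 3" and N: "odd N"
  shows "diagonal_invariants \<inter> even_energy_space m \<subseteq> so_dual scale Y vac psi N n"
proof (induction "nat (m + 1)" arbitrary: m rule: less_induct)
  case less
  let ?U = "so_dual scale Y vac psi N n"
  have U: "subspace ?U" "vac \<in> ?U" using vertex_subalgebra_dual by (auto simp: vertex_subalgebra_def)
  show ?case
  proof (cases "m < 0")
    case True
    have "energy_space e = {0}" if "e \<le> m" for e using energy_space_negative that True by simp
    then have "(\<Union>e\<in>{e. even e \<and> e \<le> m}. energy_space e) \<subseteq> {0}" by auto
    then have "even_energy_space m \<subseteq> {0}"
      unfolding even_energy_space_def by (rule span_minimal) (rule subspace_single_0)
    then show ?thesis using U subspace_0 by blast
  next
    case False
    have defect_U: "defect z \<in> ?U" if z: "z \<in> diagonal_invariants" "z \<in> even_energy_space m" for z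
    proof (rule defect_mem_dual[OF z(1)])
      fix i j r assume ij: "i \<in> {1..n}" "j \<in> {1..n}" and r: "(r::int) \<ge> 1"
      have "Y (dual_current i j) r z \<in> even_energy_space (m - 2 * r)"
      proof (rule even_energy_space_mapsto[where f="Y (dual_current i j) r", OF _ _ _ z(2)])
        fix v e assume "even e" "e \<le> m" "v \<in> energy_space e"
        then show "Y (dual_current i j) r v \<in> even_energy_space (m - 2 * r)"
          using dual_current_energy_space[OF ij, of r v e] energy_space_even_energy_space[of "e - 2 * r" "m - 2 * r"] r by auto
      qed simp_all
      moreover have "Y (dual_current i j) r z \<in> diagonal_invariants"
        by (rule dual_current_diagonal_invariants[OF ij z(1)])
      moreover have "nat (m - 2 * r + 1) < nat (m + 1)" using r False by simp
      ultimately show "Y (dual_current i j) r z \<in> ?U" using less by blast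
    qed
    have defect_even_energy_space: "defect z \<in> even_energy_space m" if "z \<in> even_energy_space m" for z
    proof (rule even_energy_space_mapsto[where f=defect, OF _ _ _ that])
      fix v e assume "even e" "e \<le> m" "v \<in> energy_space e"
      then show "defect v \<in> even_energy_space m" using defect_energy_space energy_space_even_energy_space by blast
    qed (simp_all add: defect_linear)
    have stable: "defect_product cs y \<in> diagonal_invariants \<inter> even_energy_space m" if "y \<in> diagonal_invariants \<inter> even_energy_space m" for cs y
    proof (induction cs)
      case (Cons c cs)
      then have "defect (defect_product cs y) \<in> diagonal_invariants \<inter> even_energy_space m"
        using defect_U defect_even_energy_space so_dual_subset_invariants by blast
      moreover have "subspace (diagonal_invariants \<inter> even_energy_space m)"
        unfolding even_energy_space_def by (intro subspace_inter subspace_diagonal_invariants subspace_span)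
      ultimately show ?case
        using Cons by (simp only: defect_product_simps subspace_diff subspace_scale)
    qed (use that in simp)
    \<comment> \<open>If \<open>defect z\<close> and \<open>defect z - c z\<close> lie in the subalgebra and \<open>c \<noteq> 0\<close>, then so does \<open>z\<close>.\<close>
    have peel: "y \<in> ?U" if "y \<in> diagonal_invariants \<inter> even_energy_space m" "defect_product cs y \<in> ?U" "\<forall>c\<in>set cs. c > 0" for cs y
      using that(2,3)
    proof (induction cs)
      case (Cons c cs)
      let ?z = "defect_product cs y"
      have "defect ?z \<in> ?U" using stable[OF that(1), of cs] defect_U by blast
      moreover have "defect ?z - of_int c *s ?z \<in> ?U" using Cons.prems by simp
      ultimately have "of_int c *s ?z \<in> ?U"
        using subspace_diff[OF U(1), of "defect ?z" "defect ?z - of_int c *s ?z"] by simp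
      then have "inverse (of_int c) *s (of_int c *s ?z) \<in> ?U" by (rule subspace_scale[OF U(1)])
      moreover have "c \<noteq> 0" using Cons.prems by auto
      ultimately have "?z \<in> ?U" by simp
      with Cons show ?case by simp
    qed simp
    show ?thesis
    proof
      fix v assume v: "v \<in> diagonal_invariants \<inter> even_energy_space m"
      define S where "S = (\<Union>e\<in>{e. even e \<and> e \<le> m \<and> e \<noteq> 0}. energy_space e)"
      have "(\<Union>e\<in>{e. even e \<and> e \<le> m}. energy_space e) \<subseteq> energy_space 0 \<union> S"
        unfolding S_def by auto
      then have "v \<in> span (energy_space 0 \<union> S)" using v span_mono unfolding even_energy_space_def by blast
      then obtain x y where xy: "v = x + y" "x \<in> span (energy_space 0)" "y \<in> span S"
        unfolding span_Un by blast
      have "creation_word Psi xs vac = vac" if "energy xs = 0" for xs :: "((nat \<times> nat) \<times> nat) list"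
        using energy_ge_length[of xs] that by simp
      then have "{creation_word Psi xs vac | xs. fst ` set xs \<subseteq> Idx \<and> energy xs = 0} \<subseteq> ?U" using U by auto
      then have "energy_space 0 \<subseteq> ?U" unfolding energy_space_def by (rule span_minimal[OF _ U(1)])
      then have x: "x \<in> ?U" using xy(2) span_minimal[OF _ U(1)] by blast
      have "energy_space e \<subseteq> positive_part" if "even e" "e \<noteq> 0" for e
        using energy_space_positive_part[OF n N that(1)] energy_space_negative[of e] subspace_0[OF subspace_positive_part] that
        by (cases "e > 0") auto
      then have "S \<subseteq> positive_part" unfolding S_def by blast
      then have "y \<in> positive_part" using xy(3) span_minimal[OF _ subspace_positive_part] by blast
      then obtain cs where cs: "\<forall>c\<in>set cs. c > 0" "defect_product cs y = 0"
        unfolding positive_part_def by blast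
      have "y = v - x" using xy(1) by simp
      then have "y \<in> diagonal_invariants"
        using subspace_diff[OF subspace_diagonal_invariants] v x so_dual_subset_invariants by blast
      moreover have "S \<subseteq> (\<Union>e\<in>{e. even e \<and> e \<le> m}. energy_space e)" unfolding S_def by blast
      then have "y \<in> even_energy_space m" using xy(3) span_mono unfolding even_energy_space_def by blast
      ultimately have "y \<in> ?U" using peel[of y cs] cs U subspace_0 by auto
      with x show "v \<in> ?U" unfolding xy(1) by (rule subspace_add[OF U(1)])
    qed
  qed
qed

lemma commutant_even_eq_dual:
  assumes "n \<ge> 3" "odd N"
  shows "commutant Y (V False) (so_diagonal scale Y vac psi N n) = so_dual scale Y vac psi N n"
proof
  show "commutant Y (V False) (so_diagonal scale Y vac psi N n) \<subseteq> so_dual scale Y vac psi N n"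
  proof
    fix v assume "v \<in> commutant Y (V False) (so_diagonal scale Y vac psi N n)"
    then have v: "v \<in> diagonal_invariants" by (simp add: commutant_even_eq)
    then obtain m where "v \<in> even_energy_space m"
      using even_mem_even_energy_space[of v] by (auto simp: diagonal_invariants_def)
    with v diagonal_invariants_even_energy_space_subset_dual[OF assms, of m] show "v \<in> so_dual scale Y vac psi N n" by blast
  qed
  show "so_dual scale Y vac psi N n \<subseteq> commutant Y (V False) (so_diagonal scale Y vac psi N n)"
    unfolding commutant_even_eq by (rule so_dual_subset_invariants)
qed

text \<open>
  Passing to the commutant and passing to the fixed points of the \<open>\<sigma>\<^sub>i\<close> are both conditions on single
  vectors of the even part, so their order does not matter.
\<close>

lemma commutant_tensor_power:
  assumes n: "n \<ge> 3" and N: "odd N" "N \<ge> 3"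
    and sigma: "\<And>i. i \<in> {1..n} \<Longrightarrow> is_sigma scale Y vac psi (V False) N n i (\<sigma> i)"
  shows "commutant Y (so_tensor_power scale Y vac psi N n) (so_diagonal scale Y vac psi N n)
    = fixed_points (generate (BijGroup (V False)) (\<sigma> ` {1..n})) (so_dual scale Y vac psi N n)"
proof -
  have sub: "so_dual scale Y vac psi N n \<subseteq> V False"
    using so_dual_subset_invariants by (auto simp: diagonal_invariants_def)
  have bij: "\<sigma> i \<in> Bij (V False)" if "i \<in> {1..n}" for i
    using sigma[OF that] by (simp add: is_sigma_def vertex_automorphisms_def)
  have n1: "n \<ge> 1" using n by simp
  have restrict: "commutant Y {v \<in> A. P v} U = {v \<in> commutant Y A U. P v}" for A U P
    by (auto simp: commutant_def)
  have tensor: "so_tensor_power scale Y vac psi N n = {v \<in> V False. \<forall>i\<in>{1..n}. \<sigma> i v = v}"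
    by (rule tensor_power_eq_sigma_fixed[OF N(2) n1], rule sigma)
  have "commutant Y (so_tensor_power scale Y vac psi N n) (so_diagonal scale Y vac psi N n)
    = {v \<in> commutant Y (V False) (so_diagonal scale Y vac psi N n). \<forall>i\<in>{1..n}. \<sigma> i v = v}"
    unfolding tensor by (rule restrict)
  also have "\<dots> = fixed_points (generate (BijGroup (V False)) (\<sigma> ` {1..n})) (so_dual scale Y vac psi N n)"
    unfolding commutant_even_eq_dual[OF n N(1)] by (rule fixed_points_generate[OF bij sub, symmetric])
  finally show ?thesis .
qed

end

theorem theorem4p17:
  fixes m n :: nat
    and scale :: "complex \<Rightarrow> 'v::ab_group_add \<Rightarrow> 'v"
    and V :: "bool \<Rightarrow> 'v set"
    and Y :: "'v \<Rightarrow> int \<Rightarrow> 'v \<Rightarrow> 'v"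
    and vac :: 'v
    and psi :: "nat \<Rightarrow> nat \<Rightarrow> int \<Rightarrow> 'v \<Rightarrow> 'v"
    and \<sigma> :: "nat \<Rightarrow> 'v \<Rightarrow> 'v"
    and G :: "('v \<Rightarrow> 'v) set"
  assumes "m \<ge> 2"
    and "fermionic_vertex_superalgebra scale V Y vac (2 * m + 1) n psi"
    and "\<And>i. i \<in> {1..n} \<Longrightarrow> is_sigma scale Y vac psi (V False) (2 * m + 1) n i (\<sigma> i)"
    and "G = generate (BijGroup (V False)) (\<sigma> ` {1..n})"
  shows "(n = 3 \<longrightarrow>
      commutant Y (so_tensor_power scale Y vac psi (2 * m + 1) 3)
        (so_diagonal scale Y vac psi (2 * m + 1) 3) =
      fixed_points G (sl2_dual scale Y vac psi (2 * m + 1))) \<and>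
    (n \<ge> 4 \<longrightarrow>
      commutant Y (so_tensor_power scale Y vac psi (2 * m + 1) n)
        (so_diagonal scale Y vac psi (2 * m + 1) n) =
      fixed_points G (so_dual scale Y vac psi (2 * m + 1) n))"
proof -
  interpret fermionic_vertex_superalgebra scale V Y vac "2 * m + 1" n psi
    by (rule assms(2))
  have "commutant Y (so_tensor_power scale Y vac psi (2 * m + 1) n) (so_diagonal scale Y vac psi (2 * m + 1) n)
    = fixed_points G (so_dual scale Y vac psi (2 * m + 1) n)" if "n \<ge> 3"
    unfolding assms(4) by (rule commutant_tensor_power) (use that assms(1,3) in auto)
  then show ?thesis unfolding sl2_dual_def by auto
qed

end
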